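(* Let $R$ be a reduced root system in $\mathbb{R}^m$ with positive subsystem $R_+$, reflection group $W$ and positive Weyl chamber $C$, and let $k:R\to\mathbb{R}$ be $W$-invariant with $k(\alpha)\ge 1/2$ for all $\alpha\in R$. Define $$g(x)=\int_C e^{-|y|^2/2}D_k^W(x,y)\prod_{\alpha\in R_+}\langle\alpha,y\rangle\,dy .$$ Then $g$ is an eigenfunction of $-\mathscr{J}_k=\Delta_k-\sum_{i=1}^m x_i\partial_i$ corresponding to the eigenvalue $m+|R_+|$, that is, $$-\mathscr{J}_k\,g=(m+|R_+|)\,g .$$
   Context: A reduced root system $R$ in a Euclidean space $V$ of dimension $m$ (identified with $\mathbb{R}^m$) is a finite set of nonzero vectors spanning $V$ such that $R\cap\mathbb{R}\alpha=\{\alpha,-\alpha\}$ and $\sigma_\alpha(R)=R$ for all $\alpha\in R$, where $\sigma_\alpha(x)=x-2\frac{\langle\alpha,x\rangle}{\langle\alpha,\alpha\rangle}\alpha$; $W$ is generated by the $\sigma_\alpha$. $R_+$ is the set of roots that are nonnegative combinations of a simple system $\Delta$ (a basis of $V$ contained in $R$ such that each root has coefficients all of the same sign), and $C=\{x:\langle\alpha,x\rangle>0\ \forall\alpha\in R_+\}$. $|R_+|$ is the cardinality of $R_+$. The Dunkl operators are $T_if(x)=\partial_if(x)+\sum_{\alpha\in R_+}k(\alpha)\alpha_i\frac{f(x)-f(\sigma_\alpha x)}{\langle\alpha,x\rangle}$, $1\le i\le m$; the Dunkl Laplacian is $\Delta_k=\sum_{i=1}^mT_i^2$. The Dunkl kernel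 $D_k(x,y)$ is, for each $y$, the unique real-analytic function of $x\in\mathbb{R}^m$ with $T_i^xD_k(x,y)=y_iD_k(x,y)$ for all $i$ and $D_k(0,y)=1$. Set $D_k^W(x,y)=\sum_{w\in W}D_k(x,wy)$ and $\mathscr{J}_k=-\Delta_k+\sum_{i=1}^mx_i\partial_i$. *)

theory Defs
  imports "HOL-Analysis.Analysis"
begin

section \<open>Root systems and reflection groups\<close>

definition reflection :: "real ^ 'm \<Rightarrow> real ^ 'm \<Rightarrow> real ^ 'm" where
  "reflection \<alpha> x = x - (2 * (\<alpha> \<bullet> x) / (\<alpha> \<bullet> \<alpha>)) *\<^sub>R \<alpha>"

definition reduced_root_system :: "(real ^ 'm) set \<Rightarrow> bool" where
  "reduced_root_system R \<longleftrightarrow>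
     finite R \<and> 0 \<notin> R \<and> span R = UNIV \<and>
     (\<forall>\<alpha>\<in>R. R \<inter> range (\<lambda>c. c *\<^sub>R \<alpha>) = {\<alpha>, - \<alpha>}) \<and>
     (\<forall>\<alpha>\<in>R. reflection \<alpha> ` R = R)"

(* The generators are involutions, so closure under left multiplication by generators
   already yields the generated group. *)
inductive_set refl_group :: "(real ^ 'm) set \<Rightarrow> (real ^ 'm \<Rightarrow> real ^ 'm) set"
  for R :: "(real ^ 'm) set" where
  refl_group_id: "id \<in> refl_group R"
| refl_group_comp: "\<alpha> \<in> R \<Longrightarrow> w \<in> refl_group R \<Longrightarrow> reflection \<alpha> \<circ> w \<in> refl_group R"

definition simple_system :: "(real ^ 'm) set \<Rightarrow> (real ^ 'm) set \<Rightarrow> bool" where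
  "simple_system R S \<longleftrightarrow>
     S \<subseteq> R \<and> independent S \<and> span S = UNIV \<and>
     (\<forall>\<beta>\<in>R. \<exists>c. \<beta> = (\<Sum>\<alpha>\<in>S. c \<alpha> *\<^sub>R \<alpha>) \<and>
        ((\<forall>\<alpha>\<in>S. 0 \<le> c \<alpha>) \<or> (\<forall>\<alpha>\<in>S. c \<alpha> \<le> 0)))"

definition positive_roots :: "(real ^ 'm) set \<Rightarrow> (real ^ 'm) set \<Rightarrow> (real ^ 'm) set" where
  "positive_roots R S =
     {\<beta>\<in>R. \<exists>c. (\<forall>\<alpha>\<in>S. 0 \<le> c \<alpha>) \<and> \<beta> = (\<Sum>\<alpha>\<in>S. c \<alpha> *\<^sub>R \<alpha>)}"

definition positive_subsystem :: "(real ^ 'm) set \<Rightarrow> (real ^ 'm) set \<Rightarrow> bool" where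
  "positive_subsystem R P \<longleftrightarrow> (\<exists>S. simple_system R S \<and> P = positive_roots R S)"

definition weyl_chamber :: "(real ^ 'm) set \<Rightarrow> (real ^ 'm) set" where
  "weyl_chamber P = {x. \<forall>\<alpha>\<in>P. 0 < \<alpha> \<bullet> x}"


section \<open>Differentiability notions\<close>

definition partial :: "'m \<Rightarrow> (real ^ 'm \<Rightarrow> real) \<Rightarrow> real ^ 'm \<Rightarrow> real" where
  "partial i f x = deriv (\<lambda>t. f (x + t *\<^sub>R axis i 1)) 0"

definition C1_fun :: "(real ^ 'm \<Rightarrow> real) \<Rightarrow> bool" where
  "C1_fun f \<longleftrightarrow> (\<forall>x. f differentiable (at x)) \<and> (\<forall>i. continuous_on UNIV (partial i f))"

definition C2_fun :: "(real ^ 'm \<Rightarrow> real) \<Rightarrow> bool" where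
  "C2_fun f \<longleftrightarrow> C1_fun f \<and> (\<forall>i. C1_fun (partial i f))"

(* Multi-indices are functions from the finite coordinate type to nat; the power series
   converges unconditionally (equivalently, absolutely) in a ball around each point. *)
definition real_analytic :: "(real ^ 'm \<Rightarrow> real) \<Rightarrow> bool" where
  "real_analytic f \<longleftrightarrow>
     (\<forall>x0. \<exists>r>0. \<exists>a :: ('m \<Rightarrow> nat) \<Rightarrow> real. \<forall>x\<in>ball x0 r.
        ((\<lambda>\<nu>. a \<nu> * (\<Prod>i\<in>UNIV. (x $ i - x0 $ i) ^ \<nu> i)) has_sum f x) UNIV)"


section \<open>Dunkl operators\<close>

(* On the hyperplane orthogonal to the root the quotient reads 0/0; as usual, it is
   understood there through its continuous extension, which exists for every C1 function. *)
definition dunkl_quotient :: "real ^ 'm \<Rightarrow> (real ^ 'm \<Rightarrow> real) \<Rightarrow> real ^ 'm \<Rightarrow> real" where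
  "dunkl_quotient \<alpha> f x =
     (if \<alpha> \<bullet> x \<noteq> 0 then (f x - f (reflection \<alpha> x)) / (\<alpha> \<bullet> x)
      else Lim (at x within {z. \<alpha> \<bullet> z \<noteq> 0}) (\<lambda>z. (f z - f (reflection \<alpha> z)) / (\<alpha> \<bullet> z)))"

definition dunkl_op ::
    "(real ^ 'm) set \<Rightarrow> (real ^ 'm \<Rightarrow> real) \<Rightarrow> 'm \<Rightarrow> (real ^ 'm \<Rightarrow> real) \<Rightarrow> real ^ 'm \<Rightarrow> real" where
  "dunkl_op P k i f x = partial i f x + (\<Sum>\<alpha>\<in>P. k \<alpha> * \<alpha> $ i * dunkl_quotient \<alpha> f x)"

definition dunkl_laplacian ::
    "(real ^ 'm) set \<Rightarrow> (real ^ 'm \<Rightarrow> real) \<Rightarrow> (real ^ 'm \<Rightarrow> real) \<Rightarrow> real ^ 'm \<Rightarrow> real" where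
  "dunkl_laplacian P k f x = (\<Sum>i\<in>UNIV. dunkl_op P k i (dunkl_op P k i f) x)"

definition dunkl_J ::
    "(real ^ 'm) set \<Rightarrow> (real ^ 'm \<Rightarrow> real) \<Rightarrow> (real ^ 'm \<Rightarrow> real) \<Rightarrow> real ^ 'm \<Rightarrow> real" where
  "dunkl_J P k f x = - dunkl_laplacian P k f x + (\<Sum>i\<in>UNIV. x $ i * partial i f x)"


section \<open>The Dunkl kernel\<close>

definition dunkl_kernel ::
    "(real ^ 'm) set \<Rightarrow> (real ^ 'm \<Rightarrow> real) \<Rightarrow> real ^ 'm \<Rightarrow> real ^ 'm \<Rightarrow> real" where
  "dunkl_kernel P k x y =
     (THE f. real_analytic f \<and> (\<forall>i z. dunkl_op P k i f z = y $ i * f z) \<and> f 0 = 1) x"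

definition dunkl_kernel_sym ::
    "(real ^ 'm) set \<Rightarrow> (real ^ 'm) set \<Rightarrow> (real ^ 'm \<Rightarrow> real) \<Rightarrow> real ^ 'm \<Rightarrow> real ^ 'm \<Rightarrow> real" where
  "dunkl_kernel_sym R P k x y = (\<Sum>w\<in>refl_group R. dunkl_kernel P k x (w y))"

definition g_integrand ::
    "(real ^ 'm) set \<Rightarrow> (real ^ 'm) set \<Rightarrow> (real ^ 'm \<Rightarrow> real) \<Rightarrow> real ^ 'm \<Rightarrow> real ^ 'm \<Rightarrow> real" where
  "g_integrand R P k x y =
     exp (- (norm y)\<^sup>2 / 2) * dunkl_kernel_sym R P k x y * (\<Prod>\<alpha>\<in>P. \<alpha> \<bullet> y)"

definition g_fun ::
    "(real ^ 'm) set \<Rightarrow> (real ^ 'm) set \<Rightarrow> (real ^ 'm \<Rightarrow> real) \<Rightarrow> real ^ 'm \<Rightarrow> real" where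
  "g_fun R P k x = (LINT y:weyl_chamber P|lborel. g_integrand R P k x y)"

(* Second-order operators act on C2 functions in the classical sense; requiring C2 rules
   out equations that hold only through default values of derivatives and limits. *)
definition eigenfunction ::
    "((real ^ 'm \<Rightarrow> real) \<Rightarrow> real ^ 'm \<Rightarrow> real) \<Rightarrow> real \<Rightarrow> (real ^ 'm \<Rightarrow> real) \<Rightarrow> bool" where
  "eigenfunction L c f \<longleftrightarrow> C2_fun f \<and> f \<noteq> (\<lambda>_. 0) \<and> (\<forall>x. L f x = c * f x)"

end

theory Submission
  imports Defs "HOL-Probability.Distributions"
begin

text \<open>
  The kernel is built as a sum of its homogeneous components \<open>D\<^sub>n\<close>: the equation
  \<open>(\<Sum>i. x\<^sub>i T\<^sub>i) D\<^sub>n = \<langle>x, y\<rangle> D\<^sub>n\<^sub>-\<^sub>1\<close> determines \<open>D\<^sub>n\<close> from \<open>D\<^sub>n\<^sub>-\<^sub>1\<close> because \<open>k \<ge> 0\<close>, and the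
  recursion gives factorially decaying bounds. That each single equation
  \<open>T\<^sub>i D\<^sub>n = y\<^sub>i D\<^sub>n\<^sub>-\<^sub>1\<close> holds follows from the commutativity of the \<open>T\<^sub>i\<close> and a maximum principle
  for the defect; uniqueness of the kernel is a maximum principle along rays as well.

  For \<open>g\<close>, differentiation under the integral turns \<open>\<Delta>\<^sub>k\<close> into multiplication of the integrand by
  \<open>|y|\<^sup>2\<close>. The Euler field is computed without integrating by parts: as \<open>D\<^sub>k(tx, y) = D\<^sub>k(x, ty)\<close>, a dilation
  of the chamber gives \<open>t\<^sup>N g(tx) = \<integral> exp (- |y|\<^sup>2 / 2t\<^sup>2) \<dots> dy\<close> with \<open>N = m + |R\<^sub>+|\<close>, and differentiating
  at \<open>t = 1\<close> produces the same \<open>|y|\<^sup>2\<close> term minus \<open>N g\<close>.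
\<close>

section \<open>Differentiation under the integral sign\<close>

text \<open>\<open>dunkl_kernel\<close> is a definite description, so nothing can be said about it
  before one function is shown to meet the specification and every other such function to coincide
  with it. Meeting it demands analyticity at every centre, while the homogeneous sum is an expansion
  at 0; its summands are therefore recentred together with a bound on the absolute sum of their
  coefficients that survives infinite summation. A second obstacle is the limit value of the
  difference quotient on root hyperplanes. For polynomials the quotient is again a polynomial, so
  identities are proved at regular points and extended by continuity. For C1 functions the limit is
  a directional derivative, hence linear in the function, and Dunkl operators pass through sums and
  integrals at singular points too. Series and Gaussian integrals are handled by one argument, as
  integrals over counting and Lebesgue measure; exponential bounds on the kernel and its first two
  derivatives supply the majorants. The number N collects the exponent m of the Jacobian of a
  dilation and the degree of the product of the positive roots.\<close>

lemma continuous_at_integral: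
  fixes f :: "'a::real_normed_vector \<Rightarrow> 'b \<Rightarrow> real"
  assumes "e > 0"
    and cont: "\<And>z. z \<in> space M \<Longrightarrow> isCont (\<lambda>x. f x z) x0"
    and meas: "\<And>x. x \<in> ball x0 e \<Longrightarrow> f x \<in> borel_measurable M"
    and bound: "\<And>x z. x \<in> ball x0 e \<Longrightarrow> z \<in> space M \<Longrightarrow> \<bar>f x z\<bar> \<le> h z"
    and h: "integrable M h"
  shows "isCont (\<lambda>x. \<integral>z. f x z \<partial>M) x0"
proof -
  have "((\<lambda>x. \<integral>z. f x z \<partial>M) \<circ> X) \<longlonglongrightarrow> (\<integral>z. f x0 z \<partial>M)"
    if X: "X \<longlonglongrightarrow> x0" for X
  proof -
    have "\<forall>\<^sub>F n in sequentially. X n \<in> ball x0 e"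
      using X \<open>e > 0\<close> by (metis centre_in_ball open_ball topological_tendstoD)
    then obtain N where N: "\<And>n. n \<ge> N \<Longrightarrow> X n \<in> ball x0 e"
      by (auto simp: eventually_sequentially)
    have "(\<lambda>n. \<integral>z. f (X (n + N)) z \<partial>M) \<longlonglongrightarrow> (\<integral>z. f x0 z \<partial>M)"
    proof (rule integral_dominated_convergence[where w = h])
      show "f x0 \<in> borel_measurable M" "\<And>n. f (X (n + N)) \<in> borel_measurable M"
        using meas \<open>e > 0\<close> N by auto
      show "AE z in M. (\<lambda>n. f (X (n + N)) z) \<longlonglongrightarrow> f x0 z"
      proof (rule AE_I2)
        fix z assume "z \<in> space M"
        then have "(\<lambda>n. f (X n) z) \<longlonglongrightarrow> f x0 z"
          using cont X by (auto simp: continuous_at_sequentially o_def)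
        then show "(\<lambda>n. f (X (n + N)) z) \<longlonglongrightarrow> f x0 z"
          by (rule LIMSEQ_ignore_initial_segment)
      qed
    qed (use h bound N in auto)
    then show ?thesis
      unfolding o_def by (rule LIMSEQ_offset)
  qed
  then show ?thesis
    by (simp add: continuous_at_sequentially)
qed

text \<open>Dominated convergence along sequences is applied to the normalised remainder, so that
  full differentiability results and not just directional derivatives. The measure stays arbitrary
  because series and Gaussian integrals are both instances.\<close>

lemma has_derivative_integral:
  fixes f :: "'a::{real_normed_vector, perfect_space} \<Rightarrow> 'b \<Rightarrow> real"
  assumes "e > 0"
    and der: "\<And>x z. x \<in> ball x0 e \<Longrightarrow> z \<in> space M \<Longrightarrow> ((\<lambda>x. f x z) has_derivative f' x z) (at x)"
    and bound: "\<And>x z v. x \<in> ball x0 e \<Longrightarrow> z \<in> space M \<Longrightarrow> \<bar>f' x z v\<bar> \<le> h z * norm v"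
    and int: "\<And>x. x \<in> ball x0 e \<Longrightarrow> integrable M (f x)"
    and h: "integrable M h"
    and meas: "\<And>v. (\<lambda>z. f' x0 z v) \<in> borel_measurable M"
  shows "((\<lambda>x. \<integral>z. f x z \<partial>M) has_derivative (\<lambda>v. \<integral>z. f' x0 z v \<partial>M)) (at x0)"
proof -
  let ?F = "\<lambda>x. \<integral>z. f x z \<partial>M" and ?F' = "\<lambda>v. \<integral>z. f' x0 z v \<partial>M"
  have x0: "x0 \<in> ball x0 e" using \<open>e > 0\<close> by simp
  have int': "integrable M (\<lambda>z. f' x0 z v)" for v
  proof (rule Bochner_Integration.integrable_bound)
    show "integrable M (\<lambda>z. h z * norm v)" using h by simp
    show "AE z in M. norm (f' x0 z v) \<le> norm (h z * norm v)"
      using bound[OF x0] by (intro AE_I2) (metis abs_ge_self order_trans real_norm_def)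
  qed (rule meas)
  have lin: "linear (f' x0 z)" if "z \<in> space M" for z
    using der[OF x0 that] by (rule has_derivative_linear)
  have "bounded_linear ?F'"
  proof (rule bounded_linear_intro[where K = "\<integral>z. h z \<partial>M"])
    fix u v show "?F' (u + v) = ?F' u + ?F' v"
      by (subst Bochner_Integration.integral_add[symmetric, OF int' int'])
        (auto intro!: Bochner_Integration.integral_cong simp: lin linear_add)
    have "?F' (r *\<^sub>R v) = (\<integral>z. r * f' x0 z v \<partial>M)" for r
      by (intro Bochner_Integration.integral_cong) (auto simp: lin linear_scale)
    then show "?F' (r *\<^sub>R v) = r *\<^sub>R ?F' v" for r
      unfolding real_scaleR_def Bochner_Integration.integral_mult_right_zero[symmetric] .
    have "norm (?F' v) \<le> (\<integral>z. norm (f' x0 z v) \<partial>M)" by (rule integral_norm_bound)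
    also have "\<dots> \<le> (\<integral>z. h z * norm v \<partial>M)"
      using bound[OF x0] int' h by (intro integral_mono) auto
    finally show "norm (?F' v) \<le> norm v * (\<integral>z. h z \<partial>M)"
      by (simp add: mult.commute)
  qed
  moreover have "((\<lambda>y. (?F y - ?F x0 - ?F' (y - x0)) /\<^sub>R norm (y - x0)) \<circ> X) \<longlonglongrightarrow> 0"
    if X: "X \<longlonglongrightarrow> x0" and ne: "\<And>n. X n \<noteq> x0" for X
  proof -
    let ?q = "\<lambda>y z. (f y z - f x0 z - f' x0 z (y - x0)) / norm (y - x0)"
    have "\<forall>\<^sub>F n in sequentially. X n \<in> ball x0 e"
      using X x0 by (metis open_ball topological_tendstoD)
    then obtain N where N: "\<And>n. n \<ge> N \<Longrightarrow> X n \<in> ball x0 e"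
      by (auto simp: eventually_sequentially)
    have "(\<lambda>n. \<integral>z. ?q (X (n + N)) z \<partial>M) \<longlonglongrightarrow> (\<integral>z. 0 \<partial>M)"
    proof (rule integral_dominated_convergence[where w = "\<lambda>z. 2 * h z"])
      show "(\<lambda>z. ?q (X (n + N)) z) \<in> borel_measurable M" for n
      proof -
        have [measurable]: "f (X (n + N)) \<in> borel_measurable M" "f x0 \<in> borel_measurable M"
          "(\<lambda>z. f' x0 z (X (n + N) - x0)) \<in> borel_measurable M"
          using int[OF N, of "n + N"] int[OF x0] meas by auto
        show ?thesis by measurable
      qed
      show "AE z in M. (\<lambda>n. ?q (X (n + N)) z) \<longlonglongrightarrow> 0"
      proof (rule AE_I2)
        fix z assume "z \<in> space M"
        then have "((\<lambda>y. (f y z - f x0 z - f' x0 z (y - x0)) /\<^sub>R norm (y - x0)) \<longlongrightarrow> 0) (at x0)"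
          using der[OF x0] by (simp add: has_derivative_at_within)
        then have "((\<lambda>y. ?q y z) \<circ> X) \<longlonglongrightarrow> 0"
          using X ne by (subst (asm) tendsto_at_iff_sequentially) (auto simp: divide_inverse mult.commute)
        then have "(\<lambda>n. ?q (X n) z) \<longlonglongrightarrow> 0" by (simp add: o_def)
        then show "(\<lambda>n. ?q (X (n + N)) z) \<longlonglongrightarrow> 0"
          by (rule LIMSEQ_ignore_initial_segment)
      qed
      \<comment> \<open>The remainder is an increment minus a linear term. The first is bounded
        through the mean value inequality on the convex ball, the second by hypothesis, each by
        \<open>h z\<close> times the distance.\<close>
      show "AE z in M. norm (?q (X (n + N)) z) \<le> 2 * h z" for n
      proof (rule AE_I2)
        fix z assume z: "z \<in> space M"
        let ?y = "X (n + N)"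
        have y: "?y \<in> ball x0 e" by (rule N) simp
        have "norm (f ?y z - f x0 z) \<le> h z * norm (?y - x0)"
        proof (rule differentiable_bound[where S = "ball x0 e" and f = "\<lambda>x. f x z" and f' = "\<lambda>x. f' x z"])
          fix x assume x: "x \<in> ball x0 e"
          show "((\<lambda>x. f x z) has_derivative f' x z) (at x within ball x0 e)"
            using der[OF x z] by (rule has_derivative_at_withinI)
          show "onorm (f' x z) \<le> h z"
            using bound[OF x z] by (intro onorm_le) auto
        qed (use x0 y in auto)
        moreover have "\<bar>f' x0 z (?y - x0)\<bar> \<le> h z * norm (?y - x0)"
          using bound[OF x0 z] .
        ultimately have "\<bar>f ?y z - f x0 z - f' x0 z (?y - x0)\<bar> \<le> (2 * h z) * norm (?y - x0)"
          by simp
        then show "norm (?q ?y z) \<le> 2 * h z"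
          using ne by (simp add: divide_le_eq)
      qed
    qed (use h in auto)
    moreover have "(\<integral>z. ?q (X (n + N)) z \<partial>M) = (?F (X (n + N)) - ?F x0 - ?F' (X (n + N) - x0)) /\<^sub>R norm (X (n + N) - x0)" for n
      using int[OF N, of "n + N"] int[OF x0] int' by (simp add: divide_inverse mult.commute)
    ultimately have "(\<lambda>n. (?F (X (n + N)) - ?F x0 - ?F' (X (n + N) - x0)) /\<^sub>R norm (X (n + N) - x0)) \<longlonglongrightarrow> 0"
      by simp
    then show ?thesis
      unfolding o_def by (rule LIMSEQ_offset)
  qed
  ultimately show ?thesis
    unfolding has_derivative_at_within
    by (subst tendsto_at_iff_sequentially) auto
qed

section \<open>Gaussian domination\<close>

lemma integrable_exp_neg_sqr:
  assumes "b > 0"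
  shows "integrable lborel (\<lambda>x::real. exp (- b * x\<^sup>2))"
proof -
  define \<sigma> where "\<sigma> = sqrt (1 / (2 * b))"
  have \<sigma>: "\<sigma> > 0" "2 * \<sigma>\<^sup>2 = 1 / b" using assms by (auto simp: \<sigma>_def)
  have "integrable lborel (\<lambda>x. sqrt (2 * pi * \<sigma>\<^sup>2) * normal_density 0 \<sigma> x)"
    using \<sigma> by (intro integrable_mult_right integrable_normal_density) auto
  also have "(\<lambda>x. sqrt (2 * pi * \<sigma>\<^sup>2) * normal_density 0 \<sigma> x) = (\<lambda>x. exp (- b * x\<^sup>2))"
    using \<sigma> assms by (auto simp: normal_density_def fun_eq_iff)
  finally show ?thesis .
qed

lemma integrable_exp_neg_norm_sqr:
  assumes "b > 0"
  shows "integrable lborel (\<lambda>x::'a::euclidean_space. exp (- b * (norm x)\<^sup>2))"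
proof (rule integrableI_nonneg)
  have "exp (- b * (norm x)\<^sup>2) = (\<Prod>i\<in>Basis. exp (- b * (x \<bullet> i)\<^sup>2))" for x :: 'a
    by (subst norm_eq_sqrt_inner, subst euclidean_inner)
      (simp add: exp_sum[symmetric] sum_distrib_left sum_nonneg power2_eq_square)
  then have "(\<integral>\<^sup>+x. ennreal (exp (- b * (norm x)\<^sup>2)) \<partial>(lborel :: 'a measure))
      = (\<integral>\<^sup>+x. (\<Prod>i\<in>Basis. ennreal (exp (- b * (x \<bullet> i)\<^sup>2))) \<partial>(lborel :: 'a measure))"
    by (simp add: prod_ennreal)
  also have "\<dots> = (\<Prod>i\<in>(Basis::'a set). (\<integral>\<^sup>+x. ennreal (exp (- b * x\<^sup>2)) \<partial>lborel))"
    by (rule nn_integral_lborel_prod) auto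
  also have "\<dots> < \<infinity>"
    using integrable_exp_neg_sqr[OF assms]
    by (auto simp: integrable_iff_bounded power_less_top_ennreal)
  finally show "(\<integral>\<^sup>+x. ennreal (exp (- b * (norm x)\<^sup>2)) \<partial>(lborel :: 'a measure)) < \<infinity>" .
qed auto

lemma integrable_gaussian_exp:
  fixes b c K :: real
  assumes "b > 0"
  shows "integrable lborel (\<lambda>x::'a::euclidean_space. K * exp (- b * (norm x)\<^sup>2 + c * norm x))"
proof (rule integrable_mult_right)
  have "integrable lborel (\<lambda>x::'a. exp (c\<^sup>2 / (2 * b)) * exp (- (b / 2) * (norm x)\<^sup>2))"
    using assms by (intro integrable_mult_right integrable_exp_neg_norm_sqr) auto
  then show "integrable lborel (\<lambda>x::'a. exp (- b * (norm x)\<^sup>2 + c * norm x))"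
  proof (rule Bochner_Integration.integrable_bound)
    have "- b * r\<^sup>2 + c * r \<le> c\<^sup>2 / (2 * b) + - (b / 2) * r\<^sup>2" for r
    proof -
      \<comment> \<open>Completing the square: half of the quadratic term absorbs the linear
        one.\<close>
      have "0 \<le> (b * r - c)\<^sup>2 / (2 * b)" using assms by simp
      also have "\<dots> = c\<^sup>2 / (2 * b) + (b / 2) * r\<^sup>2 - c * r"
        using assms by (simp add: power2_eq_square field_simps)
      finally show ?thesis by (simp add: algebra_simps)
    qed
    then show "AE x::'a in lborel. norm (exp (- b * (norm x)\<^sup>2 + c * norm x))
        \<le> norm (exp (c\<^sup>2 / (2 * b)) * exp (- (b / 2) * (norm x)\<^sup>2))"
      by (intro AE_I2) (simp add: exp_add[symmetric])
  qed auto
qed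

section \<open>Calculus for Dunkl operators\<close>

text \<open>The derivative is kept as data because the value of a Dunkl quotient on the hyperplane
  of its root is expressed by it. Continuity in \<open>x\<close> is asked for one direction at a
  time, the form that dominated convergence delivers.\<close>

definition C1_deriv :: "(real ^ 'm \<Rightarrow> real) \<Rightarrow> (real ^ 'm \<Rightarrow> real ^ 'm \<Rightarrow> real) \<Rightarrow> bool" where
  "C1_deriv f f' \<longleftrightarrow> (\<forall>x. (f has_derivative f' x) (at x)) \<and> (\<forall>v. continuous_on UNIV (\<lambda>x. f' x v))"

lemma linear_axis_expansion:
  fixes L :: "real ^ 'm \<Rightarrow> real"
  assumes "linear L"
  shows "L v = (\<Sum>j\<in>UNIV. v $ j * L (axis j 1))"
proof -
  have "v = (\<Sum>j\<in>UNIV. v $ j *\<^sub>R axis j 1)"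
    by (simp add: basis_expansion scalar_mult_eq_scaleR[symmetric])
  then have "L v = L (\<Sum>j\<in>UNIV. v $ j *\<^sub>R axis j 1)" by simp
  then show ?thesis
    using assms by (simp add: linear_sum linear_scale)
qed

lemma partial_has_derivative:
  assumes "(f has_derivative f') (at x)"
  shows "partial i f x = f' (axis i 1)"
proof -
  have lin: "linear f'" using assms by (rule has_derivative_linear)
  have "((\<lambda>t. f (x + t *\<^sub>R axis i 1)) has_derivative (\<lambda>t. f' (t *\<^sub>R axis i 1))) (at 0)"
    using assms by (intro has_derivative_compose[where f = "\<lambda>t. x + t *\<^sub>R axis i 1" and g = f])
      (auto intro!: derivative_eq_intros)
  then have "((\<lambda>t. f (x + t *\<^sub>R axis i 1)) has_real_derivative f' (axis i 1)) (at 0)"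
    using lin by (simp add: has_field_derivative_def linear_scale mult.commute[of _ "f' _"])
  then show ?thesis
    by (simp add: partial_def DERIV_imp_deriv)
qed

lemma directional_eq_sum_partial:
  assumes "(f has_derivative f') (at x)"
  shows "f' v = (\<Sum>j\<in>UNIV. v $ j * partial j f x)"
  using linear_axis_expansion[OF has_derivative_linear[OF assms], of v]
  by (simp add: partial_has_derivative[OF assms])

lemma C1_fun_C1_deriv:
  assumes "C1_deriv f f'"
  shows "C1_fun f"
proof -
  have "partial i f = (\<lambda>x. f' x (axis i 1))" for i
    using assms by (auto simp: C1_deriv_def partial_has_derivative fun_eq_iff)
  then show ?thesis
    using assms by (auto simp: C1_fun_def C1_deriv_def differentiable_def)
qed

section \<open>Reflections and the Dunkl quotient on the root hyperplane\<close>

lemma linear_reflection: "linear (reflection \<alpha>)"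
  by (rule linearI) (simp_all add: reflection_def inner_add_right algebra_simps add_divide_distrib)

lemma reflection_simps [simp]:
  "reflection \<alpha> 0 = 0"
  "reflection \<alpha> (x + y) = reflection \<alpha> x + reflection \<alpha> y"
  "reflection \<alpha> (x - y) = reflection \<alpha> x - reflection \<alpha> y"
  "reflection \<alpha> (- x) = - reflection \<alpha> x"
  "reflection \<alpha> (c *\<^sub>R x) = c *\<^sub>R reflection \<alpha> x"
  using linear_reflection[of \<alpha>]
  by (auto simp: linear_0 linear_add linear_diff linear_neg linear_scale)

lemma reflection_self [simp]: "reflection \<alpha> \<alpha> = - \<alpha>"
  by (cases "\<alpha> = 0") (simp_all add: reflection_def scaleR_2)

lemma reflection_uminus [simp]: "reflection (- \<alpha>) = reflection \<alpha>"
  by (simp add: reflection_def fun_eq_iff)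

lemma reflection_fixed: "\<alpha> \<bullet> x = 0 \<Longrightarrow> reflection \<alpha> x = x"
  by (simp add: reflection_def)

lemma reflection_adjoint: "reflection \<alpha> x \<bullet> y = x \<bullet> reflection \<alpha> y"
  by (simp add: reflection_def inner_diff_left inner_diff_right inner_commute)

lemma reflection_reflection [simp]: "reflection \<alpha> (reflection \<alpha> x) = x"
  by (simp add: reflection_def inner_diff_right)

lemma inner_reflection_reflection [simp]: "reflection \<alpha> x \<bullet> reflection \<alpha> y = x \<bullet> y"
  by (simp add: reflection_adjoint)

lemma norm_reflection [simp]: "norm (reflection \<alpha> x) = norm x"
  by (simp add: norm_eq_sqrt_inner)

lemma inner_root_reflection [simp]: "\<alpha> \<bullet> reflection \<alpha> x = - (\<alpha> \<bullet> x)"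
  by (simp flip: reflection_adjoint)

lemma reflection_conjugate:
  "reflection (reflection \<alpha> \<beta>) (reflection \<alpha> x) = reflection \<alpha> (reflection \<beta> x)"
  by (simp add: reflection_def[of "reflection \<alpha> \<beta>"] reflection_def[of \<beta>])

lemma bounded_linear_reflection: "bounded_linear (reflection \<alpha>)"
  using linear_reflection by (rule linear_conv_bounded_linear[THEN iffD1])

lemma continuous_on_reflection [continuous_intros]:
  "continuous_on S g \<Longrightarrow> continuous_on S (\<lambda>x. reflection \<alpha> (g x))"
  by (rule bounded_linear.continuous_on[OF bounded_linear_reflection])

text \<open>Uniqueness of limits, and with it the value of \<open>Lim\<close>, depends on this; a
  small step along \<open>\<alpha>\<close> itself leaves the hyperplane.\<close>

lemma not_trivial_limit_off_hyperplane:
  fixes \<alpha> x :: "'a::euclidean_space"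
  assumes "\<alpha> \<noteq> 0" "\<alpha> \<bullet> x = 0"
  shows "\<not> trivial_limit (at x within {z. \<alpha> \<bullet> z \<noteq> 0})"
  unfolding trivial_limit_within not_not islimpt_approachable
proof (intro allI impI)
  fix e :: real assume e: "e > 0"
  let ?z = "x + (e / (2 * norm \<alpha>)) *\<^sub>R \<alpha>"
  have "\<alpha> \<bullet> ?z \<noteq> 0" using assms e by (simp add: inner_add_right)
  moreover have "?z \<noteq> x" using assms e by simp
  moreover have "dist ?z x < e" using assms e by (simp add: dist_norm)
  ultimately show "\<exists>x'\<in>{z. \<alpha> \<bullet> z \<noteq> 0}. x' \<noteq> x \<and> dist x' x < e" by blast
qed

text \<open>The points \<open>z\<close> and \<open>reflection \<alpha> z\<close> differ by a
  multiple of \<open>\<alpha>\<close> proportional to \<open>\<alpha> \<bullet> z\<close>, so the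
  mean value theorem on their segment turns the quotient into a directional derivative at an
  intermediate point. That point tends to \<open>x\<close> along with \<open>z\<close>, since
  \<open>x\<close> is fixed by the reflection and thus equally far from both ends.\<close>

lemma dunkl_quotient_singular:
  assumes f: "C1_deriv f f'" and \<alpha>: "\<alpha> \<noteq> 0" and x: "\<alpha> \<bullet> x = 0"
  shows "dunkl_quotient \<alpha> f x = 2 * f' x \<alpha> / (\<alpha> \<bullet> \<alpha>)"
proof -
  let ?q = "\<lambda>z. (f z - f (reflection \<alpha> z)) / (\<alpha> \<bullet> z)"
  have der: "(f has_derivative f' z) (at z)" for z
    using f by (simp add: C1_deriv_def)
  have mean: "\<exists>\<xi>. dist \<xi> x \<le> dist z x \<and> ?q z = 2 * f' \<xi> \<alpha> / (\<alpha> \<bullet> \<alpha>)" if z: "\<alpha> \<bullet> z \<noteq> 0" for z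
  proof -
    let ?p = "\<lambda>t. reflection \<alpha> z + t *\<^sub>R (z - reflection \<alpha> z)"
    have "\<exists>t\<in>{0..1}. f (?p 1) - f (?p 0) = f' (?p t) ((1 - 0) *\<^sub>R (z - reflection \<alpha> z))"
    proof (rule mvt_very_simple[where f = "\<lambda>t. f (?p t)" and f' = "\<lambda>t s. f' (?p t) (s *\<^sub>R (z - reflection \<alpha> z))"])
      fix t :: real
      show "((\<lambda>t. f (?p t)) has_derivative (\<lambda>s. f' (?p t) (s *\<^sub>R (z - reflection \<alpha> z)))) (at t within {0..1})"
        by (rule has_derivative_compose[where f = ?p and g = f, OF _ der])
          (auto intro!: derivative_eq_intros)
    qed simp
    then obtain t where t: "t \<in> {0..1}"
      and eq: "f z - f (reflection \<alpha> z) = f' (?p t) (z - reflection \<alpha> z)"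
      by auto
    have "f' (?p t) (z - reflection \<alpha> z) = (2 * (\<alpha> \<bullet> z) / (\<alpha> \<bullet> \<alpha>)) * f' (?p t) \<alpha>"
      using has_derivative_linear[OF der] by (simp add: reflection_def linear_scale)
    then have "?q z = 2 * f' (?p t) \<alpha> / (\<alpha> \<bullet> \<alpha>)"
      using z by (simp add: eq)
    moreover have "dist (?p t) x \<le> dist z x"
    proof -
      have "?p t \<in> closed_segment (reflection \<alpha> z) z"
        using t by (auto simp: closed_segment_def algebra_simps)
      moreover have "dist (reflection \<alpha> z) x = dist z x"
        using norm_reflection[of \<alpha> "z - x"] by (simp add: dist_norm reflection_fixed[OF x])
      then have "closed_segment (reflection \<alpha> z) z \<subseteq> cball x (dist z x)"
        by (intro closed_segment_subset) (auto simp: dist_commute)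
      ultimately show ?thesis by (auto simp: dist_commute)
    qed
    ultimately show ?thesis by blast
  qed
  have "(?q \<longlongrightarrow> 2 * f' x \<alpha> / (\<alpha> \<bullet> \<alpha>)) (at x within {z. \<alpha> \<bullet> z \<noteq> 0})"
    unfolding Lim_within
  proof (intro allI impI)
    fix e :: real assume "e > 0"
    have "isCont (\<lambda>z. 2 * f' z \<alpha> / (\<alpha> \<bullet> \<alpha>)) x"
    proof -
      have "isCont (\<lambda>z. f' z \<alpha>) x"
        using f by (auto simp: C1_deriv_def continuous_on_eq_continuous_at)
      then show ?thesis using \<alpha> by (intro continuous_intros) auto
    qed
    then obtain d where d: "d > 0"
      "\<And>z. dist z x < d \<Longrightarrow> dist (2 * f' z \<alpha> / (\<alpha> \<bullet> \<alpha>)) (2 * f' x \<alpha> / (\<alpha> \<bullet> \<alpha>)) < e"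
      using \<open>e > 0\<close> unfolding continuous_at_eps_delta by blast
    show "\<exists>d>0. \<forall>z\<in>{z. \<alpha> \<bullet> z \<noteq> 0}. 0 < dist z x \<and> dist z x < d \<longrightarrow> dist (?q z) (2 * f' x \<alpha> / (\<alpha> \<bullet> \<alpha>)) < e"
    proof (intro exI conjI ballI impI)
      fix z assume z: "z \<in> {z. \<alpha> \<bullet> z \<noteq> 0}" "0 < dist z x \<and> dist z x < d"
      then obtain \<xi> where "dist \<xi> x \<le> dist z x" "?q z = 2 * f' \<xi> \<alpha> / (\<alpha> \<bullet> \<alpha>)"
        using mean by blast
      then show "dist (?q z) (2 * f' x \<alpha> / (\<alpha> \<bullet> \<alpha>)) < e"
        using d(2)[of \<xi>] z by simp
    qed (rule d(1))
  qed
  then show ?thesis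
    using x not_trivial_limit_off_hyperplane[OF \<alpha> x] by (simp add: dunkl_quotient_def tendsto_Lim)
qed

text \<open>The right-hand side is linear in the values of \<open>f\<close> and \<open>f'\<close> at
  every point, singular ones included; this is what permits the exchange with sums and
  integrals.\<close>

lemma dunkl_op_C1:
  assumes "C1_deriv f f'" and "0 \<notin> P"
  shows "dunkl_op P k i f x = f' x (axis i 1) + (\<Sum>\<alpha>\<in>P. k \<alpha> * \<alpha> $ i *
    (if \<alpha> \<bullet> x \<noteq> 0 then (f x - f (reflection \<alpha> x)) / (\<alpha> \<bullet> x) else 2 * f' x \<alpha> / (\<alpha> \<bullet> \<alpha>)))"
proof -
  have "partial i f x = f' x (axis i 1)"
    using assms by (simp add: C1_deriv_def partial_has_derivative)
  moreover have "dunkl_quotient \<alpha> f x =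
      (if \<alpha> \<bullet> x \<noteq> 0 then (f x - f (reflection \<alpha> x)) / (\<alpha> \<bullet> x) else 2 * f' x \<alpha> / (\<alpha> \<bullet> \<alpha>))"
    if "\<alpha> \<in> P" for \<alpha>
  proof (cases "\<alpha> \<bullet> x = 0")
    case True
    moreover have "\<alpha> \<noteq> 0" using that assms(2) by blast
    ultimately show ?thesis using dunkl_quotient_singular[OF assms(1)] by simp
  qed (simp add: dunkl_quotient_def)
  ultimately show ?thesis
    unfolding dunkl_op_def by simp
qed

section \<open>Polynomial functions\<close>

abbreviation poly_fun :: "(real ^ 'm \<Rightarrow> real) \<Rightarrow> bool" where
  "poly_fun \<equiv> real_polynomial_function"

lemmas poly_fun_intros = real_polynomial_function.intros

lemmas poly_fun_cmult = poly_fun_intros(4)[OF poly_fun_intros(2)]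

lemma poly_fun_bounded_linear_compose:
  assumes "poly_fun f" "bounded_linear L"
  shows "poly_fun (\<lambda>x. f (L x))"
  using real_polynomial_function_compose[OF polynomial_function_bounded_linear[OF assms(2)] assms(1)]
  by (simp add: o_def)

lemma poly_fun_continuous_on:
  "poly_fun f \<Longrightarrow> continuous_on S f"
  by (simp add: continuous_on_polymonial_function real_polynomial_function_eq)

lemma poly_fun_inner_right [intro]:
  "poly_fun (\<lambda>x. v \<bullet> x)"
  by (rule poly_fun_intros(1)) (rule bounded_linear_inner_right)

lemma poly_fun_vec_nth [intro]:
  "poly_fun (\<lambda>x. x $ j)"
  by (rule poly_fun_intros(1)) (rule bounded_linear_vec_nth)

lemma poly_fun_C1:
  fixes f :: "real ^ 'm \<Rightarrow> real"
  assumes "poly_fun f"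
  shows "\<exists>f'. C1_deriv f f' \<and> (\<forall>v. poly_fun (\<lambda>x. f' x v))"
proof -
  have "\<exists>f'. (\<forall>x. (f has_derivative f' x) (at x)) \<and> (\<forall>v. poly_fun (\<lambda>x. f' x v))"
    using assms
  proof induction
    case (linear f)
    then show ?case
      by (intro exI[of _ "\<lambda>x. f"]) (auto intro: bounded_linear_imp_has_derivative)
  next
    case (const c)
    then show ?case by (intro exI[of _ "\<lambda>x v. 0"]) auto
  next
    case (add f g)
    then obtain f' g' where "\<forall>x. (f has_derivative f' x) (at x)" "\<forall>v. poly_fun (\<lambda>x. f' x v)"
      "\<forall>x. (g has_derivative g' x) (at x)" "\<forall>v. poly_fun (\<lambda>x. g' x v)" by blast
    then show ?case by (intro exI[of _ "\<lambda>x v. f' x v + g' x v"]) (auto intro: has_derivative_add)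
  next
    case (mult f g)
    then obtain f' g' where "\<forall>x. (f has_derivative f' x) (at x)" "\<forall>v. poly_fun (\<lambda>x. f' x v)"
      "\<forall>x. (g has_derivative g' x) (at x)" "\<forall>v. poly_fun (\<lambda>x. g' x v)" by blast
    then show ?case using mult.hyps
      by (intro exI[of _ "\<lambda>x v. f x * g' x v + f' x v * g x"]) (auto intro!: has_derivative_mult poly_fun_intros(3,4))
  qed
  then show ?thesis
    unfolding C1_deriv_def using poly_fun_continuous_on by blast
qed

lemma poly_fun_has_derivative:
  fixes f :: "real ^ 'm \<Rightarrow> real"
  assumes "poly_fun f"
  shows "(f has_derivative (\<lambda>v. \<Sum>j\<in>UNIV. v $ j * partial j f x)) (at x)"
proof -
  obtain f' where "(f has_derivative f' x) (at x)"
    using poly_fun_C1[OF assms] by (auto simp: C1_deriv_def)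
  moreover from this have "f' x = (\<lambda>v. \<Sum>j\<in>UNIV. v $ j * partial j f x)"
    by (auto simp: directional_eq_sum_partial)
  ultimately show ?thesis by simp
qed

lemma poly_fun_partial [intro]:
  fixes f :: "real ^ 'm \<Rightarrow> real"
  assumes "poly_fun f"
  shows "poly_fun (partial i f)"
proof -
  obtain f' where f': "C1_deriv f f'" "\<forall>v. poly_fun (\<lambda>x. f' x v)"
    using poly_fun_C1[OF assms] by blast
  moreover from f'(1) have "partial i f = (\<lambda>x. f' x (axis i 1))"
    by (auto simp: C1_deriv_def partial_has_derivative)
  ultimately show ?thesis by simp
qed

lemma partial_add:
  fixes f :: "real ^ 'm \<Rightarrow> real"
  assumes "poly_fun f" "poly_fun g"
  shows "partial i (\<lambda>x. f x + g x) x = partial i f x + partial i g x"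
  by (subst partial_has_derivative[OF has_derivative_add[OF assms[THEN poly_fun_has_derivative]]])
    (simp add: axis_def if_distrib if_distribR cong: if_cong)

lemma partial_mult:
  fixes f :: "real ^ 'm \<Rightarrow> real"
  assumes "poly_fun f" "poly_fun g"
  shows "partial i (\<lambda>x. f x * g x) x = f x * partial i g x + partial i f x * g x"
  by (subst partial_has_derivative[OF has_derivative_mult[OF assms[THEN poly_fun_has_derivative]]])
    (simp add: axis_def if_distrib if_distribR cong: if_cong)

lemma partial_const [simp]: "partial i (\<lambda>x. c) x = 0"
  by (subst partial_has_derivative[OF has_derivative_const]) simp

lemma partial_cmult:
  fixes f :: "real ^ 'm \<Rightarrow> real"
  assumes "poly_fun f"
  shows "partial i (\<lambda>x. c * f x) x = c * partial i f x"
  using partial_mult[OF poly_fun_intros(2) assms] by simp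

lemma partial_diff:
  fixes f :: "real ^ 'm \<Rightarrow> real"
  assumes "poly_fun f" "poly_fun g"
  shows "partial i (\<lambda>x. f x - g x) x = partial i f x - partial i g x"
  using partial_add[OF assms(1) poly_fun_intros(4)[OF poly_fun_intros(2)[of "-1"] assms(2)]]
    partial_cmult[OF assms(2), of i "-1" x] by simp

lemma partial_sum:
  fixes f :: "'i \<Rightarrow> real ^ 'm \<Rightarrow> real"
  assumes "finite I" "\<And>j. j \<in> I \<Longrightarrow> poly_fun (f j)"
  shows "partial i (\<lambda>x. \<Sum>j\<in>I. f j x) x = (\<Sum>j\<in>I. partial i (f j) x)"
  using assms
proof (induction I rule: finite_induct)
  case (insert j I)
  then have "poly_fun (\<lambda>x. \<Sum>j\<in>I. f j x)"
    by (intro real_polynomial_function_sum) auto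
  with insert show ?case by (simp add: partial_add)
qed simp

lemma partial_bounded_linear:
  assumes "bounded_linear f"
  shows "partial i f x = f (axis i 1)"
  using assms by (intro partial_has_derivative bounded_linear_imp_has_derivative)

lemma partial_commute:
  fixes f :: "real ^ 'm \<Rightarrow> real"
  assumes "poly_fun f"
  shows "partial i (partial j f) x = partial j (partial i f) x"
  using assms
proof (induction arbitrary: x)
  case (linear f)
  then have "partial l f = (\<lambda>x. f (axis l 1))" for l by (auto simp: partial_bounded_linear)
  then show ?case by simp
next
  case (const c)
  have "partial l (\<lambda>x. c) = (\<lambda>x. 0)" for l :: 'm by auto
  then show ?case by simp
next
  case (add f g)
  have "partial l (\<lambda>x. f x + g x) = (\<lambda>x. partial l f x + partial l g x)" for l
    using add.hyps by (auto simp: partial_add)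
  then show ?case using add
    by (simp add: partial_add poly_fun_partial)
next
  case (mult f g)
  have "partial l (\<lambda>x. f x * g x) = (\<lambda>x. f x * partial l g x + partial l f x * g x)" for l
    using mult.hyps by (auto simp: partial_mult)
  then show ?case using mult
    by (simp add: partial_add partial_mult poly_fun_partial poly_fun_intros(4))
qed

lemma partial_reflection:
  fixes f :: "real ^ 'm \<Rightarrow> real"
  assumes "poly_fun f"
  shows "partial i (\<lambda>x. f (reflection \<alpha> x)) x = partial i f (reflection \<alpha> x)
    - 2 * \<alpha> $ i / (\<alpha> \<bullet> \<alpha>) * (\<Sum>j\<in>UNIV. \<alpha> $ j * partial j f (reflection \<alpha> x))"
proof -
  let ?L = "\<lambda>v. \<Sum>j\<in>UNIV. v $ j * partial j f (reflection \<alpha> x)"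
  have "((\<lambda>x. f (reflection \<alpha> x)) has_derivative (\<lambda>v. ?L (reflection \<alpha> v))) (at x)"
    by (rule has_derivative_compose[OF bounded_linear_imp_has_derivative[OF bounded_linear_reflection]
          poly_fun_has_derivative[OF assms]])
  then have "partial i (\<lambda>x. f (reflection \<alpha> x)) x = ?L (reflection \<alpha> (axis i 1))"
    by (rule partial_has_derivative)
  also have "\<dots> = ?L (axis i 1) - 2 * \<alpha> $ i / (\<alpha> \<bullet> \<alpha>) * ?L \<alpha>"
    by (simp add: reflection_def inner_axis left_diff_distrib sum_subtractf sum_distrib_left algebra_simps)
  also have "?L (axis i 1) = partial i f (reflection \<alpha> x)"
    by (simp add: axis_def if_distrib if_distribR cong: if_cong)
  finally show ?thesis .
qed

text \<open>Divided differences obey a twisted product rule: the quotient of a product is the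
  quotient of \<open>f\<close> times \<open>g\<close>, plus the reflected \<open>f\<close> times the
  quotient of \<open>g\<close>. Hence Dunkl operators map polynomials to polynomials and can be
  iterated on them.\<close>

lemma poly_fun_divided_difference:
  fixes f :: "real ^ 'm \<Rightarrow> real"
  assumes "poly_fun f" "\<alpha> \<noteq> 0"
  shows "\<exists>q. poly_fun q \<and> (\<forall>x. f x - f (reflection \<alpha> x) = (\<alpha> \<bullet> x) * q x)"
  using assms(1)
proof induction
  case (linear f)
  then have "f x - f (reflection \<alpha> x) = (\<alpha> \<bullet> x) * (2 * f \<alpha> / (\<alpha> \<bullet> \<alpha>))" for x
    by (simp add: reflection_def linear_diff linear_scale bounded_linear.linear)
  then show ?case by blast
next
  case (const c)
  then show ?case by (intro exI[of _ "\<lambda>x. 0"]) auto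
next
  case (add f g)
  then obtain p q where p: "poly_fun p" "\<And>x. f x - f (reflection \<alpha> x) = (\<alpha> \<bullet> x) * p x"
    and q: "poly_fun q" "\<And>x. g x - g (reflection \<alpha> x) = (\<alpha> \<bullet> x) * q x" by blast
  have "f x + g x - (f (reflection \<alpha> x) + g (reflection \<alpha> x)) = (\<alpha> \<bullet> x) * (p x + q x)" for x
    using p(2)[of x] q(2)[of x] by algebra
  then show ?case
    using poly_fun_intros(3)[OF p(1) q(1)] by blast
next
  case (mult f g)
  then obtain p q where p: "poly_fun p" "\<And>x. f x - f (reflection \<alpha> x) = (\<alpha> \<bullet> x) * p x"
    and q: "poly_fun q" "\<And>x. g x - g (reflection \<alpha> x) = (\<alpha> \<bullet> x) * q x" by blast
  have "f x * g x - f (reflection \<alpha> x) * g (reflection \<alpha> x)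
      = (\<alpha> \<bullet> x) * (p x * g x + f (reflection \<alpha> x) * q x)" for x
    using p(2)[of x] q(2)[of x] by algebra
  moreover have "poly_fun (\<lambda>x. p x * g x + f (reflection \<alpha> x) * q x)"
    by (intro poly_fun_intros(3,4) p(1) q(1) mult.hyps
        poly_fun_bounded_linear_compose[OF _ bounded_linear_reflection])
  ultimately show ?case by blast
qed

lemma poly_fun_dunkl_quotient:
  fixes f :: "real ^ 'm \<Rightarrow> real"
  assumes "poly_fun f" "\<alpha> \<noteq> 0"
  shows "poly_fun (dunkl_quotient \<alpha> f)"
    and "f x - f (reflection \<alpha> x) = (\<alpha> \<bullet> x) * dunkl_quotient \<alpha> f x"
proof -
  obtain q where q: "poly_fun q"
    "\<And>x. f x - f (reflection \<alpha> x) = (\<alpha> \<bullet> x) * q x"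
    using poly_fun_divided_difference[OF assms] by blast
  have "dunkl_quotient \<alpha> f x = q x" for x
  proof (cases "\<alpha> \<bullet> x = 0")
    case True
    \<comment> \<open>Off the hyperplane the quotient is the polynomial \<open>q\<close>, whose
      continuity identifies the limit in the definition.\<close>
    have "(q \<longlongrightarrow> q x) (at x within {z. \<alpha> \<bullet> z \<noteq> 0})"
      using poly_fun_continuous_on[OF q(1), of UNIV]
      by (auto simp: continuous_on_def intro: tendsto_within_subset)
    moreover have "\<forall>\<^sub>F z in at x within {z. \<alpha> \<bullet> z \<noteq> 0}. q z = (f z - f (reflection \<alpha> z)) / (\<alpha> \<bullet> z)"
      by (auto simp: eventually_at_filter q(2))
    ultimately have "((\<lambda>z. (f z - f (reflection \<alpha> z)) / (\<alpha> \<bullet> z)) \<longlongrightarrow> q x) (at x within {z. \<alpha> \<bullet> z \<noteq> 0})"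
      by (rule Lim_transform_eventually)
    then show ?thesis
      using True not_trivial_limit_off_hyperplane[OF assms(2) True]
      by (simp add: dunkl_quotient_def tendsto_Lim)
  qed (simp add: dunkl_quotient_def q(2))
  then have "dunkl_quotient \<alpha> f = q" by (rule ext)
  then show "poly_fun (dunkl_quotient \<alpha> f)"
    "f x - f (reflection \<alpha> x) = (\<alpha> \<bullet> x) * dunkl_quotient \<alpha> f x"
    using q by simp_all
qed

section \<open>Root systems\<close>

locale dunkl_setup =
  fixes R P :: "(real ^ 'm) set" and k :: "real ^ 'm \<Rightarrow> real"
  assumes root_system: "reduced_root_system R"
    and positive: "positive_subsystem R P"
    and k_invariant: "\<forall>w\<in>refl_group R. \<forall>\<alpha>\<in>R. k (w \<alpha>) = k \<alpha>"
    and k_nonneg: "\<forall>\<alpha>\<in>R. 0 \<le> k \<alpha>"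
begin

lemma finite_R: "finite R" and zero_notin_R: "0 \<notin> R" and span_R: "span R = UNIV"
  using root_system by (auto simp: reduced_root_system_def)

lemma reflection_image: "\<alpha> \<in> R \<Longrightarrow> reflection \<alpha> ` R = R"
  using root_system by (auto simp: reduced_root_system_def)

lemma reflection_in_R: "\<alpha> \<in> R \<Longrightarrow> \<beta> \<in> R \<Longrightarrow> reflection \<alpha> \<beta> \<in> R"
  using reflection_image by blast

lemma uminus_in_R: "\<alpha> \<in> R \<Longrightarrow> - \<alpha> \<in> R"
  using reflection_in_R[of \<alpha> \<alpha>] by simp

lemma reflection_in_W: "\<alpha> \<in> R \<Longrightarrow> reflection \<alpha> \<in> refl_group R"
  using refl_group_comp[OF _ refl_group_id, of \<alpha>] by simp

lemma k_reflection: "\<alpha> \<in> R \<Longrightarrow> \<beta> \<in> R \<Longrightarrow> k (reflection \<alpha> \<beta>) = k \<beta>"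
  using k_invariant reflection_in_W by blast

lemma k_uminus: "\<alpha> \<in> R \<Longrightarrow> k (- \<alpha>) = k \<alpha>"
  using k_reflection[of \<alpha> \<alpha>] by simp

lemma P_subset: "P \<subseteq> R"
  using positive by (auto simp: positive_subsystem_def positive_roots_def)

lemma finite_P: "finite P"
  using P_subset finite_R by (rule finite_subset)

lemma zero_notin_P: "0 \<notin> P"
  using P_subset zero_notin_R by blast

lemma P_nonzero: "\<alpha> \<in> P \<Longrightarrow> \<alpha> \<noteq> 0"
  using zero_notin_P by blast

lemma k_nonneg_P: "\<alpha> \<in> P \<Longrightarrow> 0 \<le> k \<alpha>"
  using k_nonneg P_subset by blast

lemma R_eq_P_Un: "R = P \<union> uminus ` P"
proof -
  obtain S where S: "simple_system R S" and P: "P = positive_roots R S"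
    using positive by (auto simp: positive_subsystem_def)
  have "\<beta> \<in> P \<union> uminus ` P" if \<beta>: "\<beta> \<in> R" for \<beta>
  proof -
    obtain c where c: "\<beta> = (\<Sum>\<alpha>\<in>S. c \<alpha> *\<^sub>R \<alpha>)"
      "(\<forall>\<alpha>\<in>S. 0 \<le> c \<alpha>) \<or> (\<forall>\<alpha>\<in>S. c \<alpha> \<le> 0)"
      using S \<beta> unfolding simple_system_def by blast
    show ?thesis
    proof (cases "\<forall>\<alpha>\<in>S. 0 \<le> c \<alpha>")
      case True
      then show ?thesis using \<beta> c(1) by (auto simp: P positive_roots_def)
    next
      case False
      then have "\<forall>\<alpha>\<in>S. 0 \<le> - c \<alpha>" using c(2) by auto
      moreover have "- \<beta> = (\<Sum>\<alpha>\<in>S. (- c \<alpha>) *\<^sub>R \<alpha>)"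
        by (simp add: c(1) sum_negf)
      ultimately have "- \<beta> \<in> P"
        using uminus_in_R[OF \<beta>] by (auto simp: P positive_roots_def intro!: exI[of _ "\<lambda>\<alpha>. - c \<alpha>"])
      then show ?thesis by (metis UnI2 image_eqI minus_minus)
    qed
  qed
  then have "R \<subseteq> P \<union> uminus ` P" by (rule subsetI)
  moreover have "uminus ` P \<subseteq> R" using P_subset uminus_in_R by blast
  ultimately show ?thesis using P_subset by blast
qed

text \<open>The functional with value 1 on each simple root is the height, a sum of nonnegative
  coefficients that are not all zero on a positive root. The representing vector serves three times:
  it separates \<open>P\<close> from its negative, it is transversal to all root hyperplanes, and it
  shows that the chamber is nonempty.\<close>

lemma exists_positive_on_P: "\<exists>x. \<forall>\<alpha>\<in>P. 0 < \<alpha> \<bullet> x"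
proof -
  obtain S where S: "simple_system R S" and P: "P = positive_roots R S"
    using positive by (auto simp: positive_subsystem_def)
  have "independent S" using S by (simp add: simple_system_def)
  then obtain L :: "real ^ 'm \<Rightarrow> real" where L: "linear L" "\<forall>\<alpha>\<in>S. L \<alpha> = 1"
    using linear_independent_extend[of S "\<lambda>_. 1 :: real"] by blast
  have "0 < \<alpha> \<bullet> adjoint L 1" if \<alpha>: "\<alpha> \<in> P" for \<alpha>
  proof -
    obtain c where c: "\<forall>\<alpha>\<in>S. 0 \<le> c \<alpha>" "\<alpha> = (\<Sum>\<alpha>\<in>S. c \<alpha> *\<^sub>R \<alpha>)"
      using \<alpha> by (auto simp: P positive_roots_def)
    have "finite S" using S finite_R finite_subset by (auto simp: simple_system_def)
    have "L \<alpha> = (\<Sum>\<alpha>\<in>S. c \<alpha>)"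
      using L by (simp add: c(2) linear_sum linear_scale)
    moreover have "(\<Sum>\<alpha>\<in>S. c \<alpha>) \<noteq> 0"
    proof
      assume "(\<Sum>\<alpha>\<in>S. c \<alpha>) = 0"
      then have "\<forall>\<alpha>\<in>S. c \<alpha> = 0" using c(1) \<open>finite S\<close> by (simp add: sum_nonneg_eq_0_iff)
      then show False using P_nonzero[OF \<alpha>] c(2) by simp
    qed
    moreover have "0 \<le> (\<Sum>\<alpha>\<in>S. c \<alpha>)" using c(1) by (simp add: sum_nonneg)
    moreover have "\<alpha> \<bullet> adjoint L 1 = L \<alpha>" using adjoint_works[OF L(1), of \<alpha> 1] by simp
    ultimately show ?thesis by simp
  qed
  then show ?thesis by blast
qed

lemma P_disjoint_uminus: "P \<inter> uminus ` P = {}"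
proof -
  obtain x where x: "\<forall>\<alpha>\<in>P. 0 < \<alpha> \<bullet> x" using exists_positive_on_P by blast
  have "- \<alpha> \<notin> P" if "\<alpha> \<in> P" for \<alpha>
    using bspec[OF x, of \<alpha>] bspec[OF x, of "- \<alpha>"] that by fastforce
  then show ?thesis by blast
qed

text \<open>A reflection permutes \<open>R\<close> but not \<open>P\<close>. Sums of terms even in
  the root are moved to \<open>R\<close>, at the cost of a factor 2, so that they can be
  reindexed.\<close>

lemma sum_R_even:
  fixes t :: "real ^ 'm \<Rightarrow> real"
  assumes "\<And>\<alpha>. \<alpha> \<in> R \<Longrightarrow> t (- \<alpha>) = t \<alpha>"
  shows "(\<Sum>\<alpha>\<in>R. t \<alpha>) = 2 * (\<Sum>\<alpha>\<in>P. t \<alpha>)"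
proof -
  have "(\<Sum>\<alpha>\<in>R. t \<alpha>) = (\<Sum>\<alpha>\<in>P. t \<alpha>) + (\<Sum>\<alpha>\<in>uminus ` P. t \<alpha>)"
    using R_eq_P_Un P_disjoint_uminus finite_P by (metis finite_imageI sum.union_disjoint)
  also have "(\<Sum>\<alpha>\<in>uminus ` P. t \<alpha>) = (\<Sum>\<alpha>\<in>P. t (- \<alpha>))"
    by (subst sum.reindex) (auto simp: inj_on_def)
  also have "\<dots> = (\<Sum>\<alpha>\<in>P. t \<alpha>)"
    using assms P_subset by (intro sum.cong) auto
  finally show ?thesis by simp
qed

lemma sum_R_reflection:
  assumes "\<alpha> \<in> R"
  shows "(\<Sum>\<beta>\<in>R. t (reflection \<alpha> \<beta>)) = (\<Sum>\<beta>\<in>R. t \<beta>)"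
  using reflection_in_R[OF assms]
  by (intro sum.reindex_bij_witness[where i = "reflection \<alpha>" and j = "reflection \<alpha>"]) auto

section \<open>The reflection group\<close>

abbreviation W :: "(real ^ 'm \<Rightarrow> real ^ 'm) set" where
  "W \<equiv> refl_group R"

abbreviation T :: "'m \<Rightarrow> (real ^ 'm \<Rightarrow> real) \<Rightarrow> real ^ 'm \<Rightarrow> real" where
  "T i \<equiv> dunkl_op P k i"

lemma linear_W: "w \<in> W \<Longrightarrow> linear w"
proof (induction rule: refl_group.induct)
  case (refl_group_comp \<alpha> w)
  show ?case by (rule linear_compose[OF refl_group_comp.IH linear_reflection])
qed (rule linear_id)

lemma W_maps_R: "w \<in> W \<Longrightarrow> \<alpha> \<in> R \<Longrightarrow> w \<alpha> \<in> R"
  by (induction rule: refl_group.induct) (auto intro: reflection_in_R)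

lemma inner_W: "w \<in> W \<Longrightarrow> w x \<bullet> w y = x \<bullet> y"
  by (induction rule: refl_group.induct) auto

lemma norm_W: "w \<in> W \<Longrightarrow> norm (w x) = norm x"
  by (simp add: norm_eq_sqrt_inner inner_W)

lemma bounded_linear_W: "w \<in> W \<Longrightarrow> bounded_linear w"
  using linear_W linear_conv_bounded_linear by blast

lemma W_comp_reflection: "w \<in> W \<Longrightarrow> \<alpha> \<in> R \<Longrightarrow> w \<circ> reflection \<alpha> \<in> W"
proof (induction rule: refl_group.induct)
  case refl_group_id
  then show ?case using reflection_in_W by simp
next
  case (refl_group_comp \<beta> w)
  show ?case
    unfolding comp_assoc
    by (rule refl_group.refl_group_comp[OF refl_group_comp.hyps(1) refl_group_comp.IH[OF refl_group_comp.prems]])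
qed

text \<open>Group elements are linear and \<open>R\<close> spans, so each is determined by the map
  it induces on the finite set \<open>R\<close>.\<close>

lemma finite_W: "finite W"
proof (rule inj_on_finite[where f = "\<lambda>w. restrict w R"])
  show "(\<lambda>w. restrict w R) ` W \<subseteq> R \<rightarrow>\<^sub>E R"
    using W_maps_R by auto
  show "finite (R \<rightarrow>\<^sub>E R)" using finite_R by (auto intro: finite_PiE)
  show "inj_on (\<lambda>w. restrict w R) W"
  proof (rule inj_onI)
    fix v w assume vw: "v \<in> W" "w \<in> W" "restrict v R = restrict w R"
    then have "v \<alpha> = w \<alpha>" if "\<alpha> \<in> R" for \<alpha>
      using that by (metis restrict_apply')
    then show "v = w"
      using linear_eq_on_span[OF linear_W[OF vw(1)] linear_W[OF vw(2)], of R] span_R by (auto simp: fun_eq_iff)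
  qed
qed

lemma W_nonempty: "W \<noteq> {}"
  using refl_group_id by blast

lemma sum_W_comp_reflection:
  assumes "\<alpha> \<in> R"
  shows "(\<Sum>w\<in>W. t (w \<circ> reflection \<alpha>)) = (\<Sum>w\<in>W. t w)"
proof -
  have "w \<circ> reflection \<alpha> \<circ> reflection \<alpha> = w" for w :: "real ^ 'm \<Rightarrow> real ^ 'm"
    by (auto simp: fun_eq_iff)
  then show ?thesis
    using W_comp_reflection[OF _ assms]
    by (intro sum.reindex_bij_witness[where i = "\<lambda>w. w \<circ> reflection \<alpha>" and j = "\<lambda>w. w \<circ> reflection \<alpha>"]) auto
qed

section \<open>Commutativity of the Dunkl operators\<close>

text \<open>A rotation \<open>w = reflection \<alpha> \<circ> reflection \<beta>\<close> determines the antisymmetric map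
  \<open>N = inverse of w - w\<close>, and the identity below makes the rotation part of the commutator
  telescope along the cyclic shift \<open>(\<alpha>, \<beta>) \<mapsto> (\<beta>, reflection \<beta> \<alpha>)\<close>.\<close>

definition rot_diff :: "(real ^ 'm \<Rightarrow> real ^ 'm) \<Rightarrow> real ^ 'm \<Rightarrow> real ^ 'm" where
  "rot_diff w v = inv w v - w v"

abbreviation rot_pairs :: "(real ^ 'm \<Rightarrow> real ^ 'm) \<Rightarrow> ((real ^ 'm) \<times> (real ^ 'm)) set" where
  "rot_pairs w \<equiv> {(\<alpha>, \<beta>). \<alpha> \<in> R \<and> \<beta> \<in> R \<and> reflection \<alpha> \<circ> reflection \<beta> = w}"

lemma inv_reflection_comp: "inv (reflection \<alpha> \<circ> reflection \<beta>) = reflection \<beta> \<circ> reflection \<alpha>"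
  by (rule inv_unique_comp) (auto simp: fun_eq_iff)

lemma rot_diff_eq:
  assumes "\<alpha> \<noteq> 0" "\<beta> \<noteq> 0"
  shows "rot_diff (reflection \<alpha> \<circ> reflection \<beta>) v =
    (4 * (\<alpha> \<bullet> \<beta>) / ((\<alpha> \<bullet> \<alpha>) * (\<beta> \<bullet> \<beta>))) *\<^sub>R ((\<alpha> \<bullet> v) *\<^sub>R \<beta> - (\<beta> \<bullet> v) *\<^sub>R \<alpha>)"
proof -
  have "rot_diff (reflection \<alpha> \<circ> reflection \<beta>) v = reflection \<beta> (reflection \<alpha> v) - reflection \<alpha> (reflection \<beta> v)"
    by (simp add: rot_diff_def inv_reflection_comp)
  also have "\<dots> = (2 * (\<alpha> \<bullet> v) / (\<alpha> \<bullet> \<alpha>) * (2 * (\<alpha> \<bullet> \<beta>) / (\<beta> \<bullet> \<beta>))) *\<^sub>R \<beta>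
      - (2 * (\<beta> \<bullet> v) / (\<beta> \<bullet> \<beta>) * (2 * (\<alpha> \<bullet> \<beta>) / (\<alpha> \<bullet> \<alpha>))) *\<^sub>R \<alpha>"
    by (simp add: reflection_def inner_diff_right inner_commute[of \<beta> \<alpha>] diff_divide_distrib algebra_simps)
  also have "\<dots> = (4 * (\<alpha> \<bullet> \<beta>) / ((\<alpha> \<bullet> \<alpha>) * (\<beta> \<bullet> \<beta>))) *\<^sub>R ((\<alpha> \<bullet> v) *\<^sub>R \<beta> - (\<beta> \<bullet> v) *\<^sub>R \<alpha>)"
    by (simp add: scaleR_diff_right mult_ac)
  finally show ?thesis .
qed

lemma telescoping_identity:
  assumes "\<alpha> \<noteq> 0" "\<beta> \<noteq> 0" "\<alpha> \<bullet> x \<noteq> 0" "\<beta> \<bullet> x \<noteq> 0"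
    and N: "N = rot_diff (reflection \<alpha> \<circ> reflection \<beta>)"
  shows "(N x \<bullet> N x) * ((\<alpha> $ i * \<beta> $ j - \<alpha> $ j * \<beta> $ i) / ((\<alpha> \<bullet> x) * (\<beta> \<bullet> x)))
    = (N (axis i 1)) $ j * ((x \<bullet> N \<alpha>) / (\<alpha> \<bullet> x) - (x \<bullet> N \<beta>) / (\<beta> \<bullet> x))"
proof -
  define a b c p q where "a = \<alpha> \<bullet> \<alpha>" "b = \<beta> \<bullet> \<beta>" "c = \<alpha> \<bullet> \<beta>" "p = \<alpha> \<bullet> x" "q = \<beta> \<bullet> x"
  have nz: "a \<noteq> 0" "b \<noteq> 0" "p \<noteq> 0" "q \<noteq> 0"
    using assms by (auto simp: a_b_c_p_q_def)
  have "N x = (4 * c / (a * b)) *\<^sub>R (p *\<^sub>R \<beta> - q *\<^sub>R \<alpha>)"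
    using rot_diff_eq[OF assms(1,2), of x] by (simp add: N a_b_c_p_q_def)
  moreover have "(p *\<^sub>R \<beta> - q *\<^sub>R \<alpha>) \<bullet> (p *\<^sub>R \<beta> - q *\<^sub>R \<alpha>) = p\<^sup>2 * b + q\<^sup>2 * a - 2 * p * q * c"
    by (simp add: a_b_c_p_q_def(1-3) inner_diff_left inner_diff_right inner_commute[of \<beta> \<alpha>] power2_eq_square algebra_simps)
  ultimately have Nx: "N x \<bullet> N x = (4 * c / (a * b))\<^sup>2 * (p\<^sup>2 * b + q\<^sup>2 * a - 2 * p * q * c)"
    by (simp add: power2_eq_square)
  have Ni: "(N (axis i 1)) $ j = 4 * c / (a * b) * (\<alpha> $ i * \<beta> $ j - \<alpha> $ j * \<beta> $ i)"
    using rot_diff_eq[OF assms(1,2), of "axis i 1"]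
    by (simp add: N a_b_c_p_q_def inner_axis mult.commute)
  have Na: "x \<bullet> N \<alpha> = 4 * c / (a * b) * (a * q - c * p)"
    using rot_diff_eq[OF assms(1,2), of \<alpha>]
    by (simp add: N a_b_c_p_q_def inner_diff_right inner_commute[of \<beta> \<alpha>] inner_commute[of x])
  have Nb: "x \<bullet> N \<beta> = 4 * c / (a * b) * (c * q - b * p)"
    using rot_diff_eq[OF assms(1,2), of \<beta>]
    by (simp add: N a_b_c_p_q_def inner_diff_right inner_commute[of \<beta> \<alpha>] inner_commute[of x])
  define u B where "u = 4 * c / (a * b)" and "B = \<alpha> $ i * \<beta> $ j - \<alpha> $ j * \<beta> $ i"
  \<comment> \<open>Up to the factor \<open>u * B\<close> common to both sides, the claim is this
    identity between inner products.\<close>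
  have "u * (a * q - c * p) / p - u * (c * q - b * p) / q = u * (p\<^sup>2 * b + q\<^sup>2 * a - 2 * p * q * c) / (p * q)"
    using nz by (simp add: field_simps power2_eq_square)
  then show ?thesis
    unfolding Nx Ni Na Nb a_b_c_p_q_def(4,5)[symmetric] u_def[symmetric] B_def[symmetric]
    by (simp add: power2_eq_square)
qed

text \<open>All pairs with product \<open>w\<close> share the map \<open>rot_diff w\<close>. After
  multiplication by the squared norm of its value at \<open>x\<close>, each term is a difference of
  one and the same function at the two roots, and the two halves have equal sums. If that value is
  zero, the sum vanishes either term by term or because exchanging the two roots changes the sign of
  each term.\<close>

lemma rotation_sum_zero:
  assumes reg: "\<And>\<alpha>. \<alpha> \<in> R \<Longrightarrow> \<alpha> \<bullet> x \<noteq> 0"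
  shows "(\<Sum>(\<alpha>, \<beta>)\<in>rot_pairs w.
    k \<alpha> * k \<beta> * ((\<alpha> $ i * \<beta> $ j - \<alpha> $ j * \<beta> $ i) / ((\<alpha> \<bullet> x) * (\<beta> \<bullet> x)))) = 0"
    (is "(\<Sum>(\<alpha>, \<beta>)\<in>?S. k \<alpha> * k \<beta> * ?B \<alpha> \<beta>) = 0")
proof -
  let ?N = "rot_diff w"
  let ?s = "\<lambda>\<alpha>. (x \<bullet> ?N \<alpha>) / (\<alpha> \<bullet> x)"
  have nz: "\<alpha> \<noteq> 0" if "\<alpha> \<in> R" for \<alpha> using that zero_notin_R by blast
  have key: "(?N x \<bullet> ?N x) * ?B \<alpha> \<beta> = (?N (axis i 1)) $ j * (?s \<alpha> - ?s \<beta>)"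
    if "(\<alpha>, \<beta>) \<in> ?S" for \<alpha> \<beta>
    using that by (intro telescoping_identity) (auto simp: nz reg)
  \<comment> \<open>The cyclic shift keeps the product of the two reflections, by the conjugation
    rule, and keeps the weight \<open>k \<alpha> * k \<beta>\<close>, by invariance of
    \<open>k\<close>.\<close>
  have shift: "(\<Sum>(\<alpha>, \<beta>)\<in>?S. k \<alpha> * k \<beta> * ?s \<beta>) = (\<Sum>(\<alpha>, \<beta>)\<in>?S. k \<alpha> * k \<beta> * ?s \<alpha>)"
  proof (rule sum.reindex_bij_witness[where j = "\<lambda>(\<alpha>, \<beta>). (\<beta>, reflection \<beta> \<alpha>)" and i = "\<lambda>(\<alpha>, \<beta>). (reflection \<alpha> \<beta>, \<alpha>)"])
    fix p assume "p \<in> ?S"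
    then obtain \<alpha> \<beta> where p: "p = (\<alpha>, \<beta>)" "\<alpha> \<in> R" "\<beta> \<in> R" "reflection \<alpha> \<circ> reflection \<beta> = w" by auto
    have "reflection \<beta> (reflection (reflection \<beta> \<alpha>) v) = reflection \<alpha> (reflection \<beta> v)" for v
      using reflection_conjugate[of \<beta> \<alpha> "reflection \<beta> v"] by simp
    then show "(case p of (\<alpha>, \<beta>) \<Rightarrow> (\<beta>, reflection \<beta> \<alpha>)) \<in> ?S"
      using p by (auto simp: reflection_in_R fun_eq_iff)
    have "reflection (reflection \<alpha> \<beta>) (reflection \<alpha> v) = reflection \<alpha> (reflection \<beta> v)" for v
      by (rule reflection_conjugate)
    then show "(case p of (\<alpha>, \<beta>) \<Rightarrow> (reflection \<alpha> \<beta>, \<alpha>)) \<in> ?S"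
      using p by (auto simp: reflection_in_R fun_eq_iff)
    show "(case case p of (\<alpha>, \<beta>) \<Rightarrow> (\<beta>, reflection \<beta> \<alpha>) of (\<alpha>, \<beta>) \<Rightarrow> k \<alpha> * k \<beta> * ?s \<alpha>)
        = (case p of (\<alpha>, \<beta>) \<Rightarrow> k \<alpha> * k \<beta> * ?s \<beta>)"
      using p by (simp add: k_reflection)
  qed auto
  have "(?N x \<bullet> ?N x) * (\<Sum>(\<alpha>, \<beta>)\<in>?S. k \<alpha> * k \<beta> * ?B \<alpha> \<beta>)
      = (\<Sum>(\<alpha>, \<beta>)\<in>?S. k \<alpha> * k \<beta> * ((?N x \<bullet> ?N x) * ?B \<alpha> \<beta>))"
    unfolding sum_distrib_left by (intro sum.cong refl) (auto simp: mult_ac)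
  also have "\<dots> = (\<Sum>(\<alpha>, \<beta>)\<in>?S. (?N (axis i 1)) $ j * (k \<alpha> * k \<beta> * ?s \<alpha> - k \<alpha> * k \<beta> * ?s \<beta>))"
  proof (intro sum.cong refl)
    fix p assume "p \<in> ?S"
    then obtain \<alpha> \<beta> where p: "p = (\<alpha>, \<beta>)" "(\<alpha>, \<beta>) \<in> ?S" by (cases p) blast
    have "k \<alpha> * k \<beta> * ((?N x \<bullet> ?N x) * ?B \<alpha> \<beta>) = (?N (axis i 1)) $ j * (k \<alpha> * k \<beta> * ?s \<alpha> - k \<alpha> * k \<beta> * ?s \<beta>)"
      unfolding key[OF p(2)] by (simp only: right_diff_distrib mult_ac)
    then show "(case p of (\<alpha>, \<beta>) \<Rightarrow> k \<alpha> * k \<beta> * ((?N x \<bullet> ?N x) * ?B \<alpha> \<beta>))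
        = (case p of (\<alpha>, \<beta>) \<Rightarrow> (?N (axis i 1)) $ j * (k \<alpha> * k \<beta> * ?s \<alpha> - k \<alpha> * k \<beta> * ?s \<beta>))"
      by (simp only: p(1) prod.case)
  qed
  also have "\<dots> = (?N (axis i 1)) $ j * ((\<Sum>(\<alpha>, \<beta>)\<in>?S. k \<alpha> * k \<beta> * ?s \<alpha>) - (\<Sum>(\<alpha>, \<beta>)\<in>?S. k \<alpha> * k \<beta> * ?s \<beta>))"
    by (simp add: case_prod_unfold sum_subtractf sum_distrib_left[symmetric])
  also have "\<dots> = 0" by (simp only: shift diff_self mult_zero_right)
  finally have "?N x \<bullet> ?N x = 0 \<or> ?thesis" by simp
  moreover have ?thesis if N0: "?N x \<bullet> ?N x = 0"
  proof (cases "\<exists>\<alpha> \<beta>. (\<alpha>, \<beta>) \<in> ?S \<and> ?B \<alpha> \<beta> \<noteq> 0")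
    case False
    then show ?thesis by (intro sum.neutral) fastforce
  next
    case True
    then obtain \<alpha> \<beta> where ab: "\<alpha> \<in> R" "\<beta> \<in> R" "reflection \<alpha> \<circ> reflection \<beta> = w" and B: "?B \<alpha> \<beta> \<noteq> 0" by auto
    have "?N x = 0" using N0 by simp
    then have "\<alpha> \<bullet> \<beta> = 0 \<or> (\<alpha> \<bullet> x) *\<^sub>R \<beta> = (\<beta> \<bullet> x) *\<^sub>R \<alpha>"
      using rot_diff_eq[OF nz nz, OF ab(1,2), of x] ab by (simp add: nz)
    \<comment> \<open>Equality would make the roots proportional and annihilate the alternating
      numerator of \<open>?B \<alpha> \<beta>\<close>; only orthogonality is left.\<close>
    moreover have "(\<alpha> \<bullet> x) *\<^sub>R \<beta> \<noteq> (\<beta> \<bullet> x) *\<^sub>R \<alpha>"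
    proof
      assume "(\<alpha> \<bullet> x) *\<^sub>R \<beta> = (\<beta> \<bullet> x) *\<^sub>R \<alpha>"
      then have "(\<alpha> \<bullet> x) * \<beta> $ l = (\<beta> \<bullet> x) * \<alpha> $ l" for l
        by (metis real_scaleR_def vector_scaleR_component)
      from this[of i] this[of j] have "(\<alpha> \<bullet> x) * (\<alpha> $ i * \<beta> $ j - \<alpha> $ j * \<beta> $ i) = 0"
        by (simp add: algebra_simps)
      then show False using B reg[OF ab(1)] by simp
    qed
    ultimately have orth: "\<alpha> \<bullet> \<beta> = 0" by blast
    have swap_w: "reflection \<beta> \<circ> reflection \<alpha> = w"
      unfolding ab(3)[symmetric] using orth
      by (auto simp: fun_eq_iff reflection_def inner_diff_right inner_commute[of \<beta> \<alpha>])
    \<comment> \<open>Reflections in orthogonal roots commute, so \<open>w\<close> is its own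
      inverse. Inversion exchanges the roots of a pair, hence the exchange acts on all of
      \<open>?S\<close> and not only on the orthogonal pair found.\<close>
    have swap: "(\<delta>, \<gamma>) \<in> ?S" if "(\<gamma>, \<delta>) \<in> ?S" for \<gamma> \<delta>
    proof -
      have "inv w = w" using inv_reflection_comp[of \<alpha> \<beta>] ab(3) swap_w by simp
      then show ?thesis using that inv_reflection_comp[of \<gamma> \<delta>] by auto
    qed
    have "(\<Sum>(\<alpha>, \<beta>)\<in>?S. k \<alpha> * k \<beta> * ?B \<alpha> \<beta>) = (\<Sum>(\<alpha>, \<beta>)\<in>?S. - (k \<alpha> * k \<beta> * ?B \<alpha> \<beta>))"
      by (rule sum.reindex_bij_witness[where i = prod.swap and j = prod.swap])
        (use swap in \<open>auto simp: mult_ac minus_divide_left simp flip: mult_minus_right\<close>)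
    also have "\<dots> = - (\<Sum>(\<alpha>, \<beta>)\<in>?S. k \<alpha> * k \<beta> * ?B \<alpha> \<beta>)"
      by (simp add: case_prod_unfold sum_negf)
    finally show ?thesis by simp
  qed
  ultimately show ?thesis by blast
qed

end

text \<open>A negative radial derivative would give larger values slightly closer to the origin.
  Since \<open>x\<close> is compared with inner points only, it may lie on the boundary of the ball
  over which it is a maximum.\<close>

lemma radial_derivative_nonneg:
  fixes f :: "'a::real_normed_vector \<Rightarrow> real"
  assumes "(f has_derivative f') (at x)" and max: "\<And>t. 0 \<le> t \<Longrightarrow> t \<le> 1 \<Longrightarrow> f (t *\<^sub>R x) \<le> f x"
  shows "0 \<le> f' x"
proof (rule ccontr)
  assume neg: "\<not> 0 \<le> f' x"
  have "((\<lambda>t. f (t *\<^sub>R x)) has_derivative (\<lambda>t. f' (t *\<^sub>R x))) (at 1)"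
    using assms(1) by (intro has_derivative_compose[where f = "\<lambda>t. t *\<^sub>R x" and g = f])
      (auto intro!: derivative_eq_intros)
  then have "((\<lambda>t. f (t *\<^sub>R x)) has_real_derivative f' x) (at 1)"
    using has_derivative_linear[OF assms(1)]
    by (simp add: has_field_derivative_def linear_scale mult.commute[of _ "f' _"])
  then obtain d where d: "d > 0" "\<And>h. 0 < h \<Longrightarrow> h < d \<Longrightarrow> f (1 *\<^sub>R x) < f ((1 - h) *\<^sub>R x)"
    using has_real_derivative_neg_dec_left[of "\<lambda>t. f (t *\<^sub>R x)" "f' x" 1 UNIV] neg by auto
  let ?h = "min (d / 2) 1"
  have "f x < f ((1 - ?h) *\<^sub>R x)" using d(1) d(2)[of ?h] by simp
  moreover have "f ((1 - ?h) *\<^sub>R x) \<le> f x" using d(1) by (intro max) auto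
  ultimately show False by simp
qed

context dunkl_setup
begin

definition regular :: "real ^ 'm \<Rightarrow> bool" where
  "regular x \<longleftrightarrow> (\<forall>\<alpha>\<in>R. \<alpha> \<bullet> x \<noteq> 0)"

text \<open>Along a direction transversal to all root hyperplanes every root has at most one zero,
  so regular points accumulate at every \<open>x\<close>.\<close>

lemma eq_if_eq_regular:
  fixes f g :: "real ^ 'm \<Rightarrow> real"
  assumes "continuous_on UNIV f" "continuous_on UNIV g"
    and eq: "\<And>x. regular x \<Longrightarrow> f x = g x"
  shows "f x = g x"
proof -
  obtain v where v: "\<forall>\<alpha>\<in>P. 0 < \<alpha> \<bullet> v" using exists_positive_on_P by blast
  then have v: "\<alpha> \<bullet> v \<noteq> 0" if "\<alpha> \<in> R" for \<alpha>
    using that unfolding R_eq_P_Un by fastforce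
  have "\<forall>\<^sub>F t in at 0. \<alpha> \<bullet> (x + t *\<^sub>R v) \<noteq> 0" if \<alpha>: "\<alpha> \<in> R" for \<alpha>
  proof (cases "\<alpha> \<bullet> x = 0")
    case True
    then show ?thesis
      using v[OF \<alpha>] by (simp add: inner_add_right eventually_at_filter)
  next
    case False
    have "((\<lambda>t. \<alpha> \<bullet> (x + t *\<^sub>R v)) \<longlongrightarrow> \<alpha> \<bullet> (x + 0 *\<^sub>R v)) (at 0)"
      by (intro tendsto_intros)
    then show ?thesis using False by (intro tendsto_imp_eventually_ne) auto
  qed
  then have "\<forall>\<^sub>F t in at 0. regular (x + t *\<^sub>R v)"
    unfolding regular_def using finite_R by (simp add: eventually_ball_finite)
  then have ev: "\<forall>\<^sub>F t in at 0. g (x + t *\<^sub>R v) = f (x + t *\<^sub>R v)"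
    by eventually_elim (simp add: eq)
  have lim: "((\<lambda>t. h (x + t *\<^sub>R v)) \<longlongrightarrow> h x) (at (0::real))" if "continuous_on UNIV h" for h :: "real ^ 'm \<Rightarrow> real"
  proof -
    have "isCont h (x + 0 *\<^sub>R v)"
      using that by (simp add: continuous_on_eq_continuous_at)
    then have "((\<lambda>t. h (x + t *\<^sub>R v)) \<longlongrightarrow> h (x + 0 *\<^sub>R v)) (at (0::real))"
      by (rule isCont_tendsto_compose) (intro tendsto_intros)
    then show ?thesis by simp
  qed
  have L: "((\<lambda>t. f (x + t *\<^sub>R v)) \<longlongrightarrow> g x) (at (0::real))"
    by (rule Lim_transform_eventually[OF lim[OF assms(2)] ev])
  show ?thesis
    by (rule tendsto_unique[OF _ lim[OF assms(1)] L]) simp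
qed

lemma inner_root_regular: "regular x \<Longrightarrow> \<alpha> \<in> P \<Longrightarrow> \<alpha> \<bullet> x \<noteq> 0"
  using P_subset by (auto simp: regular_def)

lemma dunkl_quotient_regular:
  "regular x \<Longrightarrow> \<alpha> \<in> P \<Longrightarrow> dunkl_quotient \<alpha> f x = (f x - f (reflection \<alpha> x)) / (\<alpha> \<bullet> x)"
  by (simp add: dunkl_quotient_def inner_root_regular)

text \<open>Summed over all pairs of roots, the coefficient \<open>c\<close> is antisymmetric, while
  the terms with at most one reflection form a symmetric expression and cancel. The doubly reflected
  terms are grouped by the rotation applied to \<open>x\<close>, and the coefficients of each group
  sum to zero.\<close>

lemma double_sum_vanishes:
  fixes f :: "real ^ 'm \<Rightarrow> real"
  assumes reg: "regular x"
  shows "(\<Sum>\<alpha>\<in>P. \<Sum>\<beta>\<in>P. k \<alpha> * k \<beta> * (\<alpha> $ i * \<beta> $ j - \<alpha> $ j * \<beta> $ i) *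
    dunkl_quotient \<alpha> (dunkl_quotient \<beta> f) x) = 0"
proof -
  let ?B = "\<lambda>\<alpha> \<beta>. \<alpha> $ i * \<beta> $ j - \<alpha> $ j * \<beta> $ i"
  define c where "c \<alpha> \<beta> = k \<alpha> * k \<beta> * (?B \<alpha> \<beta> / ((\<alpha> \<bullet> x) * (\<beta> \<bullet> x)))" for \<alpha> \<beta>
  define h where "h \<alpha> \<beta> = f x - f (reflection \<beta> x)" for \<alpha> \<beta> :: "real ^ 'm"
  define h' where "h' \<alpha> \<beta> = f (reflection \<alpha> x) - f (reflection \<alpha> (reflection \<beta> x))" for \<alpha> \<beta>
  define E where "E \<alpha> \<beta> = c \<alpha> \<beta> * h \<alpha> \<beta> - c \<alpha> (reflection \<alpha> \<beta>) * h' \<alpha> (reflection \<alpha> \<beta>)" for \<alpha> \<beta>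
  have E: "k \<alpha> * k \<beta> * ?B \<alpha> \<beta> * dunkl_quotient \<alpha> (dunkl_quotient \<beta> f) x = E \<alpha> \<beta>"
    if ab: "\<alpha> \<in> P" "\<beta> \<in> P" for \<alpha> \<beta>
  proof -
    have R: "\<alpha> \<in> R" "\<beta> \<in> R" using ab P_subset by auto
    have \<beta>': "\<beta> \<bullet> reflection \<alpha> x = reflection \<alpha> \<beta> \<bullet> x" by (simp add: reflection_adjoint)
    have "reflection \<alpha> \<beta> \<bullet> x \<noteq> 0" using reg reflection_in_R[OF R] by (auto simp: regular_def)
    then have "dunkl_quotient \<alpha> (dunkl_quotient \<beta> f) x =
       ((f x - f (reflection \<beta> x)) / (\<beta> \<bullet> x)
        - (f (reflection \<alpha> x) - f (reflection \<beta> (reflection \<alpha> x))) / (reflection \<alpha> \<beta> \<bullet> x)) / (\<alpha> \<bullet> x)"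
      using reg ab by (simp add: dunkl_quotient_def inner_root_regular \<beta>')
    moreover have "reflection \<beta> (reflection \<alpha> x) = reflection \<alpha> (reflection (reflection \<alpha> \<beta>) x)"
      using reflection_conjugate[of \<alpha> "reflection \<alpha> \<beta>" x] by simp
    \<comment> \<open>The reflected root differs from \<open>\<beta>\<close> by a multiple of
      \<open>\<alpha>\<close>, on which the alternating form \<open>?B \<alpha>\<close>
      vanishes.\<close>
    moreover have "?B \<alpha> (reflection \<alpha> \<beta>) = ?B \<alpha> \<beta>"
      by (simp add: reflection_def algebra_simps)
    moreover have "K * B * ((A / b - A' / b') / a) = K * (B / (a * b)) * A - K * (B / (a * b')) * A'"
      for K B A b A' b' a :: real
      by (simp add: diff_divide_distrib right_diff_distrib mult.commute mult.left_commute)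
    ultimately show ?thesis
      using R by (simp add: E_def c_def h_def h'_def k_reflection)
  qed
  have c_neg: "c (- \<alpha>) \<beta> = c \<alpha> \<beta>" "c \<alpha> (- \<beta>) = c \<alpha> \<beta>" if "\<alpha> \<in> R" "\<beta> \<in> R" for \<alpha> \<beta>
    using that by (simp_all add: c_def k_uminus divide_simps) (auto simp: algebra_simps)
  have E_neg: "E (- \<alpha>) \<beta> = E \<alpha> \<beta>" "E \<alpha> (- \<beta>) = E \<alpha> \<beta>" if "\<alpha> \<in> R" "\<beta> \<in> R" for \<alpha> \<beta>
    using that reflection_in_R[OF that] by (simp_all add: E_def c_neg h_def h'_def)
  have c_anti: "c \<beta> \<alpha> = - c \<alpha> \<beta>" for \<alpha> \<beta>
    by (simp add: c_def minus_divide_left flip: mult_minus_right) (simp add: mult.commute)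
  have rot: "(\<Sum>\<alpha>\<in>R. \<Sum>\<beta>\<in>R. c \<alpha> \<beta> * f (reflection \<alpha> (reflection \<beta> x))) = 0"
  proof -
    let ?g = "\<lambda>(\<alpha>, \<beta>). reflection \<alpha> \<circ> reflection \<beta> :: real ^ 'm \<Rightarrow> real ^ 'm"
    let ?t = "\<lambda>(\<alpha>, \<beta>). c \<alpha> \<beta> * f (reflection \<alpha> (reflection \<beta> x))"
    have "(\<Sum>\<alpha>\<in>R. \<Sum>\<beta>\<in>R. c \<alpha> \<beta> * f (reflection \<alpha> (reflection \<beta> x))) = sum ?t (R \<times> R)"
      by (simp add: sum.cartesian_product)
    also have "\<dots> = (\<Sum>w\<in>?g ` (R \<times> R). sum ?t {p. p \<in> R \<times> R \<and> ?g p = w})"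
      using finite_R by (intro sum.image_gen) auto
    also have "\<dots> = 0"
    proof (rule sum.neutral, rule ballI)
      fix w
      have set: "{p. p \<in> R \<times> R \<and> ?g p = w} = rot_pairs w"
        by auto
      have "sum ?t {p. p \<in> R \<times> R \<and> ?g p = w}
          = (\<Sum>(\<alpha>, \<beta>)\<in>rot_pairs w. c \<alpha> \<beta>) * f (w x)"
        unfolding set sum_distrib_right by (intro sum.cong refl) auto
      also have "\<dots> = 0"
        using rotation_sum_zero[where x = x and w = w and i = i and j = j] reg by (simp add: c_def regular_def)
      finally show "sum ?t {p. p \<in> R \<times> R \<and> ?g p = w} = 0" .
    qed
    finally show ?thesis .
  qed
  \<comment> \<open>\<open>E\<close> is even in each root, so each of the two indices contributes a
    factor 2.\<close>
  have "4 * (\<Sum>\<alpha>\<in>P. \<Sum>\<beta>\<in>P. E \<alpha> \<beta>) = (\<Sum>\<alpha>\<in>R. \<Sum>\<beta>\<in>R. E \<alpha> \<beta>)"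
  proof -
    have "(\<Sum>\<alpha>\<in>R. \<Sum>\<beta>\<in>R. E \<alpha> \<beta>) = (\<Sum>\<alpha>\<in>R. 2 * (\<Sum>\<beta>\<in>P. E \<alpha> \<beta>))"
      by (intro sum.cong refl sum_R_even) (simp add: E_neg)
    also have "\<dots> = 2 * (\<Sum>\<alpha>\<in>P. 2 * (\<Sum>\<beta>\<in>P. E \<alpha> \<beta>))"
      using P_subset by (intro sum_R_even arg_cong[where f = "(*) 2"] sum.cong refl) (auto simp: E_neg)
    finally show ?thesis by (simp add: sum_distrib_left)
  qed
  also have "\<dots> = (\<Sum>\<alpha>\<in>R. \<Sum>\<beta>\<in>R. c \<alpha> \<beta> * h \<alpha> \<beta>) - (\<Sum>\<alpha>\<in>R. \<Sum>\<beta>\<in>R. c \<alpha> \<beta> * h' \<alpha> \<beta>)"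
  proof -
    have "(\<Sum>\<beta>\<in>R. c \<alpha> (reflection \<alpha> \<beta>) * h' \<alpha> (reflection \<alpha> \<beta>)) = (\<Sum>\<beta>\<in>R. c \<alpha> \<beta> * h' \<alpha> \<beta>)" if "\<alpha> \<in> R" for \<alpha>
      using sum_R_reflection[OF that, of "\<lambda>\<beta>. c \<alpha> \<beta> * h' \<alpha> \<beta>"] .
    then show ?thesis by (simp add: E_def sum_subtractf)
  qed
  also have "\<dots> = (\<Sum>\<alpha>\<in>R. \<Sum>\<beta>\<in>R. c \<alpha> \<beta> * (f x - f (reflection \<alpha> x) - f (reflection \<beta> x)))"
    using rot by (simp add: h_def h'_def right_diff_distrib sum_subtractf)
  also have "\<dots> = 0"
  proof -
    let ?s = "\<lambda>\<alpha> \<beta>. f x - f (reflection \<alpha> x) - f (reflection \<beta> x)"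
    have "(\<Sum>\<alpha>\<in>R. \<Sum>\<beta>\<in>R. c \<alpha> \<beta> * ?s \<alpha> \<beta>) = (\<Sum>\<beta>\<in>R. \<Sum>\<alpha>\<in>R. c \<alpha> \<beta> * ?s \<alpha> \<beta>)"
      by (rule sum.swap)
    also have "\<dots> = (\<Sum>\<beta>\<in>R. \<Sum>\<alpha>\<in>R. - (c \<beta> \<alpha> * ?s \<beta> \<alpha>))"
    proof (intro sum.cong refl)
      fix \<alpha> \<beta> show "c \<alpha> \<beta> * ?s \<alpha> \<beta> = - (c \<beta> \<alpha> * ?s \<beta> \<alpha>)"
        by (subst c_anti[of \<alpha> \<beta>]) (simp add: algebra_simps)
    qed
    finally show ?thesis by (simp add: sum_negf)
  qed
  finally have "(\<Sum>\<alpha>\<in>P. \<Sum>\<beta>\<in>P. E \<alpha> \<beta>) = 0" by simp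
  moreover have "(\<Sum>\<alpha>\<in>P. \<Sum>\<beta>\<in>P. k \<alpha> * k \<beta> * ?B \<alpha> \<beta> * dunkl_quotient \<alpha> (dunkl_quotient \<beta> f) x) = (\<Sum>\<alpha>\<in>P. \<Sum>\<beta>\<in>P. E \<alpha> \<beta>)"
    by (intro sum.cong refl) (rule E)
  ultimately show ?thesis by simp
qed

text \<open>This comes from differentiating the factorisation of
  \<open>f x - f (reflection \<alpha> x)\<close>. The correction is \<open>\<alpha> $ i\<close>
  times a quantity free of \<open>i\<close>; weighted by \<open>\<alpha> $ j\<close> it is symmetric
  and drops out of the commutator.\<close>

lemma partial_dunkl_quotient_commutator:
  fixes f :: "real ^ 'm \<Rightarrow> real"
  assumes f: "poly_fun f" and reg: "regular x" and \<alpha>: "\<alpha> \<in> P"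
  shows "partial i (dunkl_quotient \<alpha> f) x = dunkl_quotient \<alpha> (partial i f) x +
    \<alpha> $ i * ((2 / (\<alpha> \<bullet> \<alpha>) * (\<Sum>l\<in>UNIV. \<alpha> $ l * partial l f (reflection \<alpha> x)) - dunkl_quotient \<alpha> f x) / (\<alpha> \<bullet> x))"
proof -
  note q = poly_fun_dunkl_quotient[OF f P_nonzero[OF \<alpha>]]
  let ?f\<sigma> = "\<lambda>x. f (reflection \<alpha> x)"
  have f\<sigma>: "poly_fun ?f\<sigma>"
    using f bounded_linear_reflection by (rule poly_fun_bounded_linear_compose)
  have "(\<lambda>x. f x - ?f\<sigma> x) = (\<lambda>x. (\<alpha> \<bullet> x) * dunkl_quotient \<alpha> f x)"
    using q(2) by auto
  then have "partial i (\<lambda>x. f x - ?f\<sigma> x) x = partial i (\<lambda>x. (\<alpha> \<bullet> x) * dunkl_quotient \<alpha> f x) x"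
    by simp
  also have "\<dots> = (\<alpha> \<bullet> x) * partial i (dunkl_quotient \<alpha> f) x + \<alpha> $ i * dunkl_quotient \<alpha> f x"
    by (subst partial_mult[OF poly_fun_inner_right q(1)])
      (simp add: partial_bounded_linear[OF bounded_linear_inner_right] inner_axis)
  also have "partial i (\<lambda>x. f x - ?f\<sigma> x) x = partial i f x - partial i f (reflection \<alpha> x)
    + 2 * \<alpha> $ i / (\<alpha> \<bullet> \<alpha>) * (\<Sum>l\<in>UNIV. \<alpha> $ l * partial l f (reflection \<alpha> x))"
    by (simp add: partial_diff[OF f f\<sigma>] partial_reflection[OF f])
  finally have eq: "partial i f x - partial i f (reflection \<alpha> x)
      + \<alpha> $ i * (2 / (\<alpha> \<bullet> \<alpha>) * (\<Sum>l\<in>UNIV. \<alpha> $ l * partial l f (reflection \<alpha> x)))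
    = (\<alpha> \<bullet> x) * partial i (dunkl_quotient \<alpha> f) x + \<alpha> $ i * dunkl_quotient \<alpha> f x" by (simp add: mult_ac)
  have alg: "q' = p / a + b * ((Z - q) / a)" if "p + b * Z = a * q' + b * q" "a \<noteq> 0"
    for p b Z a q' q :: real
    using that by (simp add: field_simps)
  show ?thesis
    unfolding dunkl_quotient_regular[OF reg \<alpha>, of "partial i f"]
    by (rule alg[OF eq inner_root_regular[OF reg \<alpha>]])
qed

lemma poly_fun_dunkl_op [intro]:
  fixes f :: "real ^ 'm \<Rightarrow> real"
  assumes "poly_fun f"
  shows "poly_fun (T i f)"
proof -
  have "T i f = (\<lambda>x. partial i f x + (\<Sum>\<alpha>\<in>P. k \<alpha> * \<alpha> $ i * dunkl_quotient \<alpha> f x))"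
    by (simp add: dunkl_op_def fun_eq_iff)
  then show ?thesis
    using assms finite_P P_nonzero
    by (auto intro!: poly_fun_intros(3) real_polynomial_function_sum
        poly_fun_cmult
        poly_fun_dunkl_quotient(1))
qed

lemma dunkl_op_commute_regular:
  fixes f :: "real ^ 'm \<Rightarrow> real"
  assumes f: "poly_fun f" and reg: "regular x"
  shows "T i (T j f) x = T j (T i f) x"
proof -
  let ?\<rho> = "\<lambda>\<alpha> h. dunkl_quotient \<alpha> h x"
  define G where "G \<alpha> = (2 / (\<alpha> \<bullet> \<alpha>) * (\<Sum>l\<in>UNIV. \<alpha> $ l * partial l f (reflection \<alpha> x)) - ?\<rho> \<alpha> f) / (\<alpha> \<bullet> x)" for \<alpha>
  have rf: "poly_fun (dunkl_quotient \<alpha> f)" if "\<alpha> \<in> P" for \<alpha>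
    using f P_nonzero[OF that] by (rule poly_fun_dunkl_quotient)
  \<comment> \<open>Everything except the final double sum is symmetric in \<open>i\<close> and
    \<open>j\<close>.\<close>
  have expand: "T i (T j f) x = partial i (partial j f) x
      + (\<Sum>\<alpha>\<in>P. k \<alpha> * (\<alpha> $ j * ?\<rho> \<alpha> (partial i f) + \<alpha> $ i * ?\<rho> \<alpha> (partial j f) + \<alpha> $ i * \<alpha> $ j * G \<alpha>))
      + (\<Sum>\<alpha>\<in>P. \<Sum>\<beta>\<in>P. k \<alpha> * k \<beta> * (\<alpha> $ i * \<beta> $ j) * ?\<rho> \<alpha> (dunkl_quotient \<beta> f))" for i j
  proof -
    have op: "T j f = (\<lambda>x. partial j f x + (\<Sum>\<beta>\<in>P. k \<beta> * \<beta> $ j * dunkl_quotient \<beta> f x))"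
      by (simp add: dunkl_op_def fun_eq_iff)
    have "partial i (T j f) x = partial i (partial j f) x
        + (\<Sum>\<beta>\<in>P. k \<beta> * \<beta> $ j * partial i (dunkl_quotient \<beta> f) x)"
      unfolding op using f finite_P rf
      by (subst partial_add)
        (auto intro!: real_polynomial_function_sum
          poly_fun_cmult
          simp: partial_sum partial_cmult poly_fun_cmult)
    also have "\<dots> = partial i (partial j f) x + (\<Sum>\<beta>\<in>P. k \<beta> * \<beta> $ j * (?\<rho> \<beta> (partial i f) + \<beta> $ i * G \<beta>))"
      by (simp add: partial_dunkl_quotient_commutator[OF f reg] G_def)
    finally have 1: "partial i (T j f) x = \<dots>" .
    have 2: "?\<rho> \<alpha> (T j f) = ?\<rho> \<alpha> (partial j f) + (\<Sum>\<beta>\<in>P. k \<beta> * \<beta> $ j * ?\<rho> \<alpha> (dunkl_quotient \<beta> f))"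
      if "\<alpha> \<in> P" for \<alpha>
      using inner_root_regular[OF reg that]
      by (simp add: op dunkl_quotient_regular[OF reg that] add_divide_distrib diff_divide_distrib
          sum_divide_distrib right_diff_distrib sum_subtractf)
    show ?thesis
      unfolding dunkl_op_def[of P k i "T j f"] 1
      by (simp add: 2 sum.distrib distrib_left sum_distrib_left mult_ac)
  qed
  have "T i (T j f) x - T j (T i f) x
    = (\<Sum>\<alpha>\<in>P. \<Sum>\<beta>\<in>P. k \<alpha> * k \<beta> * (\<alpha> $ i * \<beta> $ j) * ?\<rho> \<alpha> (dunkl_quotient \<beta> f))
     - (\<Sum>\<alpha>\<in>P. \<Sum>\<beta>\<in>P. k \<alpha> * k \<beta> * (\<alpha> $ j * \<beta> $ i) * ?\<rho> \<alpha> (dunkl_quotient \<beta> f))"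
    unfolding expand partial_commute[OF f, of i j]
    by (simp add: add_ac mult_ac)
  also have "\<dots> = (\<Sum>\<alpha>\<in>P. \<Sum>\<beta>\<in>P. k \<alpha> * k \<beta> * (\<alpha> $ i * \<beta> $ j - \<alpha> $ j * \<beta> $ i) * ?\<rho> \<alpha> (dunkl_quotient \<beta> f))"
    by (simp add: sum_subtractf[symmetric] right_diff_distrib left_diff_distrib)
  also have "\<dots> = 0" by (rule double_sum_vanishes[OF reg])
  finally show ?thesis by simp
qed

lemma dunkl_op_commute:
  fixes f :: "real ^ 'm \<Rightarrow> real"
  assumes "poly_fun f"
  shows "T i (T j f) x = T j (T i f) x"
  by (rule eq_if_eq_regular)
    (intro poly_fun_continuous_on poly_fun_dunkl_op assms
      dunkl_op_commute_regular; assumption)+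

text \<open>Contraction with \<open>x\<close> clears the denominators; on a root hyperplane the
  corresponding terms of both sides vanish, so no point is excluded.\<close>

lemma sum_coord_dunkl_op:
  fixes f :: "real ^ 'm \<Rightarrow> real"
  shows "(\<Sum>i\<in>UNIV. x $ i * T i f x)
    = (\<Sum>i\<in>UNIV. x $ i * partial i f x) + (\<Sum>\<alpha>\<in>P. k \<alpha> * (f x - f (reflection \<alpha> x)))"
proof -
  have "(\<Sum>i\<in>UNIV. x $ i * (\<Sum>\<alpha>\<in>P. k \<alpha> * \<alpha> $ i * dunkl_quotient \<alpha> f x))
      = (\<Sum>\<alpha>\<in>P. k \<alpha> * ((\<alpha> \<bullet> x) * dunkl_quotient \<alpha> f x))"
    unfolding inner_vec_def sum_distrib_left sum_distrib_right
    by (subst sum.swap) (simp add: mult_ac)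
  also have "\<dots> = (\<Sum>\<alpha>\<in>P. k \<alpha> * (f x - f (reflection \<alpha> x)))"
    by (intro sum.cong refl) (simp add: dunkl_quotient_def reflection_fixed)
  finally show ?thesis
    by (simp add: dunkl_op_def distrib_left sum.distrib)
qed

text \<open>A twisted Leibniz rule: the coordinate \<open>x $ j\<close> is not reflection invariant,
  and its own quotient \<open>2 * \<alpha> $ j / (\<alpha> \<bullet> \<alpha>)\<close> produces the
  last sum.\<close>

lemma dunkl_op_sum_coord:
  fixes u :: "'m \<Rightarrow> real ^ 'm \<Rightarrow> real"
  assumes u: "\<And>j. poly_fun (u j)" and reg: "regular x"
  shows "T i (\<lambda>x. \<Sum>j\<in>UNIV. x $ j * u j x) x = u i x + (\<Sum>j\<in>UNIV. x $ j * T i (u j) x)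
    + (\<Sum>\<alpha>\<in>P. k \<alpha> * (2 * \<alpha> $ i / (\<alpha> \<bullet> \<alpha>) * (\<Sum>j\<in>UNIV. \<alpha> $ j * u j (reflection \<alpha> x))))"
proof -
  let ?g = "\<lambda>x. \<Sum>j\<in>UNIV. x $ j * u j x"
  have "partial i ?g x = (\<Sum>j\<in>UNIV. partial i (\<lambda>x. x $ j * u j x) x)"
    by (rule partial_sum) (auto intro!: poly_fun_intros(4) u)
  also have "\<dots> = (\<Sum>j\<in>UNIV. x $ j * partial i (u j) x) + (\<Sum>j\<in>UNIV. axis i 1 $ j * u j x)"
    by (simp only: partial_mult[OF poly_fun_vec_nth u]
        partial_bounded_linear[OF bounded_linear_vec_nth] sum.distrib)
  also have "(\<Sum>j\<in>UNIV. axis i 1 $ j * u j x) = u i x"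
    by (simp add: axis_def if_distrib if_distribR cong: if_cong)
  finally have 1: "partial i ?g x = u i x + (\<Sum>j\<in>UNIV. x $ j * partial i (u j) x)"
    by simp
  have 2: "dunkl_quotient \<alpha> ?g x = (\<Sum>j\<in>UNIV. x $ j * dunkl_quotient \<alpha> (u j) x)
      + 2 / (\<alpha> \<bullet> \<alpha>) * (\<Sum>j\<in>UNIV. \<alpha> $ j * u j (reflection \<alpha> x))" if \<alpha>: "\<alpha> \<in> P" for \<alpha>
  proof -
    have nth: "reflection \<alpha> x $ j = x $ j - (\<alpha> \<bullet> x) * (2 / (\<alpha> \<bullet> \<alpha>) * \<alpha> $ j)" for j
      by (simp add: reflection_def)
    have "x $ j * u j x - reflection \<alpha> x $ j * u j (reflection \<alpha> x)
      = x $ j * (u j x - u j (reflection \<alpha> x)) + (\<alpha> \<bullet> x) * (2 / (\<alpha> \<bullet> \<alpha>) * (\<alpha> $ j * u j (reflection \<alpha> x)))" for j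
      unfolding nth by (simp add: algebra_simps)
    then have "?g x - ?g (reflection \<alpha> x) = (\<Sum>j\<in>UNIV. x $ j * (u j x - u j (reflection \<alpha> x)))
       + (\<alpha> \<bullet> x) * (2 / (\<alpha> \<bullet> \<alpha>) * (\<Sum>j\<in>UNIV. \<alpha> $ j * u j (reflection \<alpha> x)))"
      by (simp add: sum_subtractf[symmetric] sum.distrib sum_distrib_left)
    then show ?thesis
      using inner_root_regular[OF reg \<alpha>]
      by (simp add: dunkl_quotient_regular[OF reg \<alpha>] add_divide_distrib sum_divide_distrib)
  qed
  have "(\<Sum>\<alpha>\<in>P. k \<alpha> * \<alpha> $ i * (\<Sum>j\<in>UNIV. x $ j * dunkl_quotient \<alpha> (u j) x))
    = (\<Sum>j\<in>UNIV. x $ j * (\<Sum>\<alpha>\<in>P. k \<alpha> * \<alpha> $ i * dunkl_quotient \<alpha> (u j) x))"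
    unfolding sum_distrib_left by (subst sum.swap) (simp add: mult_ac)
  then show ?thesis
    unfolding dunkl_op_def 1
    by (simp add: 2 distrib_left sum.distrib mult_ac)
qed

text \<open>For the vector field \<open>U\<close> with components \<open>u j\<close> the equation
  says that \<open>U\<close>, its radial derivative and the weighted differences between
  \<open>U\<close> and its reflected transforms add up to zero. At a maximum of the squared norm of
  \<open>U\<close> over a ball, which reflections preserve, the last two have nonnegative inner
  product with \<open>U\<close>; hence \<open>U\<close> vanishes there and on the whole
  ball.\<close>

lemma vector_maximum_principle:
  fixes u :: "'m \<Rightarrow> real ^ 'm \<Rightarrow> real"
  assumes u: "\<And>j. poly_fun (u j)"
    and eq: "\<And>i x. u i x + (\<Sum>j\<in>UNIV. x $ j * partial j (u i) x) + (\<Sum>\<alpha>\<in>P. k \<alpha> * (u i x - u i (reflection \<alpha> x)))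
      + (\<Sum>\<alpha>\<in>P. k \<alpha> * (2 * \<alpha> $ i / (\<alpha> \<bullet> \<alpha>) * (\<Sum>j\<in>UNIV. \<alpha> $ j * u j (reflection \<alpha> x)))) = 0"
  shows "u i x = 0"
proof -
  define U where "U x = (\<chi> j. u j x)" for x
  define E where "E x = (\<chi> i. \<Sum>j\<in>UNIV. x $ j * partial j (u i) x)" for x
  define f where "f x = U x \<bullet> U x" for x
  have der: "(f has_derivative (\<lambda>v. 2 * (U x \<bullet> (\<chi> i. \<Sum>j\<in>UNIV. v $ j * partial j (u i) x)))) (at x)" for x
  proof -
    have "((\<lambda>x. \<Sum>i\<in>UNIV. u i x * u i x) has_derivative
        (\<lambda>v. \<Sum>i\<in>UNIV. u i x * (\<Sum>j\<in>UNIV. v $ j * partial j (u i) x) + (\<Sum>j\<in>UNIV. v $ j * partial j (u i) x) * u i x)) (at x)"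
      by (intro has_derivative_sum has_derivative_mult poly_fun_has_derivative u)
    moreover have "f = (\<lambda>x. \<Sum>i\<in>UNIV. u i x * u i x)"
      by (simp add: f_def U_def inner_vec_def fun_eq_iff)
    ultimately show ?thesis
      by (simp add: U_def inner_vec_def sum_distrib_left[of 2] mult.commute[of "\<Sum>j\<in>UNIV. _ j"])
  qed
  have refl_U: "reflection \<alpha> (U y) $ i = u i y - 2 * \<alpha> $ i / (\<alpha> \<bullet> \<alpha>) * (\<Sum>j\<in>UNIV. \<alpha> $ j * u j y)" for \<alpha> y i
  proof -
    have "\<alpha> \<bullet> U y = (\<Sum>j\<in>UNIV. \<alpha> $ j * u j y)" "U y $ i = u i y"
      by (simp_all add: U_def inner_vec_def)
    then show ?thesis by (simp add: reflection_def)
  qed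
  have id: "U x + E x + (\<Sum>\<alpha>\<in>P. k \<alpha> *\<^sub>R (U x - reflection \<alpha> (U (reflection \<alpha> x)))) = 0" for x
  proof -
    have "(U x + E x + (\<Sum>\<alpha>\<in>P. k \<alpha> *\<^sub>R (U x - reflection \<alpha> (U (reflection \<alpha> x))))) $ i = 0" for i
    proof -
      have "(\<Sum>\<alpha>\<in>P. k \<alpha> * (u i x - u i (reflection \<alpha> x)))
       + (\<Sum>\<alpha>\<in>P. k \<alpha> * (2 * \<alpha> $ i / (\<alpha> \<bullet> \<alpha>) * (\<Sum>j\<in>UNIV. \<alpha> $ j * u j (reflection \<alpha> x))))
       = (\<Sum>\<alpha>\<in>P. k \<alpha> * (u i x - reflection \<alpha> (U (reflection \<alpha> x)) $ i))"
        unfolding sum.distrib[symmetric]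
        unfolding refl_U by (intro sum.cong refl) (simp add: algebra_simps)
      then show ?thesis using eq[of i x]
        by (simp add: U_def E_def algebra_simps)
    qed
    then show ?thesis by (simp add: vec_eq_iff)
  qed
  have cont: "continuous_on S f" for S
    using der by (meson continuous_at_imp_continuous_on has_derivative_continuous)
  have "\<exists>x0\<in>cball 0 (norm x). \<forall>y\<in>cball 0 (norm x). f y \<le> f x0"
    by (rule continuous_attains_sup) (use cont in auto)
  then obtain x0 where x0: "norm x0 \<le> norm x" and max: "\<And>y. norm y \<le> norm x \<Longrightarrow> f y \<le> f x0"
    by auto
  have "f (t *\<^sub>R x0) \<le> f x0" if "0 \<le> t" "t \<le> 1" for t
    using that x0 mult_left_le_one_le[of "norm x0" t] by (intro max) simp
  then have "0 \<le> 2 * (U x0 \<bullet> E x0)"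
    unfolding E_def by (rule radial_derivative_nonneg[OF der])
  moreover have "U x0 \<bullet> U x0 + U x0 \<bullet> E x0
      + (\<Sum>\<alpha>\<in>P. k \<alpha> * (U x0 \<bullet> U x0 - U x0 \<bullet> reflection \<alpha> (U (reflection \<alpha> x0)))) = 0"
    using arg_cong[OF id[of x0], of "\<lambda>v. U x0 \<bullet> v"]
    by (simp add: inner_add_right inner_sum_right inner_diff_right)
  moreover have "0 \<le> (\<Sum>\<alpha>\<in>P. k \<alpha> * (U x0 \<bullet> U x0 - U x0 \<bullet> reflection \<alpha> (U (reflection \<alpha> x0))))"
  proof (intro sum_nonneg mult_nonneg_nonneg k_nonneg_P)
    fix \<alpha> assume "\<alpha> \<in> P"
    have "norm (U (reflection \<alpha> x0)) \<le> norm (U x0)"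
      using max[of "reflection \<alpha> x0"] x0 by (simp add: f_def norm_le)
    then have "U x0 \<bullet> reflection \<alpha> (U (reflection \<alpha> x0)) \<le> norm (U x0) * norm (U x0)"
      by (intro order_trans[OF norm_cauchy_schwarz] mult_left_mono) auto
    then show "0 \<le> U x0 \<bullet> U x0 - U x0 \<bullet> reflection \<alpha> (U (reflection \<alpha> x0))"
      by (simp add: dot_square_norm power2_eq_square)
  qed
  ultimately have "f x0 \<le> 0" unfolding f_def by linarith
  then have "f x \<le> 0" using max[of x] by simp
  then have "U x = 0" unfolding f_def by (metis inner_eq_zero_iff inner_ge_zero order_antisym)
  then show ?thesis by (simp add: U_def vec_eq_iff)
qed


section \<open>The homogeneous components of the Dunkl kernel\<close>

text \<open>On polynomials homogeneous of degree \<open>n\<close>, the operator \<open>\<Sum>i. x\<^sub>i T\<^sub>i\<close> acts as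
  \<open>n + k_sum - (\<Sum>\<alpha>\<in>P. k \<alpha> \<sigma>\<^sub>\<alpha>)\<close>. Since \<open>k\<close> is nonnegative it is inverted for \<open>n \<ge> 1\<close>
  by a Neumann series in the group algebra, with nonnegative coefficients of total mass \<open>1 / n\<close>.\<close>

definition k_sum :: real where
  "k_sum = (\<Sum>\<alpha>\<in>P. k \<alpha>)"

text \<open>The coefficient of \<open>u\<close> in the \<open>j\<close>-th power of the group
  algebra element that gives each reflection in a positive root the coefficient
  \<open>k \<alpha>\<close>. Powers grow by multiplication on the right, whence
  \<open>u \<circ> reflection \<alpha>\<close>. Accordingly \<open>weight n\<close> lists the
  coefficients of the inverse of \<open>n + k_sum\<close> minus this element.\<close>

primrec neumann_coeff :: "nat \<Rightarrow> (real ^ 'm \<Rightarrow> real ^ 'm) \<Rightarrow> real" where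
  "neumann_coeff 0 u = (if u = id then 1 else 0)"
| "neumann_coeff (Suc j) u = (\<Sum>\<alpha>\<in>P. k \<alpha> * neumann_coeff j (u \<circ> reflection \<alpha>))"

definition weight :: "nat \<Rightarrow> (real ^ 'm \<Rightarrow> real ^ 'm) \<Rightarrow> real" where
  "weight n u = (\<Sum>j. neumann_coeff j u / (real n + k_sum) ^ Suc j)"

lemma k_sum_nonneg: "0 \<le> k_sum"
  unfolding k_sum_def by (intro sum_nonneg k_nonneg_P)

lemma neumann_coeff_nonneg: "0 \<le> neumann_coeff j u"
  by (induction j arbitrary: u) (auto intro!: sum_nonneg mult_nonneg_nonneg k_nonneg_P)

lemma sum_neumann_coeff: "(\<Sum>u\<in>W. neumann_coeff j u) = k_sum ^ j"
proof (induction j)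
  case 0
  have "(\<Sum>u\<in>W. neumann_coeff 0 u) = (\<Sum>u\<in>W. if u = id then 1 else 0)" by simp
  also have "\<dots> = (1::real)" using finite_W refl_group_id by (subst sum.delta) auto
  finally show ?case by simp
next
  case (Suc j)
  have "(\<Sum>u\<in>W. neumann_coeff (Suc j) u)
    = (\<Sum>\<alpha>\<in>P. k \<alpha> * (\<Sum>u\<in>W. neumann_coeff j (u \<circ> reflection \<alpha>)))"
    unfolding neumann_coeff.simps sum_distrib_left by (rule sum.swap)
  also have "\<dots> = (\<Sum>\<alpha>\<in>P. k \<alpha> * k_sum ^ j)"
    using P_subset by (intro sum.cong refl) (subst sum_W_comp_reflection, auto simp: Suc)
  finally show ?case by (simp add: k_sum_def sum_distrib_right)
qed

lemma summable_weight:
  assumes "n > 0" "u \<in> W"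
  shows "summable (\<lambda>j. neumann_coeff j u / (real n + k_sum) ^ Suc j)"
proof (rule summable_comparison_test')
  let ?q = "real n + k_sum"
  have q: "?q > 0" using assms k_sum_nonneg by simp
  \<comment> \<open>Positivity of \<open>n\<close> enters here: it puts the geometric ratio below
    1.\<close>
  have "norm (k_sum / ?q) < 1" using q assms k_sum_nonneg by simp
  then show "summable (\<lambda>j. (1 / ?q) * (k_sum / ?q) ^ j)"
    by (intro summable_mult summable_geometric)
  fix j
  have "neumann_coeff j u \<le> k_sum ^ j"
    unfolding sum_neumann_coeff[symmetric] using assms finite_W
    by (intro member_le_sum neumann_coeff_nonneg) auto
  then show "norm (neumann_coeff j u / ?q ^ Suc j) \<le> (1 / ?q) * (k_sum / ?q) ^ j"
    using q by (simp add: neumann_coeff_nonneg power_divide divide_right_mono)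
qed

lemma weight_nonneg: "n > 0 \<Longrightarrow> u \<in> W \<Longrightarrow> 0 \<le> weight n u"
  unfolding weight_def using k_sum_nonneg
  by (intro suminf_nonneg summable_weight) (auto intro!: divide_nonneg_nonneg neumann_coeff_nonneg simp del: neumann_coeff.simps)

lemma weight_eq:
  assumes n: "n > 0" and u: "u \<in> W"
  shows "(real n + k_sum) * weight n u = (if u = id then 1 else 0) + (\<Sum>\<alpha>\<in>P. k \<alpha> * weight n (u \<circ> reflection \<alpha>))"
proof -
  let ?q = "real n + k_sum"
  have q: "?q > 0" using n k_sum_nonneg by simp
  have u': "u \<circ> reflection \<alpha> \<in> W" if "\<alpha> \<in> P" for \<alpha>
    using W_comp_reflection[OF u] that P_subset by blast
  have "weight n u = neumann_coeff 0 u / ?q + (\<Sum>j. neumann_coeff (Suc j) u / ?q ^ Suc (Suc j))"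
    unfolding weight_def using suminf_split_head[OF summable_weight[OF n u]] by simp
  also have "(\<Sum>j. neumann_coeff (Suc j) u / ?q ^ Suc (Suc j))
     = (\<Sum>j. \<Sum>\<alpha>\<in>P. (k \<alpha> / ?q) * (neumann_coeff j (u \<circ> reflection \<alpha>) / ?q ^ Suc j))"
    by (simp add: sum_divide_distrib mult_ac)
  also have "\<dots> = (\<Sum>\<alpha>\<in>P. \<Sum>j. (k \<alpha> / ?q) * (neumann_coeff j (u \<circ> reflection \<alpha>) / ?q ^ Suc j))"
    by (intro suminf_sum summable_mult summable_weight n u')
  also have "\<dots> = (\<Sum>\<alpha>\<in>P. (k \<alpha> / ?q) * weight n (u \<circ> reflection \<alpha>))"
    unfolding weight_def by (intro sum.cong refl suminf_mult summable_weight n u')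
  finally show ?thesis
    using q by (simp add: distrib_left sum_distrib_left)
qed

text \<open>Summing \<open>weight_eq\<close> over the group gives a linear equation for the total
  mass in which the \<open>k_sum\<close> terms cancel. These factors \<open>1 / n\<close>,
  accumulated along the recursion, are the source of the factorials in the later bounds.\<close>

lemma sum_weight:
  assumes n: "n > 0"
  shows "(\<Sum>u\<in>W. weight n u) = 1 / real n"
proof -
  let ?S = "\<Sum>u\<in>W. weight n u"
  have "(real n + k_sum) * ?S = (\<Sum>u\<in>W. (if u = id then 1 else 0) + (\<Sum>\<alpha>\<in>P. k \<alpha> * weight n (u \<circ> reflection \<alpha>)))"
    unfolding sum_distrib_left by (intro sum.cong refl weight_eq n)
  also have "\<dots> = 1 + (\<Sum>u\<in>W. \<Sum>\<alpha>\<in>P. k \<alpha> * weight n (u \<circ> reflection \<alpha>))"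
    using finite_W refl_group_id by (simp add: sum.distrib)
  also have "(\<Sum>u\<in>W. \<Sum>\<alpha>\<in>P. k \<alpha> * weight n (u \<circ> reflection \<alpha>))
      = (\<Sum>\<alpha>\<in>P. k \<alpha> * (\<Sum>u\<in>W. weight n (u \<circ> reflection \<alpha>)))"
    unfolding sum_distrib_left by (rule sum.swap)
  also have "\<dots> = (\<Sum>\<alpha>\<in>P. k \<alpha> * ?S)"
    using P_subset by (intro sum.cong refl) (subst sum_W_comp_reflection, auto)
  also have "\<dots> = k_sum * ?S" by (simp add: k_sum_def sum_distrib_right)
  finally show ?thesis using n by (simp add: field_simps)
qed

lemma weighted_sum_bound:
  assumes "\<And>w. w \<in> W \<Longrightarrow> \<bar>A w\<bar> \<le> K"
  shows "\<bar>\<Sum>w\<in>W. weight (Suc n) w * A w\<bar> \<le> K / real (Suc n)"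
proof -
  have "\<bar>\<Sum>w\<in>W. weight (Suc n) w * A w\<bar> \<le> (\<Sum>w\<in>W. \<bar>weight (Suc n) w * A w\<bar>)"
    by (rule sum_abs)
  also have "\<dots> \<le> (\<Sum>w\<in>W. weight (Suc n) w * K)"
    by (intro sum_mono) (auto simp: abs_mult weight_nonneg intro!: mult_left_mono assms)
  finally show ?thesis by (simp add: sum_distrib_right[symmetric] sum_weight)
qed

primrec dunkl_hom :: "nat \<Rightarrow> real ^ 'm \<Rightarrow> real ^ 'm \<Rightarrow> real" where
  "dunkl_hom 0 y x = 1"
| "dunkl_hom (Suc n) y x = (\<Sum>w\<in>W. weight (Suc n) w * ((w x \<bullet> y) * dunkl_hom n y (w x)))"

lemma poly_fun_dunkl_hom: "poly_fun (dunkl_hom n y)"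
proof (induction n)
  case 0
  then show ?case by (simp add: poly_fun_intros(2) fun_eq_iff[symmetric])
next
  case (Suc n)
  have "poly_fun (\<lambda>x. \<Sum>w\<in>W. weight (Suc n) w * ((w x \<bullet> y) * dunkl_hom n y (w x)))"
  proof (intro real_polynomial_function_sum finite_W poly_fun_cmult
      poly_fun_intros(4))
    fix w assume w: "w \<in> W"
    show "poly_fun (\<lambda>x. w x \<bullet> y)"
      by (intro poly_fun_intros(1) bounded_linear_intros bounded_linear_compose[OF bounded_linear_inner_left]
          bounded_linear_W w)
    show "poly_fun (\<lambda>x. dunkl_hom n y (w x))"
      by (rule poly_fun_bounded_linear_compose[OF Suc bounded_linear_W[OF w]])
  qed
  moreover have "dunkl_hom (Suc n) y = (\<lambda>x. \<Sum>w\<in>W. weight (Suc n) w * ((w x \<bullet> y) * dunkl_hom n y (w x)))"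
    by (simp add: fun_eq_iff)
  ultimately show ?case by simp
qed

text \<open>Moving the reflection from the argument to the weights turns the left-hand side into an
  instance of \<open>weight_eq\<close>, of which only the term of the identity element
  survives.\<close>

lemma dunkl_hom_eq:
  "(real (Suc n) + k_sum) * dunkl_hom (Suc n) y x - (\<Sum>\<alpha>\<in>P. k \<alpha> * dunkl_hom (Suc n) y (reflection \<alpha> x))
    = (x \<bullet> y) * dunkl_hom n y x"
proof -
  let ?a = "weight (Suc n)"
  define h where "h x = (x \<bullet> y) * dunkl_hom n y x" for x
  have F: "dunkl_hom (Suc n) y x = (\<Sum>w\<in>W. ?a w * h (w x))" for x
    by (simp add: h_def)
  have "(\<Sum>\<alpha>\<in>P. k \<alpha> * dunkl_hom (Suc n) y (reflection \<alpha> x)) = (\<Sum>\<alpha>\<in>P. k \<alpha> * (\<Sum>w\<in>W. ?a (w \<circ> reflection \<alpha>) * h (w x)))"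
  proof (intro sum.cong refl arg_cong2[where f = "(*)"])
    fix \<alpha> assume "\<alpha> \<in> P"
    then have "(\<Sum>w\<in>W. ?a ((w \<circ> reflection \<alpha>) \<circ> reflection \<alpha>) * h ((w \<circ> reflection \<alpha>) x)) = (\<Sum>w\<in>W. ?a (w \<circ> reflection \<alpha>) * h (w x))"
      using P_subset by (intro sum_W_comp_reflection[where t = "\<lambda>w. ?a (w \<circ> reflection \<alpha>) * h (w x)"]) auto
    then show "dunkl_hom (Suc n) y (reflection \<alpha> x) = (\<Sum>w\<in>W. ?a (w \<circ> reflection \<alpha>) * h (w x))"
      unfolding F by (simp add: comp_def)
  qed
  also have "\<dots> = (\<Sum>w\<in>W. (\<Sum>\<alpha>\<in>P. k \<alpha> * ?a (w \<circ> reflection \<alpha>)) * h (w x))"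
    unfolding sum_distrib_left sum_distrib_right by (subst sum.swap) (simp add: mult_ac)
  also have "\<dots> = (\<Sum>w\<in>W. ((real (Suc n) + k_sum) * ?a w - (if w = id then 1 else 0)) * h (w x))"
    by (intro sum.cong refl) (simp only: weight_eq zero_less_Suc add_diff_cancel_left')
  also have "\<dots> = (real (Suc n) + k_sum) * dunkl_hom (Suc n) y x - (\<Sum>w\<in>W. if w = id then h x else 0)"
    unfolding F left_diff_distrib sum_subtractf sum_distrib_left
    by (intro arg_cong2[where f = "(-)"] sum.cong refl) (auto simp: mult_ac)
  also have "(\<Sum>w\<in>W. if w = id then h x else 0) = h x"
    using finite_W refl_group_id by (subst sum.delta) auto
  finally show ?thesis by (simp add: h_def)
qed

lemma dunkl_hom_scale_right: "dunkl_hom n y (t *\<^sub>R x) = t ^ n * dunkl_hom n y x"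
proof (induction n arbitrary: x)
  case (Suc n)
  have "(\<Sum>w\<in>W. weight (Suc n) w * ((w (t *\<^sub>R x) \<bullet> y) * dunkl_hom n y (w (t *\<^sub>R x))))
    = (\<Sum>w\<in>W. t ^ Suc n * (weight (Suc n) w * ((w x \<bullet> y) * dunkl_hom n y (w x))))"
    by (intro sum.cong refl) (simp add: linear_W linear_scale Suc mult_ac)
  then show ?case by (simp add: sum_distrib_left)
qed simp

lemma dunkl_hom_scale_left: "dunkl_hom n (t *\<^sub>R y) x = t ^ n * dunkl_hom n y x"
proof (induction n arbitrary: x)
  case (Suc n)
  have "(\<Sum>w\<in>W. weight (Suc n) w * ((w x \<bullet> t *\<^sub>R y) * dunkl_hom n (t *\<^sub>R y) (w x)))
    = (\<Sum>w\<in>W. t ^ Suc n * (weight (Suc n) w * ((w x \<bullet> y) * dunkl_hom n y (w x))))"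
    by (intro sum.cong refl) (simp add: Suc mult_ac)
  then show ?case by (simp add: sum_distrib_left)
qed simp

lemma dunkl_hom_euler: "(\<Sum>j\<in>UNIV. x $ j * partial j (dunkl_hom n y) x) = real n * dunkl_hom n y x"
proof -
  let ?f = "dunkl_hom n y"
  have d: "((\<lambda>t. ?f (t *\<^sub>R x)) has_derivative (\<lambda>s. \<Sum>j\<in>UNIV. (s *\<^sub>R x) $ j * partial j ?f (1 *\<^sub>R x))) (at 1)"
    by (rule has_derivative_compose[where f = "\<lambda>t. t *\<^sub>R x" and g = ?f])
      (auto intro!: derivative_eq_intros poly_fun_has_derivative poly_fun_dunkl_hom)
  have "((\<lambda>t. ?f (t *\<^sub>R x)) has_real_derivative (\<Sum>j\<in>UNIV. x $ j * partial j ?f x)) (at 1)"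
  proof -
    have "(\<lambda>s. \<Sum>j\<in>UNIV. (s *\<^sub>R x) $ j * partial j ?f (1 *\<^sub>R x)) = (*) (\<Sum>j\<in>UNIV. x $ j * partial j ?f x)"
      by (auto simp: sum_distrib_left sum_distrib_right mult_ac)
    with d show ?thesis by (simp only: has_field_derivative_def)
  qed
  moreover have "((\<lambda>t. t ^ n * ?f x) has_real_derivative real n * ?f x) (at 1)"
    by (auto intro!: derivative_eq_intros)
  ultimately show ?thesis
    unfolding dunkl_hom_scale_right by (rule DERIV_unique)
qed

lemma sum_coord_dunkl_op_hom:
  "(\<Sum>i\<in>UNIV. x $ i * T i (dunkl_hom (Suc n) y) x) = (x \<bullet> y) * dunkl_hom n y x"
  unfolding sum_coord_dunkl_op dunkl_hom_euler dunkl_hom_eq[symmetric]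
  by (simp add: right_diff_distrib sum_subtractf sum_distrib_right[symmetric] k_sum_def algebra_simps del: dunkl_hom.simps)

lemma dunkl_op_const: "T i (\<lambda>x. c) x = 0"
proof -
  have "C1_deriv (\<lambda>x :: real ^ 'm. c) (\<lambda>x v. 0)" by (simp add: C1_deriv_def)
  then show ?thesis
    by (simp add: dunkl_op_C1[OF _ zero_notin_P] cong: if_cong)
qed

lemma dunkl_op_diff_cmult_regular:
  fixes f g :: "real ^ 'm \<Rightarrow> real"
  assumes f: "poly_fun f" and g: "poly_fun g" and reg: "regular x"
  shows "T i (\<lambda>x. f x - c * g x) x = T i f x - c * T i g x"
proof -
  have cg: "poly_fun (\<lambda>x. c * g x)"
    by (intro poly_fun_cmult g)
  have "(\<Sum>\<alpha>\<in>P. k \<alpha> * \<alpha> $ i * dunkl_quotient \<alpha> (\<lambda>x. f x - c * g x) x)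
    = (\<Sum>\<alpha>\<in>P. k \<alpha> * \<alpha> $ i * dunkl_quotient \<alpha> f x - c * (k \<alpha> * \<alpha> $ i * dunkl_quotient \<alpha> g x))"
  proof (intro sum.cong refl)
    fix \<alpha> assume "\<alpha> \<in> P"
    then show "k \<alpha> * \<alpha> $ i * dunkl_quotient \<alpha> (\<lambda>x. f x - c * g x) x
      = k \<alpha> * \<alpha> $ i * dunkl_quotient \<alpha> f x - c * (k \<alpha> * \<alpha> $ i * dunkl_quotient \<alpha> g x)"
      using inner_root_regular[OF reg] by (simp add: dunkl_quotient_regular[OF reg] field_simps)
  qed
  then show ?thesis
    by (simp add: dunkl_op_def partial_diff[OF f cg] partial_cmult[OF g] sum_subtractf sum_distrib_left algebra_simps)
qed

text \<open>The defects \<open>u j\<close> satisfy \<open>T i (u j) = T j (u i)\<close> at regular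
  points, by commutativity and \<open>cross\<close>, and their contraction with \<open>x\<close> is
  zero by the recursion. Applying \<open>T i\<close> to that zero function and using the symmetry
  gives the system of the vector maximum principle. The hypothesis is stated as \<open>cross\<close>
  so that degree 0, which has no predecessor, is covered as well.\<close>

lemma dunkl_op_hom_step:
  assumes cross: "\<And>i j x. y $ j * T i (dunkl_hom n y) x = y $ i * T j (dunkl_hom n y) x"
  shows "T i (dunkl_hom (Suc n) y) x = y $ i * dunkl_hom n y x"
proof -
  let ?F = "dunkl_hom (Suc n) y" and ?G = "dunkl_hom n y"
  have F: "poly_fun ?F" and G: "poly_fun ?G"
    by (rule poly_fun_dunkl_hom)+
  define u where "u j = (\<lambda>x. T j ?F x - y $ j * ?G x)" for j
  have u: "poly_fun (u j)" for j
    unfolding u_def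
    by (intro real_polynomial_function_diff poly_fun_cmult
        poly_fun_dunkl_op F G)
  have zero: "(\<lambda>x. \<Sum>j\<in>UNIV. x $ j * u j x) = (\<lambda>x. 0)"
  proof
    fix x
    have "(\<Sum>j\<in>UNIV. x $ j * u j x) = (\<Sum>j\<in>UNIV. x $ j * T j ?F x) - (\<Sum>j\<in>UNIV. x $ j * y $ j) * ?G x"
      by (simp only: u_def right_diff_distrib sum_subtractf sum_distrib_right mult.assoc)
    also have "\<dots> = 0" unfolding sum_coord_dunkl_op_hom by (simp add: inner_vec_def)
    finally show "(\<Sum>j\<in>UNIV. x $ j * u j x) = 0" .
  qed
  have sym: "T i (u j) x = T j (u i) x" if "regular x" for i j x
    unfolding u_def dunkl_op_diff_cmult_regular[OF poly_fun_dunkl_op[OF F] G that]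
    by (simp only: dunkl_op_commute[OF F, of i j] cross[of j i])
  let ?lhs = "\<lambda>i x. u i x + (\<Sum>j\<in>UNIV. x $ j * partial j (u i) x) + (\<Sum>\<alpha>\<in>P. k \<alpha> * (u i x - u i (reflection \<alpha> x)))
      + (\<Sum>\<alpha>\<in>P. k \<alpha> * (2 * \<alpha> $ i / (\<alpha> \<bullet> \<alpha>) * (\<Sum>j\<in>UNIV. \<alpha> $ j * u j (reflection \<alpha> x))))"
  have reg: "?lhs i x = 0" if x: "regular x" for i x
  proof -
    have "0 = T i (\<lambda>x. \<Sum>j\<in>UNIV. x $ j * u j x) x"
      unfolding zero by (simp only: dunkl_op_const)
    also have "\<dots> = u i x + (\<Sum>j\<in>UNIV. x $ j * T j (u i) x)
      + (\<Sum>\<alpha>\<in>P. k \<alpha> * (2 * \<alpha> $ i / (\<alpha> \<bullet> \<alpha>) * (\<Sum>j\<in>UNIV. \<alpha> $ j * u j (reflection \<alpha> x))))"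
      by (simp only: dunkl_op_sum_coord[OF u x] sym[OF x, of i])
    finally show ?thesis unfolding sum_coord_dunkl_op by simp
  qed
  have cont: "continuous_on UNIV (u j)" "continuous_on UNIV (partial l (u j))" for l j
    by (intro poly_fun_continuous_on poly_fun_partial u)+
  have cont': "continuous_on UNIV (\<lambda>x. u j (reflection \<alpha> x))" for j \<alpha>
    by (rule continuous_on_compose2[OF cont(1)]) (auto intro: continuous_intros)
  \<comment> \<open>The symmetry of the defects was derived at regular points; every term is
    continuous, so the system holds everywhere.\<close>
  have "?lhs i x = 0" for i x
  proof (rule eq_if_eq_regular[where f = "?lhs i" and g = "\<lambda>x. 0"])
    show "continuous_on UNIV (?lhs i)" by (intro continuous_intros cont cont')
  qed (use reg in auto)
  from vector_maximum_principle[of u, OF u this] show ?thesis by (simp add: u_def)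
qed

lemma dunkl_op_hom_Suc: "T i (dunkl_hom (Suc n) y) x = y $ i * dunkl_hom n y x"
proof (induction n arbitrary: i x)
  case 0
  have "dunkl_hom 0 y = (\<lambda>x. 1)" by auto
  then show ?case by (intro dunkl_op_hom_step) (simp add: dunkl_op_const)
next
  case (Suc n)
  show ?case by (rule dunkl_op_hom_step) (simp only: Suc mult.left_commute)
qed

section \<open>Derivatives and growth of the homogeneous components\<close>

primrec dunkl_hom_deriv :: "nat \<Rightarrow> real ^ 'm \<Rightarrow> real ^ 'm \<Rightarrow> real ^ 'm \<Rightarrow> real" where
  "dunkl_hom_deriv 0 y x v = 0"
| "dunkl_hom_deriv (Suc n) y x v = (\<Sum>w\<in>W. weight (Suc n) w *
    ((w v \<bullet> y) * dunkl_hom n y (w x) + (w x \<bullet> y) * dunkl_hom_deriv n y (w x) (w v)))"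

primrec dunkl_hom_deriv2 :: "nat \<Rightarrow> real ^ 'm \<Rightarrow> real ^ 'm \<Rightarrow> real ^ 'm \<Rightarrow> real ^ 'm \<Rightarrow> real" where
  "dunkl_hom_deriv2 0 y x u v = 0"
| "dunkl_hom_deriv2 (Suc n) y x u v = (\<Sum>w\<in>W. weight (Suc n) w *
    ((w v \<bullet> y) * dunkl_hom_deriv n y (w x) (w u) + (w u \<bullet> y) * dunkl_hom_deriv n y (w x) (w v)
      + (w x \<bullet> y) * dunkl_hom_deriv2 n y (w x) (w u) (w v)))"

lemma has_derivative_dunkl_hom: "(dunkl_hom n y has_derivative dunkl_hom_deriv n y x) (at x)"
proof (induction n arbitrary: x)
  case 0
  have "dunkl_hom 0 y = (\<lambda>x. 1)" "dunkl_hom_deriv 0 y x = (\<lambda>v. 0)" by auto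
  then show ?case by simp
next
  case (Suc n)
  have "((\<lambda>x. \<Sum>w\<in>W. weight (Suc n) w * ((w x \<bullet> y) * dunkl_hom n y (w x))) has_derivative
    (\<lambda>v. \<Sum>w\<in>W. weight (Suc n) w *
      ((w x \<bullet> y) * dunkl_hom_deriv n y (w x) (w v) + (w v \<bullet> y) * dunkl_hom n y (w x)))) (at x)"
  proof (intro has_derivative_sum has_derivative_mult_right has_derivative_mult)
    fix w assume w: "w \<in> W"
    have dw: "(w has_derivative w) (at x)"
      by (rule bounded_linear_imp_has_derivative[OF bounded_linear_W[OF w]])
    show "((\<lambda>x. w x \<bullet> y) has_derivative (\<lambda>v. w v \<bullet> y)) (at x)"
      using dw by (rule has_derivative_inner_left)
    show "((\<lambda>x. dunkl_hom n y (w x)) has_derivative (\<lambda>v. dunkl_hom_deriv n y (w x) (w v))) (at x)"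
      by (rule has_derivative_compose[OF dw Suc])
  qed
  moreover have "dunkl_hom (Suc n) y = (\<lambda>x. \<Sum>w\<in>W. weight (Suc n) w * ((w x \<bullet> y) * dunkl_hom n y (w x)))"
    "dunkl_hom_deriv (Suc n) y x = (\<lambda>v. \<Sum>w\<in>W. weight (Suc n) w *
      ((w x \<bullet> y) * dunkl_hom_deriv n y (w x) (w v) + (w v \<bullet> y) * dunkl_hom n y (w x)))"
    by (simp_all add: fun_eq_iff add.commute)
  ultimately show ?case by (simp only:)
qed

lemma has_derivative_dunkl_hom_deriv:
  "((\<lambda>x. dunkl_hom_deriv n y x v) has_derivative (\<lambda>u. dunkl_hom_deriv2 n y x u v)) (at x)"
proof (induction n arbitrary: x v)
  case 0
  then show ?case by simp
next
  case (Suc n)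
  have "((\<lambda>x. \<Sum>w\<in>W. weight (Suc n) w *
      ((w v \<bullet> y) * dunkl_hom n y (w x) + (w x \<bullet> y) * dunkl_hom_deriv n y (w x) (w v))) has_derivative
    (\<lambda>u. \<Sum>w\<in>W. weight (Suc n) w *
      ((w v \<bullet> y) * dunkl_hom_deriv n y (w x) (w u) +
       ((w x \<bullet> y) * dunkl_hom_deriv2 n y (w x) (w u) (w v) + (w u \<bullet> y) * dunkl_hom_deriv n y (w x) (w v))))) (at x)"
  proof (intro has_derivative_sum has_derivative_mult_right has_derivative_add has_derivative_mult[where f = "\<lambda>x. _ x \<bullet> y"])
    fix w assume w: "w \<in> W"
    have dw: "(w has_derivative w) (at x)"
      by (rule bounded_linear_imp_has_derivative[OF bounded_linear_W[OF w]])
    show "((\<lambda>x. w x \<bullet> y) has_derivative (\<lambda>v. w v \<bullet> y)) (at x)"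
      using dw by (rule has_derivative_inner_left)
    show "((\<lambda>x. dunkl_hom n y (w x)) has_derivative (\<lambda>v. dunkl_hom_deriv n y (w x) (w v))) (at x)"
      by (rule has_derivative_compose[OF dw has_derivative_dunkl_hom])
    show "((\<lambda>x. dunkl_hom_deriv n y (w x) (w v)) has_derivative (\<lambda>u. dunkl_hom_deriv2 n y (w x) (w u) (w v))) (at x)"
      by (rule has_derivative_compose[OF dw Suc])
  qed
  then show ?case by (simp add: algebra_simps)
qed

lemma continuous_dunkl_hom_deriv2: "continuous_on UNIV (\<lambda>x. dunkl_hom_deriv2 n y x u v)"
proof (induction n arbitrary: u v)
  case (Suc n)
  have cw: "continuous_on UNIV w" if "w \<in> W" for w
    using that by (intro linear_continuous_on bounded_linear_W)
  have "continuous_on UNIV (\<lambda>x. dunkl_hom_deriv n y x v)" for v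
    using has_derivative_dunkl_hom_deriv by (meson continuous_at_imp_continuous_on has_derivative_continuous)
  then have d1: "continuous_on UNIV (\<lambda>x. dunkl_hom_deriv n y (w x) v)" if "w \<in> W" for w v
    using cw[OF that] by (rule continuous_on_compose2) simp
  have d2: "continuous_on UNIV (\<lambda>x. dunkl_hom_deriv2 n y (w x) u v)" if "w \<in> W" for w u v
    using Suc cw[OF that] by (rule continuous_on_compose2) simp
  show ?case
    unfolding dunkl_hom_deriv2.simps
    by (intro continuous_on_sum continuous_on_mult continuous_on_add continuous_on_const continuous_on_inner cw d1 d2)
qed simp

lemma continuous_dunkl_hom_left:
  "continuous_on UNIV (\<lambda>y. dunkl_hom n y x)"
  "continuous_on UNIV (\<lambda>y. dunkl_hom_deriv n y x v)"
  "continuous_on UNIV (\<lambda>y. dunkl_hom_deriv2 n y x u v)"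
proof -
  show 1: "continuous_on UNIV (\<lambda>y. dunkl_hom n y x)" for n x
    by (induction n arbitrary: x) (auto intro!: continuous_intros)
  show 2: "continuous_on UNIV (\<lambda>y. dunkl_hom_deriv n y x v)" for n x v
    by (induction n arbitrary: x v) (auto intro!: continuous_intros 1)
  show "continuous_on UNIV (\<lambda>y. dunkl_hom_deriv2 n y x u v)"
    by (induction n arbitrary: x u v) (auto intro!: continuous_intros 2)
qed

text \<open>With \<open>norm x + 1\<close> in place of \<open>norm x\<close>, a single quantity
  dominates both the linear factor of the recursion and, up to \<open>norm v\<close>, its
  derivative; all bounds then have the form of a power over a factorial.\<close>

lemma inner_W_bounds:
  assumes "w \<in> W"
  shows "\<bar>w x \<bullet> y\<bar> \<le> (norm x + 1) * norm y" "\<bar>w v \<bullet> y\<bar> \<le> norm v * ((norm x + 1) * norm y)"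
proof -
  have "\<bar>w v \<bullet> y\<bar> \<le> norm v * norm y" for v
    using Cauchy_Schwarz_ineq2[of "w v" y] by (simp add: norm_W[OF assms])
  moreover have "norm x * norm y \<le> (norm x + 1) * norm y" by (simp add: mult_right_mono)
  moreover have "norm v * norm y \<le> norm v * ((norm x + 1) * norm y)"
    by (intro mult_left_mono) (simp_all add: mult_le_cancel_right1 algebra_simps)
  ultimately show "\<bar>w x \<bullet> y\<bar> \<le> (norm x + 1) * norm y" "\<bar>w v \<bullet> y\<bar> \<le> norm v * ((norm x + 1) * norm y)"
    using order_trans by blast+
qed

lemma abs_mult_le: "\<bar>a\<bar> \<le> A \<Longrightarrow> \<bar>b\<bar> \<le> B \<Longrightarrow> \<bar>a * b\<bar> \<le> A * B" for a b A B :: real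
  by (simp add: abs_mult) (meson abs_ge_zero mult_mono order_trans)

lemma dunkl_hom_bound: "\<bar>dunkl_hom n y x\<bar> \<le> ((norm x + 1) * norm y) ^ n / fact n"
proof (induction n arbitrary: x)
  case (Suc n)
  let ?s = "(norm x + 1) * norm y"
  have "\<bar>dunkl_hom (Suc n) y x\<bar> \<le> (?s * (?s ^ n / fact n)) / real (Suc n)"
    unfolding dunkl_hom.simps
  proof (intro weighted_sum_bound abs_mult_le)
    fix w assume w: "w \<in> W"
    show "\<bar>w x \<bullet> y\<bar> \<le> ?s" by (rule inner_W_bounds[OF w])
    show "\<bar>dunkl_hom n y (w x)\<bar> \<le> ?s ^ n / fact n" using Suc[of "w x"] by (simp add: norm_W[OF w])
  qed
  then show ?case by (simp add: mult.commute)
qed simp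

lemma dunkl_hom_deriv_bound:
  "\<bar>dunkl_hom_deriv n y x v\<bar> \<le> norm v * (2 * ((norm x + 1) * norm y)) ^ n / fact n"
proof (induction n arbitrary: x v)
  case (Suc n)
  let ?s = "(norm x + 1) * norm y"
  have s: "0 \<le> ?s" by simp
  have "\<bar>dunkl_hom_deriv (Suc n) y x v\<bar>
      \<le> ((norm v * ?s) * (?s ^ n / fact n) + ?s * (norm v * (2 * ?s) ^ n / fact n)) / real (Suc n)"
    unfolding dunkl_hom_deriv.simps
  proof (intro weighted_sum_bound order_trans[OF abs_triangle_ineq] add_mono abs_mult_le)
    fix w assume w: "w \<in> W"
    show "\<bar>w x \<bullet> y\<bar> \<le> ?s" "\<bar>w v \<bullet> y\<bar> \<le> norm v * ?s" by (rule inner_W_bounds[OF w])+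
    show "\<bar>dunkl_hom n y (w x)\<bar> \<le> ?s ^ n / fact n" using dunkl_hom_bound[of n y "w x"] by (simp add: norm_W[OF w])
    show "\<bar>dunkl_hom_deriv n y (w x) (w v)\<bar> \<le> norm v * (2 * ?s) ^ n / fact n"
      using Suc[of "w x" "w v"] by (simp add: norm_W[OF w])
  qed
  also have "\<dots> = norm v * ?s ^ Suc n * (1 + 2 ^ n) / fact (Suc n)"
    by (simp only: power_mult_distrib power_Suc fact_Suc) (simp add: add_divide_distrib algebra_simps)
  \<comment> \<open>The product rule yields \<open>1 + 2 ^ n\<close>, which the base 2 absorbs. For
    second derivatives it yields \<open>2 * 2 ^ n + 4 ^ n\<close>, whence the base 4 there.\<close>
  also have "\<dots> \<le> norm v * ?s ^ Suc n * 2 ^ Suc n / fact (Suc n)"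
    using s by (intro divide_right_mono mult_left_mono mult_nonneg_nonneg) auto
  finally show ?case by (simp only: power_mult_distrib mult_ac)
qed simp

lemma dunkl_hom_deriv2_bound:
  "\<bar>dunkl_hom_deriv2 n y x u v\<bar> \<le> norm u * norm v * (4 * ((norm x + 1) * norm y)) ^ n / fact n"
proof (induction n arbitrary: x u v)
  case (Suc n)
  let ?s = "(norm x + 1) * norm y"
  have s: "0 \<le> ?s" by simp
  have "\<bar>dunkl_hom_deriv2 (Suc n) y x u v\<bar>
      \<le> (((norm v * ?s) * (norm u * (2 * ?s) ^ n / fact n) + (norm u * ?s) * (norm v * (2 * ?s) ^ n / fact n))
        + ?s * (norm u * norm v * (4 * ?s) ^ n / fact n)) / real (Suc n)"
    unfolding dunkl_hom_deriv2.simps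
  proof (intro weighted_sum_bound order_trans[OF abs_triangle_ineq] add_mono abs_mult_le)
    fix w assume w: "w \<in> W"
    show "\<bar>w x \<bullet> y\<bar> \<le> ?s" "\<bar>w v \<bullet> y\<bar> \<le> norm v * ?s" "\<bar>w u \<bullet> y\<bar> \<le> norm u * ?s" by (rule inner_W_bounds[OF w])+
    show "\<bar>dunkl_hom_deriv n y (w x) (w v)\<bar> \<le> norm v * (2 * ?s) ^ n / fact n"
      "\<bar>dunkl_hom_deriv n y (w x) (w u)\<bar> \<le> norm u * (2 * ?s) ^ n / fact n"
      using dunkl_hom_deriv_bound[of n y "w x"] by (simp_all add: norm_W[OF w])
        (metis norm_W[OF w])+
    show "\<bar>dunkl_hom_deriv2 n y (w x) (w u) (w v)\<bar> \<le> norm u * norm v * (4 * ?s) ^ n / fact n"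
      using Suc[of "w x" "w u" "w v"] by (simp add: norm_W[OF w])
  qed
  also have "\<dots> = norm u * norm v * ?s ^ Suc n * (2 * 2 ^ n + 4 ^ n) / fact (Suc n)"
    by (simp only: power_mult_distrib power_Suc fact_Suc) (simp add: add_divide_distrib algebra_simps)
  also have "\<dots> \<le> norm u * norm v * ?s ^ Suc n * 4 ^ Suc n / fact (Suc n)"
  proof -
    have "(2::real) ^ n \<le> 4 ^ n" "(0::real) \<le> 4 ^ n" by (auto intro: power_mono)
    then have "2 * 2 ^ n + 4 ^ n \<le> (4::real) ^ Suc n" unfolding power_Suc by linarith
    then show ?thesis
      using s by (intro divide_right_mono mult_left_mono mult_nonneg_nonneg) auto
  qed
  finally show ?case by (simp only: power_mult_distrib mult_ac)
qed simp

end

section \<open>Multivariate power series\<close>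

lemma has_sum_UNIV_if_zero_outside:
  fixes g :: "'a \<Rightarrow> real"
  assumes "(g has_sum T) A" "\<And>x. x \<notin> A \<Longrightarrow> g x = 0"
  shows "(g has_sum T) UNIV"
  using assms has_sum_cong_neutral[of UNIV A g g T] by auto

definition vmonom :: "('m \<Rightarrow> nat) \<Rightarrow> real ^ 'm \<Rightarrow> real" where
  "vmonom \<nu> z = (\<Prod>i\<in>UNIV. (z $ i) ^ \<nu> i)"

lemma abs_vmonom_le_one:
  assumes "\<And>i. \<bar>z $ i\<bar> \<le> 1"
  shows "\<bar>vmonom \<nu> z\<bar> \<le> 1"
  unfolding vmonom_def abs_prod power_abs
  by (intro prod_le_1) (auto intro!: power_le_one assms)

text \<open>An expansion on the closed unit cube about \<open>x0\<close> whose coefficients have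
  absolute sum at most \<open>A\<close>. The explicit \<open>A\<close> is what allows infinitely
  many expansions to be added; the inequality \<open>S \<le> A\<close> lets estimates be
  weakened.\<close>

definition ps_bound :: "real ^ 'm \<Rightarrow> real \<Rightarrow> (real ^ 'm \<Rightarrow> real) \<Rightarrow> bool" where
  "ps_bound x0 A f \<longleftrightarrow> (\<exists>a S. S \<le> A \<and> ((\<lambda>\<nu>. \<bar>a \<nu>\<bar>) has_sum S) UNIV \<and>
     (\<forall>x. (\<forall>i. \<bar>x $ i - x0 $ i\<bar> \<le> 1) \<longrightarrow> ((\<lambda>\<nu>. a \<nu> * vmonom \<nu> (x - x0)) has_sum f x) UNIV))"

lemma ps_bound_mono: "ps_bound x0 A f \<Longrightarrow> A \<le> B \<Longrightarrow> ps_bound x0 B f"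
  unfolding ps_bound_def by (meson order_trans)

lemma ps_bound_const: "ps_bound x0 \<bar>c\<bar> (\<lambda>x. c)"
proof -
  let ?a = "\<lambda>\<nu> :: 'a \<Rightarrow> nat. if \<nu> = (\<lambda>i. 0) then c else 0"
  have "(g has_sum g (\<lambda>i. 0)) UNIV" if "\<And>\<nu>. \<nu> \<noteq> (\<lambda>i. 0) \<Longrightarrow> g \<nu> = 0" for g :: "('a \<Rightarrow> nat) \<Rightarrow> real"
    using has_sum_finite[of "{\<lambda>i. 0}" g] that by (intro has_sum_UNIV_if_zero_outside[where A = "{\<lambda>i. 0}"]) auto
  from this[of "\<lambda>\<nu>. \<bar>?a \<nu>\<bar>"] this[of "\<lambda>\<nu>. ?a \<nu> * vmonom \<nu> z" for z]
  have "((\<lambda>\<nu>. \<bar>?a \<nu>\<bar>) has_sum \<bar>c\<bar>) UNIV" and "((\<lambda>\<nu>. ?a \<nu> * vmonom \<nu> z) has_sum c) UNIV" for z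
    by (simp_all add: vmonom_def)
  note sums = this
  show ?thesis
    unfolding ps_bound_def
    by (intro exI[of _ ?a] exI[of _ "\<bar>c\<bar>"] conjI allI impI order_refl sums)
qed

lemma ps_bound_cmult:
  assumes "ps_bound x0 A f"
  shows "ps_bound x0 (\<bar>c\<bar> * A) (\<lambda>x. c * f x)"
proof -
  obtain a S where "S \<le> A" "((\<lambda>\<nu>. \<bar>a \<nu>\<bar>) has_sum S) UNIV"
    "\<And>x. (\<forall>i. \<bar>x $ i - x0 $ i\<bar> \<le> 1) \<Longrightarrow> ((\<lambda>\<nu>. a \<nu> * vmonom \<nu> (x - x0)) has_sum f x) UNIV"
    using assms unfolding ps_bound_def by blast
  then show ?thesis
    unfolding ps_bound_def
    by (intro exI[of _ "\<lambda>\<nu>. c * a \<nu>"] exI[of _ "\<bar>c\<bar> * S"])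
      (auto simp: abs_mult mult.assoc intro!: mult_left_mono has_sum_cmult_right)
qed

text \<open>Multiplication by a centred coordinate only shifts exponents, so the sum of the absolute
  coefficients is unchanged.\<close>

lemma ps_bound_coord_mult:
  assumes "ps_bound x0 A f"
  shows "ps_bound x0 A (\<lambda>x. (x $ i - x0 $ i) * f x)"
proof -
  obtain a S where S: "S \<le> A" "((\<lambda>\<nu>. \<bar>a \<nu>\<bar>) has_sum S) UNIV"
    and sum: "\<And>x. (\<forall>i. \<bar>x $ i - x0 $ i\<bar> \<le> 1) \<Longrightarrow> ((\<lambda>\<nu>. a \<nu> * vmonom \<nu> (x - x0)) has_sum f x) UNIV"
    using assms unfolding ps_bound_def by blast
  let ?up = "\<lambda>\<nu> :: 'a \<Rightarrow> nat. \<nu>(i := Suc (\<nu> i))"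
  define b where "b \<nu> = (if \<nu> i = 0 then 0 else a (\<nu>(i := \<nu> i - 1)))" for \<nu>
  have b_up: "b (?up \<nu>) = a \<nu>" for \<nu> by (simp add: b_def)
  have inj: "inj ?up"
  proof (rule injI)
    fix \<mu> \<nu> assume eq: "?up \<mu> = ?up \<nu>"
    show "\<mu> = \<nu>"
    proof
      fix j show "\<mu> j = \<nu> j" using fun_cong[OF eq, of j] by (cases "j = i") auto
    qed
  qed
  have off: "b \<nu> = 0" if "\<nu> \<notin> range ?up" for \<nu>
  proof (rule ccontr)
    assume "b \<nu> \<noteq> 0"
    then have "\<nu> = ?up (\<nu>(i := \<nu> i - 1))" by (auto simp: b_def fun_eq_iff split: if_splits)
    then show False using that by blast
  qed
  have shift: "(g has_sum T) UNIV"
    if "((\<lambda>\<nu>. g (?up \<nu>)) has_sum T) UNIV" "\<And>\<nu>. b \<nu> = 0 \<Longrightarrow> g \<nu> = 0"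
    for g :: "('a \<Rightarrow> nat) \<Rightarrow> real" and T
  proof -
    have "(g has_sum T) (range ?up)"
      using that(1) by (subst has_sum_reindex[OF inj]) (simp add: o_def)
    then show ?thesis
      using off that(2) has_sum_UNIV_if_zero_outside[of g "range ?up" T] by blast
  qed
  have mon: "vmonom (?up \<nu>) z = z $ i * vmonom \<nu> z" for \<nu> z
  proof -
    have "vmonom (?up \<nu>) z = (\<Prod>j\<in>UNIV. (if j = i then z $ i else 1) * (z $ j) ^ \<nu> j)"
      unfolding vmonom_def by (intro prod.cong) auto
    then show ?thesis by (simp add: prod.distrib vmonom_def)
  qed
  have "((\<lambda>\<nu>. \<bar>b \<nu>\<bar>) has_sum S) UNIV"
    by (rule shift) (use S(2) in \<open>auto simp: b_up\<close>)
  moreover have "((\<lambda>\<nu>. b \<nu> * vmonom \<nu> (x - x0)) has_sum ((x $ i - x0 $ i) * f x)) UNIV"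
    if "\<forall>i. \<bar>x $ i - x0 $ i\<bar> \<le> 1" for x
  proof (rule shift)
    have "((\<lambda>\<nu>. (x $ i - x0 $ i) * (a \<nu> * vmonom \<nu> (x - x0))) has_sum ((x $ i - x0 $ i) * f x)) UNIV"
      by (rule has_sum_cmult_right[OF sum[OF that]])
    then show "((\<lambda>\<nu>. b (?up \<nu>) * vmonom (?up \<nu>) (x - x0)) has_sum ((x $ i - x0 $ i) * f x)) UNIV"
      by (simp only: b_up mon vector_minus_component mult.left_commute)
  qed auto
  ultimately show ?thesis
    unfolding ps_bound_def using S(1) by (intro exI[of _ b] exI[of _ S]) simp
qed

text \<open>The bounds make the double family of coefficients absolutely summable, so the order of
  summation may be exchanged. Monomials are at most 1 in absolute value on the unit cube, and the
  same majorant controls the function values.\<close>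

lemma ps_bound_has_sum:
  fixes f :: "'i \<Rightarrow> real ^ 'm \<Rightarrow> real"
  assumes f: "\<And>n. n \<in> I \<Longrightarrow> ps_bound x0 (A n) (f n)" and A: "(A has_sum T) I"
    and g: "\<And>x. ((\<lambda>n. f n x) has_sum g x) I"
  shows "ps_bound x0 T g"
proof -
  have "\<forall>n\<in>I. \<exists>a. \<exists>S \<le> A n. ((\<lambda>\<nu>. \<bar>a \<nu>\<bar>) has_sum S) UNIV \<and>
     (\<forall>x. (\<forall>i. \<bar>x $ i - x0 $ i\<bar> \<le> 1) \<longrightarrow> ((\<lambda>\<nu>. a \<nu> * vmonom \<nu> (x - x0)) has_sum f n x) UNIV)"
    using f unfolding ps_bound_def by blast
  then obtain a where a: "\<And>n. n \<in> I \<Longrightarrow> \<exists>S \<le> A n. ((\<lambda>\<nu>. \<bar>a n \<nu>\<bar>) has_sum S) UNIV"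
    and sum: "\<And>n x. n \<in> I \<Longrightarrow> \<forall>i. \<bar>x $ i - x0 $ i\<bar> \<le> 1 \<Longrightarrow> ((\<lambda>\<nu>. a n \<nu> * vmonom \<nu> (x - x0)) has_sum f n x) UNIV"
    unfolding bchoice_iff by blast
  let ?S = "\<lambda>n. infsum (\<lambda>\<nu>. \<bar>a n \<nu>\<bar>) UNIV"
  have S: "((\<lambda>\<nu>. \<bar>a n \<nu>\<bar>) has_sum ?S n) UNIV" "?S n \<le> A n" if "n \<in> I" for n
    using a[OF that] infsumI has_sum_infsum summable_on_def by blast+
  have S0: "0 \<le> ?S n" for n by (rule infsum_nonneg) simp
  have sumS: "?S summable_on I"
    using A S(2) S0 by (intro summable_on_comparison_test[of A I ?S]) (auto simp: summable_on_def)
  have abs: "(\<lambda>p. norm (case p of (n, \<nu>) \<Rightarrow> a n \<nu>)) summable_on I \<times> UNIV"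
    unfolding Infinite_Sum.abs_summable_on_Sigma_iff
  proof (intro conjI ballI)
    fix n assume "n \<in> I"
    then show "(\<lambda>\<nu>. norm ((\<lambda>(n, \<nu>). a n \<nu>) (n, \<nu>))) summable_on UNIV"
      using S(1) by (auto simp: summable_on_def)
  next
    show "(\<lambda>n. norm (\<Sum>\<^sub>\<infinity>\<nu>. norm ((\<lambda>(n, \<nu>). a n \<nu>) (n, \<nu>)))) summable_on I"
      using sumS S0 by simp
  qed
  define b where "b \<nu> = infsum (\<lambda>n. a n \<nu>) I" for \<nu>
  have swap: "(\<lambda>p. norm (case p of (\<nu>, n) \<Rightarrow> a n \<nu>)) summable_on UNIV \<times> I"
    using abs by (subst (asm) summable_on_swap) (simp add: case_prod_unfold)
  have row: "(\<lambda>n. norm (a n \<nu>)) summable_on I" for \<nu>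
    using swap unfolding Infinite_Sum.abs_summable_on_Sigma_iff by auto
  have b: "((\<lambda>n. a n \<nu>) has_sum b \<nu>) I" for \<nu>
    unfolding b_def using abs_summable_summable[OF row] by (rule has_sum_infsum)
  have "((\<lambda>(n, \<nu>). \<bar>a n \<nu>\<bar>) has_sum infsum ?S I) (I \<times> UNIV)"
  proof -
    obtain U where U: "((\<lambda>(n, \<nu>). \<bar>a n \<nu>\<bar>) has_sum U) (I \<times> UNIV)"
      using abs by (auto simp: summable_on_def case_prod_unfold)
    then have "(?S has_sum U) I" by (rule has_sum_SigmaD) (use S(1) in auto)
    then show ?thesis using U infsumI by blast
  qed
  then have "((\<lambda>(\<nu>, n). \<bar>a n \<nu>\<bar>) has_sum infsum ?S I) (UNIV \<times> I)"
    by (subst (asm) has_sum_swap) (simp add: case_prod_unfold)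
  then have cols: "((\<lambda>\<nu>. infsum (\<lambda>n. \<bar>a n \<nu>\<bar>) I) has_sum infsum ?S I) UNIV"
    by (rule has_sum_SigmaD) (use row in \<open>auto simp: has_sum_infsum\<close>)
  have b_le: "\<bar>b \<nu>\<bar> \<le> infsum (\<lambda>n. \<bar>a n \<nu>\<bar>) I" for \<nu>
    using norm_infsum_bound[OF row] by (simp add: b_def)
  have sum_b: "(\<lambda>\<nu>. \<bar>b \<nu>\<bar>) summable_on UNIV"
    by (rule summable_on_comparison_test[OF has_sum_imp_summable[OF cols] b_le]) simp
  have "infsum (\<lambda>\<nu>. \<bar>b \<nu>\<bar>) UNIV \<le> infsum ?S I"
    using has_sum_mono[OF has_sum_infsum[OF sum_b] cols] b_le by blast
  also have "\<dots> \<le> T"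
    using has_sum_mono[OF has_sum_infsum[OF sumS] A] S(2) by blast
  finally have bound: "infsum (\<lambda>\<nu>. \<bar>b \<nu>\<bar>) UNIV \<le> T" .
  have "((\<lambda>\<nu>. b \<nu> * vmonom \<nu> (x - x0)) has_sum g x) UNIV" if x: "\<forall>i. \<bar>x $ i - x0 $ i\<bar> \<le> 1" for x
  proof -
    let ?m = "\<lambda>\<nu>. vmonom \<nu> (x - x0)"
    have m: "\<bar>?m \<nu>\<bar> \<le> 1" for \<nu> using x by (intro abs_vmonom_le_one) simp
    have "(\<lambda>p. norm (case p of (n, \<nu>) \<Rightarrow> a n \<nu> * ?m \<nu>)) summable_on I \<times> UNIV"
    proof (rule Infinite_Sum.abs_summable_on_comparison_test[OF abs])
      fix p assume "p \<in> I \<times> (UNIV :: ('m \<Rightarrow> nat) set)"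
      show "norm (case p of (n, \<nu>) \<Rightarrow> a n \<nu> * ?m \<nu>) \<le> norm (case p of (n, \<nu>) \<Rightarrow> a n \<nu>)"
        using m by (auto simp: abs_mult mult_left_le split: prod.split)
    qed
    then have "(\<lambda>(n, \<nu>). a n \<nu> * ?m \<nu>) summable_on I \<times> UNIV"
      by (rule abs_summable_summable)
    then obtain U where U: "((\<lambda>(n, \<nu>). a n \<nu> * ?m \<nu>) has_sum U) (I \<times> UNIV)"
      unfolding summable_on_def by blast
    then have "((\<lambda>n. f n x) has_sum U) I"
      by (rule has_sum_SigmaD) (use sum x in auto)
    then have "U = g x" using g[of x] by (rule has_sum_unique)
    then have "((\<lambda>(\<nu>, n). a n \<nu> * ?m \<nu>) has_sum g x) (UNIV \<times> I)"
      using U by (subst (asm) has_sum_swap) (simp add: case_prod_unfold)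
    then show ?thesis
      by (rule has_sum_SigmaD) (use b in \<open>auto intro!: has_sum_cmult_left\<close>)
  qed
  then show ?thesis
    unfolding ps_bound_def using bound has_sum_infsum[OF sum_b]
    by (intro exI[of _ b] exI[of _ "infsum (\<lambda>\<nu>. \<bar>b \<nu>\<bar>) UNIV"]) simp
qed

lemma ps_bound_sum:
  assumes "finite I" "\<And>n. n \<in> I \<Longrightarrow> ps_bound x0 (A n) (f n)"
  shows "ps_bound x0 (\<Sum>n\<in>I. A n) (\<lambda>x. \<Sum>n\<in>I. f n x)"
  by (rule ps_bound_has_sum[where I = I and A = A and f = f]) (use assms in auto)

lemma ps_bound_add:
  assumes "ps_bound x0 A f" "ps_bound x0 B g"
  shows "ps_bound x0 (A + B) (\<lambda>x. f x + g x)"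
  using ps_bound_sum[of "UNIV :: bool set" x0 "\<lambda>b. if b then A else B" "\<lambda>b. if b then f else g"] assms
  by (simp add: UNIV_bool add.commute)

text \<open>The form is recentred as its value at \<open>x0\<close>, at most
  \<open>c * norm x0\<close>, plus centred coordinates whose coefficients are its values on the
  axes, at most \<open>c\<close> each.\<close>

lemma ps_bound_linear_mult:
  fixes L :: "real ^ 'm \<Rightarrow> real"
  assumes f: "ps_bound x0 A f" and "0 \<le> A" and L: "linear L" "\<And>v. \<bar>L v\<bar> \<le> c * norm v"
  shows "ps_bound x0 (((norm x0 + CARD('m)) * c) * A) (\<lambda>x. L x * f x)"
proof -
  have "L x * f x = L x0 * f x + (\<Sum>i\<in>UNIV. L (axis i 1) * ((x $ i - x0 $ i) * f x))" for x
  proof -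
    have "L x = L x0 + L (x - x0)" using L(1) by (simp add: linear_diff)
    also have "L (x - x0) = (\<Sum>i\<in>UNIV. (x $ i - x0 $ i) * L (axis i 1))"
      using linear_axis_expansion[OF L(1), of "x - x0"] by simp
    finally have eq: "L x = L x0 + (\<Sum>i\<in>UNIV. (x $ i - x0 $ i) * L (axis i 1))" .
    show ?thesis unfolding eq distrib_right sum_distrib_right by (simp add: mult_ac)
  qed
  moreover have "ps_bound x0 (\<bar>L x0\<bar> * A + (\<Sum>i\<in>UNIV. \<bar>L (axis i 1)\<bar> * A))
    (\<lambda>x. L x0 * f x + (\<Sum>i\<in>UNIV. L (axis i 1) * ((x $ i - x0 $ i) * f x)))"
    by (intro ps_bound_add ps_bound_sum ps_bound_cmult ps_bound_coord_mult f) auto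
  moreover have "\<bar>L x0\<bar> * A + (\<Sum>i\<in>(UNIV :: 'm set). \<bar>L (axis i 1)\<bar> * A) \<le> ((norm x0 + CARD('m)) * c) * A"
  proof -
    have "\<bar>L (axis i 1)\<bar> \<le> c" for i :: 'm using L(2)[of "axis i 1"] by simp
    then have "(\<Sum>i\<in>(UNIV :: 'm set). \<bar>L (axis i 1)\<bar> * A) \<le> (\<Sum>i\<in>(UNIV :: 'm set). c * A)"
      using \<open>0 \<le> A\<close> by (intro sum_mono mult_right_mono) auto
    moreover have "\<bar>L x0\<bar> * A \<le> (c * norm x0) * A"
      using L(2) \<open>0 \<le> A\<close> by (rule mult_right_mono)
    ultimately show ?thesis by (simp add: algebra_simps)
  qed
  ultimately show ?thesis by (simp add: ps_bound_mono)
qed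

lemma real_analytic_ps_bound:
  assumes "\<And>x0. \<exists>A. ps_bound x0 A f"
  shows "real_analytic f"
  unfolding real_analytic_def
proof
  fix x0
  obtain a where a: "\<And>x. \<forall>i. \<bar>x $ i - x0 $ i\<bar> \<le> 1 \<Longrightarrow> ((\<lambda>\<nu>. a \<nu> * vmonom \<nu> (x - x0)) has_sum f x) UNIV"
    using assms[of x0] unfolding ps_bound_def by blast
  have "((\<lambda>\<nu>. a \<nu> * (\<Prod>i\<in>UNIV. (x $ i - x0 $ i) ^ \<nu> i)) has_sum f x) UNIV" if "x \<in> ball x0 1" for x
  proof -
    have "\<bar>x $ i - x0 $ i\<bar> \<le> 1" for i
      using component_le_norm_cart[of "x - x0" i] that by (simp add: dist_norm norm_minus_commute)
    then show ?thesis using a[of x] by (simp add: vmonom_def)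
  qed
  then show "\<exists>r>0. \<exists>a. \<forall>x\<in>ball x0 r. ((\<lambda>\<nu>. a \<nu> * (\<Prod>i\<in>UNIV. (x $ i - x0 $ i) ^ \<nu> i)) has_sum f x) UNIV"
    by (intro exI[of _ 1] conjI exI[of _ a]) auto
qed

section \<open>Differentiability of real-analytic functions\<close>

lemma multi_index_cases:
  fixes \<nu> :: "'m::finite \<Rightarrow> nat"
  assumes "\<nu> \<notin> insert (\<lambda>i. 0) (range (\<lambda>j. (\<lambda>i. 0)(j := 1)))"
  shows "2 \<le> (\<Sum>i\<in>UNIV. \<nu> i)"
proof (rule ccontr)
  assume less: "\<not> 2 \<le> (\<Sum>i\<in>UNIV. \<nu> i)"
  have "\<nu> \<noteq> (\<lambda>i. 0)" using assms by blast
  then obtain j where j: "\<nu> j \<noteq> 0" by auto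
  have "(\<Sum>i\<in>UNIV. \<nu> i) = \<nu> j + (\<Sum>i\<in>UNIV - {j}. \<nu> i)" by (simp add: sum.remove)
  then have "\<nu> j = 1" "(\<Sum>i\<in>UNIV - {j}. \<nu> i) = 0" using less j by linarith+
  then have "\<nu> = (\<lambda>i. 0)(j := 1)" by (auto simp: fun_eq_iff)
  then show False using assms by blast
qed

lemma abs_vmonom_le:
  assumes "\<And>i. \<bar>z $ i\<bar> \<le> t"
  shows "\<bar>vmonom \<nu> z\<bar> \<le> t ^ (\<Sum>i\<in>UNIV. \<nu> i)"
  unfolding vmonom_def abs_prod power_abs power_sum
  by (intro prod_mono) (auto intro!: power_mono assms)

text \<open>Absolute summability at one corner of a small cube bounds all terms of degree at least 2
  by a constant times the squared distance to \<open>x0\<close>; the degree 1 terms are then the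
  derivative.\<close>

lemma real_analytic_has_derivative:
  fixes f :: "real ^ 'm \<Rightarrow> real"
  assumes "real_analytic f"
  shows "\<exists>f'. (f has_derivative f') (at x0)"
proof -
  obtain r a where r: "r > 0"
    and sum: "\<And>x. x \<in> ball x0 r \<Longrightarrow> ((\<lambda>\<nu>. a \<nu> * vmonom \<nu> (x - x0)) has_sum f x) UNIV"
    using spec[OF assms[unfolded real_analytic_def], of x0] by (fastforce simp: vmonom_def)
  \<comment> \<open>The point with all offsets from \<open>x0\<close> equal to \<open>s\<close> has
    l1 distance \<open>r / 2\<close> and so lies in the ball of convergence.\<close>
  define s where "s = r / (2 * CARD('m))"
  have card: "CARD('m) \<ge> 1" by (simp add: Suc_leI)
  have s: "s > 0" "CARD('m) * s < r" "s < r"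
  proof -
    show "s > 0" using r by (simp add: s_def)
    have "CARD('m) * s = r / 2" by (simp add: s_def)
    then show 1: "CARD('m) * s < r" using r by simp
    have "s \<le> CARD('m) * s" using card \<open>s > 0\<close> by (simp add: mult_le_cancel_right1)
    then show "s < r" using 1 by simp
  qed
  let ?z = "(\<chi> i. s) :: real ^ 'm"
  let ?F = "insert (\<lambda>i. 0) (range (\<lambda>j :: 'm. (\<lambda>i. 0)(j := 1))) :: ('m \<Rightarrow> nat) set"
  have "norm ?z < r" using norm_le_l1_cart[of ?z] s by simp
  then have "(\<lambda>\<nu>. a \<nu> * vmonom \<nu> ?z) summable_on UNIV"
    using sum[of "x0 + ?z"] by (auto simp: summable_on_def dist_norm)
  then have "(\<lambda>\<nu>. \<bar>a \<nu> * vmonom \<nu> ?z\<bar>) summable_on UNIV"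
    using summable_on_iff_abs_summable_on_real[of "\<lambda>\<nu>. a \<nu> * vmonom \<nu> ?z" UNIV] by simp
  moreover have "\<bar>a \<nu> * vmonom \<nu> ?z\<bar> = \<bar>a \<nu>\<bar> * s ^ (\<Sum>i\<in>UNIV. \<nu> i)" for \<nu>
    using s(1) by (simp add: abs_mult vmonom_def power_sum abs_prod power_abs)
  ultimately have M: "(\<lambda>\<nu>. \<bar>a \<nu>\<bar> * s ^ (\<Sum>i\<in>UNIV. \<nu> i)) summable_on (UNIV - ?F)"
    by (intro summable_on_subset_banach[OF _ Diff_subset]) simp
  define C where "C = infsum (\<lambda>\<nu>. \<bar>a \<nu>\<bar> * s ^ (\<Sum>i\<in>UNIV. \<nu> i)) (UNIV - ?F) / s\<^sup>2"
  let ?L = "\<lambda>z :: real ^ 'm. \<Sum>j\<in>UNIV. a ((\<lambda>i. 0)(j := 1)) * z $ j"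
  have main: "\<bar>f x - a (\<lambda>i. 0) - ?L (x - x0)\<bar> \<le> C * (norm (x - x0))\<^sup>2" if x: "norm (x - x0) < s" for x
  proof -
    let ?z = "x - x0"
    have comp: "\<bar>?z $ i\<bar> \<le> norm ?z" for i by (rule component_le_norm_cart)
    have "x \<in> ball x0 r" using x s(3) by (simp add: dist_norm norm_minus_commute)
    then have all: "((\<lambda>\<nu>. a \<nu> * vmonom \<nu> ?z) has_sum f x) UNIV" by (rule sum)
    have inj: "inj (\<lambda>j :: 'm. (\<lambda>i. 0 :: nat)(j := 1))"
      by (rule injI) (metis fun_upd_apply one_neq_zero)
    have notin: "(\<lambda>i. 0) \<notin> range (\<lambda>j :: 'm. (\<lambda>i. 0 :: nat)(j := 1))"
    proof (rule notI, elim rangeE)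
      fix j :: 'm assume "(\<lambda>i. 0 :: nat) = (\<lambda>i. 0)(j := 1)"
      from fun_cong[OF this, of j] show False by simp
    qed
    have mon1: "vmonom ((\<lambda>i. 0)(j := 1)) ?z = ?z $ j" for j
    proof -
      have "vmonom ((\<lambda>i. 0)(j := 1)) ?z = (\<Prod>i\<in>UNIV. if i = j then ?z $ j else 1)"
        unfolding vmonom_def by (intro prod.cong) auto
      then show ?thesis by simp
    qed
    have "(\<Sum>\<nu>\<in>?F. a \<nu> * vmonom \<nu> ?z) = a (\<lambda>i. 0) * vmonom (\<lambda>i. 0) ?z
        + (\<Sum>\<nu>\<in>range (\<lambda>j. (\<lambda>i. 0)(j := 1)). a \<nu> * vmonom \<nu> ?z)"
      using notin by (intro sum.insert) auto
    also have "(\<Sum>\<nu>\<in>range (\<lambda>j. (\<lambda>i. 0)(j := 1)). a \<nu> * vmonom \<nu> ?z) = ?L ?z"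
      by (simp only: sum.reindex[OF inj] o_def mon1)
    also have "vmonom (\<lambda>i. 0) ?z = 1" by (simp add: vmonom_def)
    finally have "(\<Sum>\<nu>\<in>?F. a \<nu> * vmonom \<nu> ?z) = a (\<lambda>i. 0) + ?L ?z" by (simp only: mult_1_right)
    then have "((\<lambda>\<nu>. a \<nu> * vmonom \<nu> ?z) has_sum (a (\<lambda>i. 0) + ?L ?z)) ?F"
      by (intro has_sum_finiteI) auto
    from has_sum_Diff[OF all this] have rest: "((\<lambda>\<nu>. a \<nu> * vmonom \<nu> ?z) has_sum (f x - a (\<lambda>i. 0) - ?L ?z)) (UNIV - ?F)"
      by (simp add: algebra_simps)
    have "((\<lambda>\<nu>. (norm ?z / s)\<^sup>2 * (\<bar>a \<nu>\<bar> * s ^ (\<Sum>i\<in>UNIV. \<nu> i))) has_sum (norm ?z / s)\<^sup>2 * (C * s\<^sup>2)) (UNIV - ?F)"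
      using has_sum_cmult_right[OF has_sum_infsum[OF M], of "(norm ?z / s)\<^sup>2"] s(1) by (simp add: C_def)
    with rest have "norm (f x - a (\<lambda>i. 0) - ?L ?z) \<le> (norm ?z / s)\<^sup>2 * (C * s\<^sup>2)"
    proof (rule norm_infsum_le)
      fix \<nu> assume "\<nu> \<in> UNIV - ?F"
      then obtain n where n: "(\<Sum>i\<in>UNIV. \<nu> i) = n + 2"
        using multi_index_cases[of \<nu>] le_Suc_ex[of 2] by (metis DiffD2 add.commute)
      have "\<bar>vmonom \<nu> ?z\<bar> \<le> norm ?z ^ (n + 2)"
        using abs_vmonom_le[of ?z "norm ?z" \<nu>] comp n by simp
      also have "\<dots> = norm ?z ^ n * (norm ?z)\<^sup>2" by (simp only: power_add)
      also have "\<dots> \<le> s ^ n * (norm ?z)\<^sup>2"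
        using x by (intro mult_right_mono power_mono) auto
      also have "\<dots> = (norm ?z / s)\<^sup>2 * s ^ (n + 2)"
        using s(1) by (simp add: power_add power_divide power2_eq_square)
      finally have "\<bar>a \<nu>\<bar> * \<bar>vmonom \<nu> ?z\<bar> \<le> \<bar>a \<nu>\<bar> * ((norm ?z / s)\<^sup>2 * s ^ (n + 2))"
        by (intro mult_left_mono) auto
      then show "norm (a \<nu> * vmonom \<nu> ?z) \<le> (norm ?z / s)\<^sup>2 * (\<bar>a \<nu>\<bar> * s ^ (\<Sum>i\<in>UNIV. \<nu> i))"
        by (simp add: abs_mult n mult_ac)
    qed
    then show ?thesis using s(1) by (simp add: power_divide mult_ac)
  qed
  have f0: "f x0 = a (\<lambda>i. 0)" using main[of x0] s(1) by simp
  have "(f has_derivative ?L) (at x0)"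
  proof (rule has_derivativeI_sandwich[where e = s and H = "\<lambda>x. C * norm (x - x0)"])
    show "bounded_linear ?L"
      by (intro bounded_linear_sum bounded_linear_const_mult bounded_linear_vec_nth)
    have "((\<lambda>x. C * norm (x - x0)) \<longlongrightarrow> C * norm (x0 - x0)) (at x0)" by (intro tendsto_intros)
    then show "((\<lambda>x. C * norm (x - x0)) \<longlongrightarrow> 0) (at x0)" by simp
    fix y assume y: "y \<noteq> x0" "dist y x0 < s"
    then have "norm (f y - f x0 - ?L (y - x0)) \<le> C * norm (y - x0) * norm (y - x0)"
      using main[of y] by (simp add: f0 dist_norm power2_eq_square mult.assoc)
    then show "norm (f y - f x0 - ?L (y - x0)) / norm (y - x0) \<le> C * norm (y - x0)"
      using y by (simp add: divide_le_eq)
  qed (rule s(1))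
  then show ?thesis by blast
qed

section \<open>Integrals of families of functions\<close>

text \<open>The common setting for termwise differentiation of the kernel series, with counting
  measure, and for differentiation of the Gaussian integrals, with Lebesgue measure. Majorants need
  to be uniform only on balls about the origin.\<close>

locale C1_family =
  fixes M :: "'b measure" and f :: "'b \<Rightarrow> real ^ 'm \<Rightarrow> real" and f' :: "'b \<Rightarrow> real ^ 'm \<Rightarrow> real ^ 'm \<Rightarrow> real"
  assumes C1: "\<And>z. z \<in> space M \<Longrightarrow> C1_deriv (f z) (f' z)"
    and integrable: "\<And>x. integrable M (\<lambda>z. f z x)"
    and measurable_deriv: "\<And>x v. (\<lambda>z. f' z x v) \<in> borel_measurable M"
    and dominated: "\<And>r. \<exists>h. integrable M h \<and>
      (\<forall>x\<in>ball 0 r. \<forall>z\<in>space M. \<forall>v. \<bar>f' z x v\<bar> \<le> h z * norm v)"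
begin

lemma integrable_deriv: "integrable M (\<lambda>z. f' z x v)"
proof -
  have x: "x \<in> ball 0 (norm x + 1)" by simp
  obtain h where h: "integrable M h"
    "\<And>z. z \<in> space M \<Longrightarrow> \<bar>f' z x v\<bar> \<le> h z * norm v"
    using dominated[of "norm x + 1"] x by blast
  show ?thesis
  proof (rule Bochner_Integration.integrable_bound)
    show "integrable M (\<lambda>z. h z * norm v)" using h(1) by simp
    show "AE z in M. norm (f' z x v) \<le> norm (h z * norm v)"
      using h(2) by (intro AE_I2) (metis abs_ge_self order_trans real_norm_def)
  qed (rule measurable_deriv)
qed

lemma C1_deriv_integral: "C1_deriv (\<lambda>x. \<integral>z. f z x \<partial>M) (\<lambda>x v. \<integral>z. f' z x v \<partial>M)"
proof -
  have "((\<lambda>x. \<integral>z. f z x \<partial>M) has_derivative (\<lambda>v. \<integral>z. f' z x0 v \<partial>M)) (at x0) \<and>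
    (\<forall>v. isCont (\<lambda>x. \<integral>z. f' z x v \<partial>M) x0)" for x0
  proof -
    obtain h where h: "integrable M h"
      "\<And>x z v. x \<in> ball 0 (norm x0 + 1) \<Longrightarrow> z \<in> space M \<Longrightarrow> \<bar>f' z x v\<bar> \<le> h z * norm v"
      using dominated[of "norm x0 + 1"] by blast
    have ball: "x \<in> ball 0 (norm x0 + 1)" if "x \<in> ball x0 1" for x
      using that norm_triangle_ineq2[of x x0] by (simp add: dist_norm norm_minus_commute)
    have "((\<lambda>x. \<integral>z. f z x \<partial>M) has_derivative (\<lambda>v. \<integral>z. f' z x0 v \<partial>M)) (at x0)"
    proof (rule has_derivative_integral[where e = 1 and h = h])
      fix x z v assume x: "x \<in> ball x0 1" and z: "z \<in> space M"
      show "((\<lambda>x. f z x) has_derivative f' z x) (at x)"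
        using C1[OF z] by (simp add: C1_deriv_def)
      show "\<bar>f' z x v\<bar> \<le> h z * norm v"
        by (rule h(2)[OF ball[OF x] z])
    qed (use h(1) integrable measurable_deriv in auto)
    moreover have "isCont (\<lambda>x. \<integral>z. f' z x v \<partial>M) x0" for v
    proof (rule continuous_at_integral[where e = 1 and h = "\<lambda>z. h z * norm v"])
      fix x z assume z: "z \<in> space M"
      show "isCont (\<lambda>x. f' z x v) x0"
        using C1[OF z] by (simp add: C1_deriv_def continuous_on_eq_continuous_at)
      show "\<bar>f' z x v\<bar> \<le> h z * norm v" if "x \<in> ball x0 1"
        by (rule h(2)[OF ball[OF that] z])
    qed (use h(1) measurable_deriv in auto)
    ultimately show ?thesis by blast
  qed
  then show ?thesis
    unfolding C1_deriv_def by (auto intro: continuous_at_imp_continuous_on)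
qed

lemma dunkl_op_integral:
  assumes "0 \<notin> P"
  shows "dunkl_op P k i (\<lambda>x. \<integral>z. f z x \<partial>M) x = (\<integral>z. dunkl_op P k i (f z) x \<partial>M)"
proof -
  let ?q = "\<lambda>\<alpha> z. if \<alpha> \<bullet> x \<noteq> 0 then (f z x - f z (reflection \<alpha> x)) / (\<alpha> \<bullet> x) else 2 * f' z x \<alpha> / (\<alpha> \<bullet> \<alpha>)"
  have q: "integrable M (?q \<alpha>)" for \<alpha>
    using integrable integrable_deriv by (cases "\<alpha> \<bullet> x = 0") auto
  have "(\<integral>z. dunkl_op P k i (f z) x \<partial>M) = (\<integral>z. f' z x (axis i 1) + (\<Sum>\<alpha>\<in>P. k \<alpha> * \<alpha> $ i * ?q \<alpha> z) \<partial>M)"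
    by (intro Bochner_Integration.integral_cong refl dunkl_op_C1[OF C1 assms])
  also have "\<dots> = (\<integral>z. f' z x (axis i 1) \<partial>M) + (\<Sum>\<alpha>\<in>P. k \<alpha> * \<alpha> $ i * (\<integral>z. ?q \<alpha> z \<partial>M))"
    using q integrable_deriv
    by (subst Bochner_Integration.integral_add) (auto intro!: Bochner_Integration.integrable_sum simp: Bochner_Integration.integral_sum)
  also have "\<dots> = dunkl_op P k i (\<lambda>x. \<integral>z. f z x \<partial>M) x"
    unfolding dunkl_op_C1[OF C1_deriv_integral assms]
    using integrable integrable_deriv
    by (intro arg_cong2[where f = "(+)"] refl sum.cong arg_cong2[where f = "(*)"]) auto
  finally show ?thesis by simp
qed

end

lemma summable_scaled_exp: "summable (\<lambda>n. c * r ^ n / fact n :: real)"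
  using summable_mult[OF summable_exp[of r], of c] by (simp add: divide_inverse mult_ac)

lemma suminf_exp_bound:
  fixes t :: "nat \<Rightarrow> real"
  assumes "\<And>n. \<bar>t n\<bar> \<le> c * r ^ n / fact n"
  shows "summable (\<lambda>n. \<bar>t n\<bar>)" "\<bar>suminf t\<bar> \<le> c * exp r"
proof -
  show abs: "summable (\<lambda>n. \<bar>t n\<bar>)"
    by (rule summable_comparison_test'[OF summable_scaled_exp[of c r]]) (use assms in auto)
  have "\<bar>suminf t\<bar> \<le> (\<Sum>n. \<bar>t n\<bar>)" using abs by (rule summable_rabs)
  also have "\<dots> \<le> (\<Sum>n. c * r ^ n / fact n)"
    by (intro suminf_le assms abs summable_scaled_exp)
  also have "\<dots> = c * exp r"
    using sums_mult[OF exp_converges[of r], of c] by (simp add: sums_iff divide_inverse mult_ac)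
  finally show "\<bar>suminf t\<bar> \<le> c * exp r" .
qed

section \<open>Existence and uniqueness of the Dunkl kernel\<close>

context dunkl_setup
begin

definition dunkl_series :: "real ^ 'm \<Rightarrow> real ^ 'm \<Rightarrow> real" where
  "dunkl_series y x = (\<Sum>n. dunkl_hom n y x)"

definition dunkl_series_deriv :: "real ^ 'm \<Rightarrow> real ^ 'm \<Rightarrow> real ^ 'm \<Rightarrow> real" where
  "dunkl_series_deriv y x v = (\<Sum>n. dunkl_hom_deriv n y x v)"

definition dunkl_series_deriv2 :: "real ^ 'm \<Rightarrow> real ^ 'm \<Rightarrow> real ^ 'm \<Rightarrow> real ^ 'm \<Rightarrow> real" where
  "dunkl_series_deriv2 y x u v = (\<Sum>n. dunkl_hom_deriv2 n y x u v)"

lemma dunkl_series_bound: "\<bar>dunkl_series y x\<bar> \<le> exp ((norm x + 1) * norm y)"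
  using suminf_exp_bound(2)[of "\<lambda>n. dunkl_hom n y x" 1] dunkl_hom_bound[of _ y x]
  by (simp add: dunkl_series_def)

lemma dunkl_series_deriv_bound: "\<bar>dunkl_series_deriv y x v\<bar> \<le> norm v * exp (2 * ((norm x + 1) * norm y))"
  unfolding dunkl_series_deriv_def by (rule suminf_exp_bound(2)) (rule dunkl_hom_deriv_bound)

lemma dunkl_series_deriv2_bound:
  "\<bar>dunkl_series_deriv2 y x u v\<bar> \<le> norm u * norm v * exp (4 * ((norm x + 1) * norm y))"
  unfolding dunkl_series_deriv2_def by (rule suminf_exp_bound(2)) (rule dunkl_hom_deriv2_bound)

lemma integrable_hom:
  "integrable (count_space UNIV) (\<lambda>n. dunkl_hom n y x)"
  "integrable (count_space UNIV) (\<lambda>n. dunkl_hom_deriv n y x v)"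
  "integrable (count_space UNIV) (\<lambda>n. dunkl_hom_deriv2 n y x u v)"
  unfolding integrable_count_space_nat_iff real_norm_def
  using suminf_exp_bound(1)[of "\<lambda>n. dunkl_hom n y x" 1 "(norm x + 1) * norm y"] dunkl_hom_bound[of _ y x]
    suminf_exp_bound(1)[OF dunkl_hom_deriv_bound[of _ y x v]]
    suminf_exp_bound(1)[OF dunkl_hom_deriv2_bound[of _ y x u v]]
  by simp_all

lemma dunkl_series_eq_integral:
  "dunkl_series y x = (\<integral>n. dunkl_hom n y x \<partial>count_space UNIV)"
  "dunkl_series_deriv y x v = (\<integral>n. dunkl_hom_deriv n y x v \<partial>count_space UNIV)"
  "dunkl_series_deriv2 y x u v = (\<integral>n. dunkl_hom_deriv2 n y x u v \<partial>count_space UNIV)"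
  by (simp_all add: dunkl_series_def dunkl_series_deriv_def dunkl_series_deriv2_def
      integral_count_space_nat integrable_hom)

lemma C1_dunkl_hom: "C1_deriv (dunkl_hom n y) (dunkl_hom_deriv n y)"
  unfolding C1_deriv_def using has_derivative_dunkl_hom has_derivative_dunkl_hom_deriv
  by (meson continuous_at_imp_continuous_on has_derivative_continuous)

lemma C1_dunkl_hom_deriv: "C1_deriv (\<lambda>x. dunkl_hom_deriv n y x v) (\<lambda>x u. dunkl_hom_deriv2 n y x u v)"
  unfolding C1_deriv_def using has_derivative_dunkl_hom_deriv continuous_dunkl_hom_deriv2 by blast

lemma C1_family_count_space:
  fixes f :: "nat \<Rightarrow> real ^ 'm \<Rightarrow> real"
  assumes C1: "\<And>n. C1_deriv (f n) (f' n)" and int: "\<And>x. integrable (count_space UNIV) (\<lambda>n. f n x)"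
    and bound: "\<And>n x v. \<bar>f' n x v\<bar> \<le> d * norm v * (c * ((norm x + 1) * b)) ^ n / fact n"
    and nonneg: "0 \<le> b" "0 \<le> c" "0 \<le> d"
  shows "C1_family (count_space (UNIV :: nat set)) f f'"
proof
  fix r
  \<comment> \<open>The absolute value covers negative radii, where the ball is empty but an
    integrable majorant is still demanded.\<close>
  let ?h = "\<lambda>n. d * (c * ((\<bar>r\<bar> + 1) * b)) ^ n / fact n"
  show "\<exists>h. integrable (count_space UNIV) h \<and>
    (\<forall>x\<in>ball 0 r. \<forall>n\<in>space (count_space UNIV). \<forall>v. \<bar>f' n x v\<bar> \<le> h n * norm v)"
  proof (intro exI[of _ ?h] conjI ballI allI)
    show "integrable (count_space UNIV) ?h"
      unfolding integrable_count_space_nat_iff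
      using summable_scaled_exp[of d "c * ((\<bar>r\<bar> + 1) * b)"] nonneg by simp
    fix x v :: "real ^ 'm" and n assume "x \<in> ball 0 r"
    then have "d * norm v * (c * ((norm x + 1) * b)) ^ n / fact n \<le> d * norm v * (c * ((\<bar>r\<bar> + 1) * b)) ^ n / fact n"
      using nonneg by (intro divide_right_mono mult_left_mono power_mono mult_right_mono) auto
    with bound[of n x v] show "\<bar>f' n x v\<bar> \<le> ?h n * norm v" by (simp add: mult_ac)
  qed
qed (use C1 int in auto)

lemma C1_family_hom: "C1_family (count_space UNIV) (\<lambda>n. dunkl_hom n y) (\<lambda>n. dunkl_hom_deriv n y)"
  by (rule C1_family_count_space[OF C1_dunkl_hom integrable_hom(1), where d = 1 and c = 2 and b = "norm y"])
    (use dunkl_hom_deriv_bound in auto)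

lemma C1_family_hom_deriv:
  "C1_family (count_space UNIV) (\<lambda>n x. dunkl_hom_deriv n y x v) (\<lambda>n x u. dunkl_hom_deriv2 n y x u v)"
  by (rule C1_family_count_space[OF C1_dunkl_hom_deriv integrable_hom(2), where d = "norm v" and c = 4 and b = "norm y"])
    (use dunkl_hom_deriv2_bound[of _ y _ _ v] in \<open>auto simp: mult.commute[of "norm v"]\<close>)

lemma C1_dunkl_series: "C1_deriv (dunkl_series y) (dunkl_series_deriv y)"
  using C1_family.C1_deriv_integral[OF C1_family_hom] by (simp add: dunkl_series_eq_integral[abs_def])

lemma C1_dunkl_series_deriv: "C1_deriv (\<lambda>x. dunkl_series_deriv y x v) (\<lambda>x u. dunkl_series_deriv2 y x u v)"
  using C1_family.C1_deriv_integral[OF C1_family_hom_deriv] by (simp add: dunkl_series_eq_integral)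

text \<open>Termwise, \<open>T i\<close> lowers the degree by one and produces the factor
  \<open>y $ i\<close>; the degree 0 term is annihilated, so the series is shifted by one
  place.\<close>

lemma dunkl_op_series: "T i (dunkl_series y) x = y $ i * dunkl_series y x"
proof -
  let ?t = "\<lambda>n. T i (dunkl_hom n y) x"
  have "dunkl_hom 0 y = (\<lambda>x. 1)" by auto
  then have t0: "?t 0 = 0" by (simp add: dunkl_op_const)
  have sum: "summable (\<lambda>n. y $ i * dunkl_hom n y x)"
    using integrable_hom(1)[of y x] by (auto simp: integrable_count_space_nat_iff intro: summable_norm_cancel summable_mult)
  have abs: "summable (\<lambda>n. norm (?t n))"
  proof (subst summable_Suc_iff[symmetric])
    have "summable (\<lambda>n. \<bar>y $ i\<bar> * norm (dunkl_hom n y x))"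
      using integrable_hom(1)[of y x] by (intro summable_mult) (simp add: integrable_count_space_nat_iff)
    then show "summable (\<lambda>n. norm (?t (Suc n)))"
      by (simp only: dunkl_op_hom_Suc real_norm_def abs_mult)
  qed
  have "T i (dunkl_series y) x = (\<integral>n. ?t n \<partial>count_space UNIV)"
    using C1_family.dunkl_op_integral[OF C1_family_hom zero_notin_P, of k i y x]
    by (simp add: dunkl_series_eq_integral[abs_def])
  also have "\<dots> = (\<Sum>n. ?t n)"
    using abs by (intro integral_count_space_nat) (simp add: integrable_count_space_nat_iff)
  also have "\<dots> = (\<Sum>n. ?t (Suc n))"
    using suminf_split_head[OF summable_norm_cancel[OF abs]] t0 by simp
  also have "\<dots> = (\<Sum>n. y $ i * dunkl_hom n y x)" by (simp only: dunkl_op_hom_Suc)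
  also have "\<dots> = y $ i * dunkl_series y x"
    unfolding dunkl_series_def
    using integrable_hom(1)[of y x] by (intro suminf_mult) (auto simp: integrable_count_space_nat_iff intro: summable_norm_cancel)
  finally show ?thesis .
qed

lemma dunkl_series_zero: "dunkl_series y 0 = 1"
proof -
  have "dunkl_hom n y 0 = (if n = 0 then 1 else 0)" for n
    using dunkl_hom_scale_right[of n y 0 0] by (cases n) auto
  then show ?thesis
    unfolding dunkl_series_def by (subst suminf_finite[of "{0}"]) auto
qed

lemma dunkl_series_scale: "dunkl_series y (t *\<^sub>R x) = dunkl_series (t *\<^sub>R y) x"
  by (simp add: dunkl_series_def dunkl_hom_scale_left dunkl_hom_scale_right)

lemma measurable_dunkl_series [measurable]:
  "(\<lambda>y. dunkl_series y x) \<in> borel_measurable borel"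
  "(\<lambda>y. dunkl_series_deriv y x v) \<in> borel_measurable borel"
  "(\<lambda>y. dunkl_series_deriv2 y x u v) \<in> borel_measurable borel"
  unfolding dunkl_series_def dunkl_series_deriv_def dunkl_series_deriv2_def
  by (intro borel_measurable_suminf borel_measurable_continuous_onI continuous_dunkl_hom_left)+

text \<open>The isometry \<open>u\<close> makes the induction work, as the recursion evaluates the
  lower component at \<open>w (u x)\<close>. The bounds are the terms of an exponential series,
  finite at every centre \<open>x0\<close>.\<close>

lemma ps_bound_dunkl_hom:
  fixes x0 :: "real ^ 'm" and u :: "real ^ 'm \<Rightarrow> real ^ 'm"
  assumes "linear u" "\<And>v. norm (u v) = norm v"
  shows "ps_bound x0 (((norm x0 + CARD('m)) * norm y) ^ n / fact n) (\<lambda>x. dunkl_hom n y (u x))"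
  using assms
proof (induction n arbitrary: u)
  case 0
  then show ?case using ps_bound_const[of x0 1] by simp
next
  case (Suc n)
  let ?B = "(norm x0 + CARD('m)) * norm y"
  have step: "ps_bound x0 (?B * (?B ^ n / fact n)) (\<lambda>x. (w (u x) \<bullet> y) * dunkl_hom n y (w (u x)))"
    if w: "w \<in> W" for w
  proof (rule ps_bound_linear_mult)
    have lin: "linear (\<lambda>x. w (u x))"
      using linear_compose[OF Suc.prems(1) linear_W[OF w]] by (simp add: o_def)
    then show "ps_bound x0 (?B ^ n / fact n) (\<lambda>x. dunkl_hom n y (w (u x)))"
      by (rule Suc.IH) (simp add: norm_W[OF w] Suc.prems(2))
    show "linear (\<lambda>x. w (u x) \<bullet> y)"
      using lin by (auto simp: linear_iff inner_add_left)
    show "\<bar>w (u v) \<bullet> y\<bar> \<le> norm y * norm v" for v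
      using Cauchy_Schwarz_ineq2[of "w (u v)" y] by (simp add: norm_W[OF w] Suc.prems(2) mult.commute)
  qed simp
  have "ps_bound x0 (\<Sum>w\<in>W. \<bar>weight (Suc n) w\<bar> * (?B * (?B ^ n / fact n)))
    (\<lambda>x. \<Sum>w\<in>W. weight (Suc n) w * ((w (u x) \<bullet> y) * dunkl_hom n y (w (u x))))"
    by (rule ps_bound_sum[OF finite_W ps_bound_cmult[OF step]])
  moreover have "(\<Sum>w\<in>W. \<bar>weight (Suc n) w\<bar> * (?B * (?B ^ n / fact n))) = ?B ^ Suc n / fact (Suc n)"
  proof -
    have "(\<Sum>w\<in>W. \<bar>weight (Suc n) w\<bar>) = 1 / real (Suc n)"
      unfolding sum_weight[OF zero_less_Suc, symmetric]
      by (intro sum.cong) (auto simp: weight_nonneg)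
    then show ?thesis by (simp only: sum_distrib_right[symmetric]) (simp add: mult.commute)
  qed
  ultimately show ?case by simp
qed

lemma real_analytic_dunkl_series: "real_analytic (dunkl_series y)"
proof (rule real_analytic_ps_bound)
  fix x0 :: "real ^ 'm"
  let ?B = "(norm x0 + CARD('m)) * norm y"
  have "ps_bound x0 (exp ?B) (dunkl_series y)"
  proof (rule ps_bound_has_sum[where I = UNIV and A = "\<lambda>n. ?B ^ n / fact n" and f = "\<lambda>n. dunkl_hom n y"])
    show "ps_bound x0 (?B ^ n / fact n) (dunkl_hom n y)" for n
      using ps_bound_dunkl_hom[of id x0 y n] by (simp add: linear_id)
    show "((\<lambda>n. ?B ^ n / fact n) has_sum exp ?B) UNIV"
      using exp_converges[of ?B] summable_scaled_exp[of 1 ?B]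
      by (intro norm_summable_imp_has_sum) (simp_all add: divide_inverse mult.commute)
    show "((\<lambda>n. dunkl_hom n y x) has_sum dunkl_series y x) UNIV" for x
      using integrable_hom(1)[of y x] unfolding integrable_count_space_nat_iff dunkl_series_def
      by (intro norm_summable_imp_has_sum summable_sums) (auto intro: summable_norm_cancel)
  qed
  then show "\<exists>A. ps_bound x0 A (dunkl_series y)" by blast
qed

text \<open>A positive value would force a positive maximum, over a ball, of \<open>f\<close> damped
  by \<open>exp (- (norm y + 1) * norm z)\<close>. The damping is reflection invariant, so the
  reflection terms there are nonnegative. Maximality demands radial growth of \<open>f\<close> at
  rate at least \<open>norm y + 1\<close>, whereas the equation allows at most
  \<open>norm y\<close>.\<close>

lemma scalar_maximum_principle:
  fixes f :: "real ^ 'm \<Rightarrow> real"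
  assumes der: "\<And>x. (f has_derivative f' x) (at x)"
    and eq: "\<And>x. f' x x + (\<Sum>\<alpha>\<in>P. k \<alpha> * (f x - f (reflection \<alpha> x))) = (x \<bullet> y) * f x"
    and "f 0 \<le> 0"
  shows "f x \<le> 0"
proof (rule ccontr)
  assume pos: "\<not> f x \<le> 0"
  let ?L = "norm y + 1"
  let ?\<phi> = "\<lambda>z. f z * exp (- ?L * norm z)"
  have "continuous_on S f" for S
    using der by (meson continuous_at_imp_continuous_on has_derivative_continuous)
  then have "\<exists>x0\<in>cball 0 (norm x). \<forall>z\<in>cball 0 (norm x). ?\<phi> z \<le> ?\<phi> x0"
    by (intro continuous_attains_sup) (auto intro!: continuous_intros)
  then obtain x0 where x0: "norm x0 \<le> norm x" and max: "\<And>z. norm z \<le> norm x \<Longrightarrow> ?\<phi> z \<le> ?\<phi> x0"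
    by auto
  have "0 < ?\<phi> x" using pos by simp
  then have "0 < ?\<phi> x0" using max[of x] by simp
  then have fx0: "0 < f x0" by (simp add: zero_less_mult_iff)
  \<comment> \<open>At the origin the two growth rates would not be strictly different; the initial
    condition excludes it.\<close>
  then have "x0 \<noteq> 0" using \<open>f 0 \<le> 0\<close> by auto
  then have nx0: "0 < norm x0" by simp
  let ?\<psi> = "\<lambda>t. f (t *\<^sub>R x0) * exp (- ?L * (t * norm x0))"
  have line: "((\<lambda>t. f (t *\<^sub>R x0)) has_derivative (\<lambda>s. f' (1 *\<^sub>R x0) (s *\<^sub>R x0))) (at 1)"
    by (rule has_derivative_compose[where f = "\<lambda>t. t *\<^sub>R x0" and g = f])
      (auto intro!: derivative_eq_intros der)
  let ?e = "exp (- ?L * norm x0)"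
  have "((\<lambda>t. exp (- ?L * (t * norm x0))) has_real_derivative ?e * (- ?L * norm x0)) (at 1)"
    by (auto intro!: derivative_eq_intros)
  then have "(?\<psi> has_derivative (\<lambda>s. f (1 *\<^sub>R x0) * (?e * (- ?L * norm x0) * s) + f' (1 *\<^sub>R x0) (s *\<^sub>R x0) * exp (- ?L * (1 * norm x0)))) (at 1)"
    by (intro has_derivative_mult line has_field_derivative_imp_has_derivative)
  then have "0 \<le> f (1 *\<^sub>R x0) * (?e * (- ?L * norm x0) * 1) + f' (1 *\<^sub>R x0) (1 *\<^sub>R x0) * exp (- ?L * (1 * norm x0))"
  proof (rule radial_derivative_nonneg)
    fix t :: real assume t: "0 \<le> t" "t \<le> 1"
    then have "norm (t *\<^sub>R x0) \<le> norm x" using x0 mult_left_le_one_le[of "norm x0" t] by simp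
    from max[OF this] show "?\<psi> (t *\<^sub>R 1) \<le> ?\<psi> 1" using t by simp
  qed
  then have "0 \<le> ?e * (f' x0 x0 - ?L * norm x0 * f x0)" by (simp add: algebra_simps)
  then have lower: "?L * norm x0 * f x0 \<le> f' x0 x0" by (simp add: zero_le_mult_iff)
  have "0 \<le> (\<Sum>\<alpha>\<in>P. k \<alpha> * (f x0 - f (reflection \<alpha> x0)))"
  proof (intro sum_nonneg mult_nonneg_nonneg k_nonneg_P)
    fix \<alpha>
    show "0 \<le> f x0 - f (reflection \<alpha> x0)" using max[of "reflection \<alpha> x0"] x0 by simp
  qed
  then have "f' x0 x0 \<le> (x0 \<bullet> y) * f x0" using eq[of x0] by linarith
  also have "\<dots> \<le> (norm x0 * norm y) * f x0"
    using fx0 norm_cauchy_schwarz[of x0 y] by (intro mult_right_mono) auto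
  also have "\<dots> < ?L * norm x0 * f x0"
    using fx0 nx0 by (simp add: algebra_simps)
  finally show False using lower by simp
qed

text \<open>Contracting the eigenvalue equations with \<open>x\<close> gives a linear radial
  equation, which \<open>f - g\<close> inherits with initial value 0. The roles of \<open>f\<close>
  and \<open>g\<close> can be exchanged, so two uses give equality.\<close>

lemma dunkl_eigenfunction_le:
  assumes "real_analytic f" "\<And>i z. T i f z = y $ i * f z" "f 0 = 1"
    and "real_analytic g" "\<And>i z. T i g z = y $ i * g z" "g 0 = 1"
  shows "f x \<le> g x"
proof -
  have radial: "\<exists>f'. \<forall>x. (f has_derivative f' x) (at x) \<and>
      f' x x + (\<Sum>\<alpha>\<in>P. k \<alpha> * (f x - f (reflection \<alpha> x))) = (x \<bullet> y) * f x"
    if f: "real_analytic f" "\<And>i z. T i f z = y $ i * f z" for f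
  proof -
    obtain f' where f': "\<And>x. (f has_derivative f' x) (at x)"
      using real_analytic_has_derivative[OF f(1)] by metis
    have "f' x x + (\<Sum>\<alpha>\<in>P. k \<alpha> * (f x - f (reflection \<alpha> x))) = (x \<bullet> y) * f x" for x
    proof -
      have "f' x x + (\<Sum>\<alpha>\<in>P. k \<alpha> * (f x - f (reflection \<alpha> x))) = (\<Sum>i\<in>UNIV. x $ i * T i f x)"
        unfolding sum_coord_dunkl_op directional_eq_sum_partial[OF f'] by simp
      also have "\<dots> = (x \<bullet> y) * f x"
        by (simp only: f(2) inner_vec_def inner_real_def sum_distrib_right mult.assoc)
      finally show ?thesis .
    qed
    then show ?thesis using f' by blast
  qed
  obtain f' where f': "\<And>x. (f has_derivative f' x) (at x)"
    "\<And>x. f' x x + (\<Sum>\<alpha>\<in>P. k \<alpha> * (f x - f (reflection \<alpha> x))) = (x \<bullet> y) * f x"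
    using radial[OF assms(1,2)] by blast
  obtain g' where g': "\<And>x. (g has_derivative g' x) (at x)"
    "\<And>x. g' x x + (\<Sum>\<alpha>\<in>P. k \<alpha> * (g x - g (reflection \<alpha> x))) = (x \<bullet> y) * g x"
    using radial[OF assms(4,5)] by blast
  have "f x - g x \<le> 0"
  proof (rule scalar_maximum_principle[where f = "\<lambda>x. f x - g x" and f' = "\<lambda>x v. f' x v - g' x v" and y = y])
    fix x
    show "((\<lambda>x. f x - g x) has_derivative (\<lambda>v. f' x v - g' x v)) (at x)"
      by (intro has_derivative_diff f'(1) g'(1))
    show "f' x x - g' x x + (\<Sum>\<alpha>\<in>P. k \<alpha> * (f x - g x - (f (reflection \<alpha> x) - g (reflection \<alpha> x)))) = (x \<bullet> y) * (f x - g x)"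
      using f'(2)[of x] g'(2)[of x] by (simp add: right_diff_distrib sum_subtractf)
  qed (use assms in auto)
  then show ?thesis by simp
qed

lemma dunkl_kernel_eq_series: "dunkl_kernel P k x y = dunkl_series y x"
proof -
  have "(THE f. real_analytic f \<and> (\<forall>i z. T i f z = y $ i * f z) \<and> f 0 = 1) = dunkl_series y"
  proof (rule the_equality)
    show "real_analytic (dunkl_series y) \<and> (\<forall>i z. T i (dunkl_series y) z = y $ i * dunkl_series y z) \<and> dunkl_series y 0 = 1"
      using real_analytic_dunkl_series dunkl_op_series dunkl_series_zero by blast
    fix f assume f: "real_analytic f \<and> (\<forall>i z. T i f z = y $ i * f z) \<and> f 0 = 1"
    then have f: "real_analytic f" "\<And>i z. T i f z = y $ i * f z" "f 0 = 1" by auto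
    note D = real_analytic_dunkl_series dunkl_op_series dunkl_series_zero
    show "f = dunkl_series y"
      by (intro ext order_antisym dunkl_eigenfunction_le[OF f D] dunkl_eigenfunction_le[OF D f])
  qed
  then show ?thesis by (simp add: dunkl_kernel_def)
qed

end

section \<open>Functions of at most exponential growth\<close>

text \<open>Closed under products and finite sums, and consisting of functions integrable against
  every Gaussian, this class settles each integrability question from the shape of the
  integrand.\<close>

definition exp_bounded :: "('a::euclidean_space \<Rightarrow> real) \<Rightarrow> bool" where
  "exp_bounded f \<longleftrightarrow> f \<in> borel_measurable borel \<and> (\<exists>c d. \<forall>z. \<bar>f z\<bar> \<le> c * exp (d * norm z))"

lemma exp_boundedI:
  "f \<in> borel_measurable borel \<Longrightarrow> (\<And>z. \<bar>f z\<bar> \<le> c * exp (d * norm z)) \<Longrightarrow> exp_bounded f"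
  unfolding exp_bounded_def by blast

lemma exp_bounded_measurable: "exp_bounded f \<Longrightarrow> f \<in> borel_measurable borel"
  by (simp add: exp_bounded_def)

lemma exp_bounded_const: "exp_bounded (\<lambda>z. c)"
  by (rule exp_boundedI[where c = "\<bar>c\<bar>" and d = 0]) auto

lemma exp_bounded_norm: "exp_bounded norm"
proof (rule exp_boundedI[where c = 1 and d = 1])
  show "\<bar>norm z\<bar> \<le> 1 * exp (1 * norm z)" for z :: 'a
    using exp_ge_add_one_self[of "norm z"] by (simp del: exp_ge_add_one_self)
qed simp

lemma exp_bounded_exp: "exp_bounded (\<lambda>z. exp (c * norm z))"
  by (rule exp_boundedI[where c = 1 and d = c]) auto

lemma exp_bounded_abs: "exp_bounded f \<Longrightarrow> exp_bounded (\<lambda>z. \<bar>f z\<bar>)"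
  unfolding exp_bounded_def by auto

lemma exp_bounded_inner: "exp_bounded (\<lambda>z. v \<bullet> z)"
proof (rule exp_boundedI[where c = "norm v" and d = 1])
  show "\<bar>v \<bullet> z\<bar> \<le> norm v * exp (1 * norm z)" for z
  proof -
    have "\<bar>v \<bullet> z\<bar> \<le> norm v * norm z" by (rule Cauchy_Schwarz_ineq2)
    also have "\<dots> \<le> norm v * exp (1 * norm z)"
      using exp_ge_add_one_self[of "norm z"] by (intro mult_left_mono) (simp_all del: exp_ge_add_one_self)
    finally show ?thesis .
  qed
qed simp

lemma exp_bounded_mult:
  fixes f g :: "'a::euclidean_space \<Rightarrow> real"
  assumes "exp_bounded f" "exp_bounded g"
  shows "exp_bounded (\<lambda>z. f z * g z)"
proof -
  obtain c d c' d' where b: "\<And>z. \<bar>f z\<bar> \<le> c * exp (d * norm z)" "\<And>z. \<bar>g z\<bar> \<le> c' * exp (d' * norm z)"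
    using assms unfolding exp_bounded_def by blast
  show ?thesis
  proof (rule exp_boundedI[where c = "c * c'" and d = "d + d'"])
    show "(\<lambda>z. f z * g z) \<in> borel_measurable borel"
      using assms[THEN exp_bounded_measurable] by simp
    fix z
    have "\<bar>f z * g z\<bar> \<le> (c * exp (d * norm z)) * (c' * exp (d' * norm z))"
      unfolding abs_mult using b by (intro mult_mono) (auto intro: order_trans[OF abs_ge_zero])
    also have "\<dots> = c * c' * exp ((d + d') * norm z)"
      by (simp add: distrib_right exp_add)
    finally show "\<bar>f z * g z\<bar> \<le> c * c' * exp ((d + d') * norm z)" .
  qed
qed

lemma exp_bounded_add:
  fixes f g :: "'a::euclidean_space \<Rightarrow> real"
  assumes "exp_bounded f" "exp_bounded g"
  shows "exp_bounded (\<lambda>z. f z + g z)"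
proof -
  obtain c d c' d' where b: "\<And>z. \<bar>f z\<bar> \<le> c * exp (d * norm z)" "\<And>z. \<bar>g z\<bar> \<le> c' * exp (d' * norm z)"
    using assms unfolding exp_bounded_def by blast
  have c: "0 \<le> c" "0 \<le> c'" using order_trans[OF abs_ge_zero b(1)[of 0]] order_trans[OF abs_ge_zero b(2)[of 0]] by auto
  show ?thesis
  proof (rule exp_boundedI[where c = "c + c'" and d = "max d d'"])
    show "(\<lambda>z. f z + g z) \<in> borel_measurable borel"
      using assms[THEN exp_bounded_measurable] by simp
    fix z :: 'a
    have "c * exp (d * norm z) \<le> c * exp (max d d' * norm z)" "c' * exp (d' * norm z) \<le> c' * exp (max d d' * norm z)"
      using c by (auto intro!: mult_left_mono mult_right_mono)
    then show "\<bar>f z + g z\<bar> \<le> (c + c') * exp (max d d' * norm z)"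
      using b(1)[of z] b(2)[of z] unfolding distrib_right by linarith
  qed
qed

lemma exp_bounded_sum: "finite I \<Longrightarrow> (\<And>i. i \<in> I \<Longrightarrow> exp_bounded (f i)) \<Longrightarrow> exp_bounded (\<lambda>z. \<Sum>i\<in>I. f i z)"
  by (induction I rule: finite_induct) (auto intro: exp_bounded_const exp_bounded_add)

lemma exp_bounded_prod: "finite I \<Longrightarrow> (\<And>i. i \<in> I \<Longrightarrow> exp_bounded (f i)) \<Longrightarrow> exp_bounded (\<lambda>z. \<Prod>i\<in>I. f i z)"
  by (induction I rule: finite_induct) (auto intro: exp_bounded_const exp_bounded_mult)

lemma exp_bounded_indicator: "A \<in> sets borel \<Longrightarrow> exp_bounded (indicator A)"
  by (rule exp_boundedI[where c = 1 and d = 0]) (auto simp: indicator_def)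

lemma integrable_gauss_exp_bounded:
  assumes "exp_bounded f" "b > 0"
  shows "integrable lborel (\<lambda>z. exp (- b * (norm z)\<^sup>2) * f z)"
proof -
  obtain c d where b: "\<And>z. \<bar>f z\<bar> \<le> c * exp (d * norm z)"
    using assms unfolding exp_bounded_def by blast
  show ?thesis
  proof (rule Bochner_Integration.integrable_bound)
    show "integrable lborel (\<lambda>z. c * exp (- b * (norm z)\<^sup>2 + d * norm z))"
      by (rule integrable_gaussian_exp[OF assms(2)])
    show "(\<lambda>z. exp (- b * (norm z)\<^sup>2) * f z) \<in> borel_measurable lborel"
      using exp_bounded_measurable[OF assms(1)] by simp
    show "AE z in lborel. norm (exp (- b * (norm z)\<^sup>2) * f z) \<le> norm (c * exp (- b * (norm z)\<^sup>2 + d * norm z))"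
    proof (rule AE_I2)
      fix z
      have "norm (exp (- b * (norm z)\<^sup>2) * f z) \<le> exp (- b * (norm z)\<^sup>2) * (c * exp (d * norm z))"
        using b[of z] by (simp add: abs_mult)
      also have "\<dots> = c * exp (- b * (norm z)\<^sup>2 + d * norm z)"
        by (simp only: exp_add mult.left_commute)
      also have "\<dots> \<le> norm (c * exp (- b * (norm z)\<^sup>2 + d * norm z))"
        by (simp only: real_norm_def abs_ge_self)
      finally show "norm (exp (- b * (norm z)\<^sup>2) * f z) \<le> norm (c * exp (- b * (norm z)\<^sup>2 + d * norm z))" .
    qed
  qed
qed

lemma integral_lborel_scale:
  fixes F :: "'a::euclidean_space \<Rightarrow> real"
  assumes "t > 0" and F: "F \<in> borel_measurable borel"
  shows "(\<integral>y. F y \<partial>lborel) = t ^ DIM('a) * (\<integral>y. F (t *\<^sub>R y) \<partial>lborel)"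
proof -
  have "(\<integral>y. F y \<partial>lborel) = (\<integral>y. F y \<partial>density (distr lborel borel (\<lambda>x. 0 + t *\<^sub>R x)) (\<lambda>_. \<bar>t\<bar> ^ DIM('a)))"
    using lborel_affine[of t "0 :: 'a"] assms(1) by simp
  also have "\<dots> = (\<integral>y. t ^ DIM('a) * F y \<partial>distr lborel borel (\<lambda>x. 0 + t *\<^sub>R x))"
    using F assms(1) by (subst integral_density) (auto simp: ennreal_power)
  also have "\<dots> = (\<integral>y. t ^ DIM('a) * F (t *\<^sub>R y) \<partial>lborel)"
    using F by (subst integral_distr) auto
  finally show ?thesis by simp
qed

lemma C1_deriv_sum:
  assumes "finite I" "\<And>w. w \<in> I \<Longrightarrow> C1_deriv (f w) (f' w)"
  shows "C1_deriv (\<lambda>x. \<Sum>w\<in>I. c w * f w x) (\<lambda>x v. \<Sum>w\<in>I. c w * f' w x v)"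
  using assms unfolding C1_deriv_def
  by (auto intro!: has_derivative_sum has_derivative_mult_right continuous_intros)

lemma dunkl_op_sum:
  assumes "finite I" "\<And>w. w \<in> I \<Longrightarrow> C1_deriv (f w) (f' w)" and P: "0 \<notin> P"
  shows "dunkl_op P k i (\<lambda>x. \<Sum>w\<in>I. c w * f w x) x = (\<Sum>w\<in>I. c w * dunkl_op P k i (f w) x)"
proof -
  let ?q = "\<lambda>\<alpha> w. if \<alpha> \<bullet> x \<noteq> 0 then (f w x - f w (reflection \<alpha> x)) / (\<alpha> \<bullet> x) else 2 * f' w x \<alpha> / (\<alpha> \<bullet> \<alpha>)"
  have C: "C1_deriv (\<lambda>x. \<Sum>w\<in>I. c w * f w x) (\<lambda>x v. \<Sum>w\<in>I. c w * f' w x v)"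
    by (rule C1_deriv_sum[OF assms(1,2)])
  have "(\<Sum>w\<in>I. c w * dunkl_op P k i (f w) x)
    = (\<Sum>w\<in>I. c w * (f' w x (axis i 1) + (\<Sum>\<alpha>\<in>P. k \<alpha> * \<alpha> $ i * ?q \<alpha> w)))"
    by (intro sum.cong refl arg_cong2[where f = "(*)"] dunkl_op_C1 assms(2) P)
  also have "\<dots> = (\<Sum>w\<in>I. c w * f' w x (axis i 1)) + (\<Sum>\<alpha>\<in>P. k \<alpha> * \<alpha> $ i * (\<Sum>w\<in>I. c w * ?q \<alpha> w))"
    unfolding distrib_left sum.distrib sum_distrib_left
    by (subst (2) sum.swap) (simp only: mult_ac)
  also have "\<dots> = dunkl_op P k i (\<lambda>x. \<Sum>w\<in>I. c w * f w x) x"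
    unfolding dunkl_op_C1[OF C P]
  proof (intro arg_cong2[where f = "(+)"] refl sum.cong arg_cong2[where f = "(*)"])
    fix \<alpha>
    show "(\<Sum>w\<in>I. c w * ?q \<alpha> w) = (if \<alpha> \<bullet> x \<noteq> 0 then ((\<Sum>w\<in>I. c w * f w x) - (\<Sum>w\<in>I. c w * f w (reflection \<alpha> x))) / (\<alpha> \<bullet> x)
       else 2 * (\<Sum>w\<in>I. c w * f' w x \<alpha>) / (\<alpha> \<bullet> \<alpha>))"
      by (simp add: sum_subtractf[symmetric] sum_divide_distrib right_diff_distrib sum_distrib_left mult.left_commute)
  qed
  finally show ?thesis by simp
qed

section \<open>The eigenfunction\<close>

abbreviation gauss :: "real ^ 'm \<Rightarrow> real" where
  "gauss y \<equiv> exp (- (1/2) * (norm y)\<^sup>2)"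

context dunkl_setup
begin

text \<open>Absorbing the indicator lets all integrals run over the whole space. As the chamber is a
  cone, the weight remains homogeneous under positive dilations.\<close>

definition chamber_weight :: "real ^ 'm \<Rightarrow> real" where
  "chamber_weight y = indicator (weyl_chamber P) y * (\<Prod>\<alpha>\<in>P. \<alpha> \<bullet> y)"

lemma open_weyl_chamber: "open (weyl_chamber P)"
proof -
  have "weyl_chamber P = (\<Inter>\<alpha>\<in>P. {x. 0 < \<alpha> \<bullet> x})" by (auto simp: weyl_chamber_def)
  then show ?thesis
    using finite_P by (auto intro!: open_INT open_Collect_less continuous_intros)
qed

lemma exp_bounded_chamber_weight: "exp_bounded chamber_weight"
  unfolding chamber_weight_def[abs_def]
  by (intro exp_bounded_mult exp_bounded_indicator exp_bounded_prod exp_bounded_inner finite_P borel_open open_weyl_chamber)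

lemma chamber_weight_nonneg: "0 \<le> chamber_weight y"
  by (auto simp: chamber_weight_def indicator_def weyl_chamber_def intro!: prod_nonneg intro: less_imp_le)

lemma chamber_weight_pos: "y \<in> weyl_chamber P \<Longrightarrow> 0 < chamber_weight y"
  using prod_pos[of P "\<lambda>\<alpha>. \<alpha> \<bullet> y"] by (simp add: chamber_weight_def weyl_chamber_def)

lemma chamber_weight_scale: "t > 0 \<Longrightarrow> chamber_weight (t *\<^sub>R y) = t ^ card P * chamber_weight y"
  by (simp add: chamber_weight_def indicator_def weyl_chamber_def zero_less_mult_iff prod.distrib)

lemma exp_bounded_comp_W:
  assumes "exp_bounded \<phi>" and w: "w \<in> W"
  shows "exp_bounded (\<lambda>z. \<phi> (w z))"
proof -
  obtain c d where b: "\<And>z. \<bar>\<phi> z\<bar> \<le> c * exp (d * norm z)"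
    using assms unfolding exp_bounded_def by blast
  show ?thesis
  proof (rule exp_boundedI[where c = c and d = d])
    have "w \<in> borel_measurable borel"
      by (intro borel_measurable_continuous_onI linear_continuous_on bounded_linear_W w)
    then show "(\<lambda>z. \<phi> (w z)) \<in> borel_measurable borel"
      using exp_bounded_measurable[OF assms(1)] by simp
    show "\<bar>\<phi> (w z)\<bar> \<le> c * exp (d * norm z)" for z
      using b[of "w z"] by (simp add: norm_W[OF w])
  qed
qed

text \<open>Stated for an abstract \<open>S\<close> because it is used for the kernel and again for
  its directional derivatives, which together give C2. The factor \<open>p\<close> makes room for
  the multipliers that Dunkl operators create.\<close>

lemma C1_family_gauss:
  fixes S :: "real ^ 'm \<Rightarrow> real ^ 'm \<Rightarrow> real"
  assumes p: "exp_bounded p" and C1: "\<And>y. C1_deriv (S y) (S' y)"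
    and meas: "\<And>x. (\<lambda>y. S y x) \<in> borel_measurable borel" "\<And>x v. (\<lambda>y. S' y x v) \<in> borel_measurable borel"
    and bound: "\<And>x y. \<bar>S y x\<bar> \<le> a * exp (b * ((norm x + 1) * norm y))"
      "\<And>x y v. \<bar>S' y x v\<bar> \<le> a * norm v * exp (b * ((norm x + 1) * norm y))"
    and ab: "0 \<le> a" "0 \<le> b"
  shows "C1_family lborel
    (\<lambda>y x. gauss y * (chamber_weight y * (\<Sum>w\<in>W. p (w y) * S (w y) x)))
    (\<lambda>y x v. gauss y * (chamber_weight y * (\<Sum>w\<in>W. p (w y) * S' (w y) x v)))"
proof
  have S: "exp_bounded (\<lambda>y. S y x)" for x
    using bound(1)[of _ x] by (intro exp_boundedI[OF meas(1), where c = a and d = "b * (norm x + 1)"]) (simp add: mult.assoc)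
  have S': "exp_bounded (\<lambda>y. S' y x v)" for x v
    using bound(2)[of _ x v] by (intro exp_boundedI[OF meas(2), where c = "a * norm v" and d = "b * (norm x + 1)"]) (simp add: mult.assoc)
  have eb: "exp_bounded (\<lambda>y. chamber_weight y * (\<Sum>w\<in>W. p (w y) * S (w y) x))"
    "exp_bounded (\<lambda>y. chamber_weight y * (\<Sum>w\<in>W. p (w y) * S' (w y) x v))" for x v
    by (intro exp_bounded_mult[OF exp_bounded_chamber_weight] exp_bounded_sum finite_W
        exp_bounded_comp_W[OF exp_bounded_mult[OF p S]] exp_bounded_comp_W[OF exp_bounded_mult[OF p S']]; assumption)+
  show "C1_deriv (\<lambda>x. gauss y * (chamber_weight y * (\<Sum>w\<in>W. p (w y) * S (w y) x)))
      (\<lambda>x v. gauss y * (chamber_weight y * (\<Sum>w\<in>W. p (w y) * S' (w y) x v)))" for y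
    using C1_deriv_sum[OF finite_W C1, of "\<lambda>w. gauss y * chamber_weight y * p (w y)" "\<lambda>w. w y"]
    by (simp add: sum_distrib_left mult.assoc)
  show "integrable lborel (\<lambda>y. gauss y * (chamber_weight y * (\<Sum>w\<in>W. p (w y) * S (w y) x)))" for x
    by (rule integrable_gauss_exp_bounded[OF eb(1)]) simp
  show "(\<lambda>y. gauss y * (chamber_weight y * (\<Sum>w\<in>W. p (w y) * S' (w y) x v))) \<in> borel_measurable lborel" for x v
    using integrable_gauss_exp_bounded[OF eb(2)[of x v], of "1/2"] by (intro borel_measurable_integrable) simp
  fix r
  let ?h = "\<lambda>y. gauss y * (chamber_weight y * (\<Sum>w\<in>W. \<bar>p (w y)\<bar> * (a * exp (b * ((\<bar>r\<bar> + 1) * norm y)))))"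
  show "\<exists>h. integrable lborel h \<and> (\<forall>x\<in>ball 0 r. \<forall>y\<in>space lborel. \<forall>v.
    \<bar>gauss y * (chamber_weight y * (\<Sum>w\<in>W. p (w y) * S' (w y) x v))\<bar> \<le> h y * norm v)"
  proof (intro exI[of _ ?h] conjI ballI allI)
    have "exp_bounded (\<lambda>y. chamber_weight y * (\<Sum>w\<in>W. \<bar>p (w y)\<bar> * (a * exp (b * ((\<bar>r\<bar> + 1) * norm y)))))"
      by (intro exp_bounded_mult exp_bounded_chamber_weight exp_bounded_sum finite_W exp_bounded_abs
          exp_bounded_comp_W[OF p] exp_bounded_const exp_bounded_exp[of "b * (\<bar>r\<bar> + 1)", unfolded mult.assoc])
    then show "integrable lborel ?h" by (rule integrable_gauss_exp_bounded) simp
    fix x y v assume x: "x \<in> ball (0 :: real ^ 'm) r"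
    have "\<bar>\<Sum>w\<in>W. p (w y) * S' (w y) x v\<bar> \<le> (\<Sum>w\<in>W. \<bar>p (w y)\<bar> * (a * exp (b * ((\<bar>r\<bar> + 1) * norm y))) * norm v)"
    proof (rule order_trans[OF sum_abs], rule sum_mono)
      fix w assume w: "w \<in> W"
      have "\<bar>S' (w y) x v\<bar> \<le> a * norm v * exp (b * ((norm x + 1) * norm y))"
        using bound(2)[of "w y" x v] by (simp add: norm_W[OF w])
      also have "\<dots> \<le> a * norm v * exp (b * ((\<bar>r\<bar> + 1) * norm y))"
        using ab x by (intro mult_left_mono) (auto intro!: mult_right_mono mult_left_mono)
      finally have "\<bar>p (w y)\<bar> * \<bar>S' (w y) x v\<bar> \<le> \<bar>p (w y)\<bar> * (a * norm v * exp (b * ((\<bar>r\<bar> + 1) * norm y)))"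
        by (intro mult_left_mono) auto
      then show "\<bar>p (w y) * S' (w y) x v\<bar> \<le> \<bar>p (w y)\<bar> * (a * exp (b * ((\<bar>r\<bar> + 1) * norm y))) * norm v"
        by (simp add: abs_mult mult_ac)
    qed
    then have "gauss y * (chamber_weight y * \<bar>\<Sum>w\<in>W. p (w y) * S' (w y) x v\<bar>)
      \<le> gauss y * (chamber_weight y * (\<Sum>w\<in>W. \<bar>p (w y)\<bar> * (a * exp (b * ((\<bar>r\<bar> + 1) * norm y))) * norm v))"
      by (intro mult_left_mono chamber_weight_nonneg) auto
    then show "\<bar>gauss y * (chamber_weight y * (\<Sum>w\<in>W. p (w y) * S' (w y) x v))\<bar> \<le> ?h y * norm v"
      by (simp only: abs_mult abs_exp_cancel abs_of_nonneg[OF chamber_weight_nonneg] sum_distrib_right[symmetric] mult.assoc)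
  qed
qed

text \<open>The multiplier is evaluated at \<open>w y\<close> because
  \<open>dunkl_series (w y)\<close> has the coordinates of \<open>w y\<close> as eigenvalues. A
  Dunkl operator then just multiplies \<open>p\<close> by a coordinate, and the result has the same
  form.\<close>

definition gauss_transform :: "(real ^ 'm \<Rightarrow> real) \<Rightarrow> real ^ 'm \<Rightarrow> real" where
  "gauss_transform p x = (\<integral>y. gauss y *
    (chamber_weight y * (\<Sum>w\<in>W. p (w y) * dunkl_series (w y) x)) \<partial>lborel)"

lemma C1_family_series:
  assumes "exp_bounded p"
  shows "C1_family lborel
    (\<lambda>y x. gauss y * (chamber_weight y * (\<Sum>w\<in>W. p (w y) * dunkl_series (w y) x)))
    (\<lambda>y x v. gauss y * (chamber_weight y * (\<Sum>w\<in>W. p (w y) * dunkl_series_deriv (w y) x v)))"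
proof (rule C1_family_gauss[where a = 1 and b = 2, OF assms C1_dunkl_series measurable_dunkl_series(1,2)])
  show "\<bar>dunkl_series y x\<bar> \<le> 1 * exp (2 * ((norm x + 1) * norm y))" for x y
    using order_trans[OF dunkl_series_bound, of x y "exp (2 * ((norm x + 1) * norm y))"] by simp
  show "\<bar>dunkl_series_deriv y x v\<bar> \<le> 1 * norm v * exp (2 * ((norm x + 1) * norm y))" for x y v
    using dunkl_series_deriv_bound[of y x v] by (simp only: mult_1_left)
qed auto

lemma C1_family_series_deriv:
  assumes "exp_bounded p"
  shows "C1_family lborel
    (\<lambda>y x. gauss y * (chamber_weight y * (\<Sum>w\<in>W. p (w y) * dunkl_series_deriv (w y) x v)))
    (\<lambda>y x u. gauss y * (chamber_weight y * (\<Sum>w\<in>W. p (w y) * dunkl_series_deriv2 (w y) x u v)))"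
proof (rule C1_family_gauss[where a = "norm v" and b = 4, OF assms C1_dunkl_series_deriv measurable_dunkl_series(2,3)])
  show "\<bar>dunkl_series_deriv y x v\<bar> \<le> norm v * exp (4 * ((norm x + 1) * norm y))" for x y
    by (rule order_trans[OF dunkl_series_deriv_bound], rule mult_left_mono, unfold exp_le_cancel_iff, rule mult_right_mono) auto
  show "\<bar>dunkl_series_deriv2 y x u v\<bar> \<le> norm v * norm u * exp (4 * ((norm x + 1) * norm y))" for x y u
    using dunkl_series_deriv2_bound[of y x u v] by (simp only: mult.commute[of "norm u"])
qed auto

lemma C2_fun_gauss_transform:
  assumes "exp_bounded p"
  shows "C2_fun (gauss_transform p)"
proof -
  note C1 = C1_family.C1_deriv_integral[OF C1_family_series[OF assms]]
  have "partial i (gauss_transform p) = (\<lambda>x. \<integral>y. gauss y *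
    (chamber_weight y * (\<Sum>w\<in>W. p (w y) * dunkl_series_deriv (w y) x (axis i 1))) \<partial>lborel)" for i
    unfolding gauss_transform_def
    using C1 by (intro ext partial_has_derivative) (simp add: C1_deriv_def)
  then have "C1_fun (partial i (gauss_transform p))" for i
    using C1_fun_C1_deriv[OF C1_family.C1_deriv_integral[OF C1_family_series_deriv[OF assms]]] by simp
  moreover have "C1_fun (gauss_transform p)"
    unfolding gauss_transform_def by (rule C1_fun_C1_deriv[OF C1])
  ultimately show ?thesis by (simp add: C2_fun_def)
qed

lemma dunkl_op_gauss_transform:
  assumes p: "exp_bounded p"
  shows "T i (gauss_transform p) = gauss_transform (\<lambda>z. z $ i * p z)"
proof
  fix x
  have "T i (gauss_transform p) x = (\<integral>y. T i (\<lambda>x. gauss y *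
    (chamber_weight y * (\<Sum>w\<in>W. p (w y) * dunkl_series (w y) x))) x \<partial>lborel)"
    unfolding gauss_transform_def
    by (rule C1_family.dunkl_op_integral[OF C1_family_series[OF p] zero_notin_P])
  also have "\<dots> = gauss_transform (\<lambda>z. z $ i * p z) x"
    unfolding gauss_transform_def
  proof (intro Bochner_Integration.integral_cong refl)
    fix y
    let ?c = "gauss y * chamber_weight y"
    have "T i (\<lambda>x. \<Sum>w\<in>W. (?c * p (w y)) * dunkl_series (w y) x) x
      = (\<Sum>w\<in>W. (?c * p (w y)) * (w y $ i * dunkl_series (w y) x))"
      by (subst dunkl_op_sum[OF finite_W C1_dunkl_series zero_notin_P]) (simp only: dunkl_op_series)
    then show "T i (\<lambda>x. gauss y *
        (chamber_weight y * (\<Sum>w\<in>W. p (w y) * dunkl_series (w y) x))) x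
      = gauss y * (chamber_weight y * (\<Sum>w\<in>W. w y $ i * p (w y) * dunkl_series (w y) x))"
      by (simp add: sum_distrib_left mult_ac)
  qed
  finally show "T i (gauss_transform p) x = gauss_transform (\<lambda>z. z $ i * p z) x" .
qed

lemma exp_bounded_coord: "exp_bounded (\<lambda>z :: real ^ 'm. z $ i)"
  using exp_bounded_inner[of "axis i 1 :: real ^ 'm"] by (simp add: inner_axis')

lemma dunkl_laplacian_gauss_transform:
  "dunkl_laplacian P k (gauss_transform (\<lambda>z. 1)) x = gauss_transform (\<lambda>z. (norm z)\<^sup>2) x"
proof -
  have "dunkl_laplacian P k (gauss_transform (\<lambda>z. 1)) x = (\<Sum>i\<in>UNIV. gauss_transform (\<lambda>z. z $ i * (z $ i * 1)) x)"
    unfolding dunkl_laplacian_def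
    by (simp only: dunkl_op_gauss_transform exp_bounded_const exp_bounded_mult[OF exp_bounded_coord exp_bounded_const])
  also have "\<dots> = gauss_transform (\<lambda>z. (norm z)\<^sup>2) x"
    unfolding gauss_transform_def
  proof (subst Bochner_Integration.integral_sum[symmetric])
    show "integrable lborel (\<lambda>y. gauss y *
        (chamber_weight y * (\<Sum>w\<in>W. w y $ i * (w y $ i * 1) * dunkl_series (w y) x)))" for i
      by (intro C1_family.integrable[OF C1_family_series] exp_bounded_mult exp_bounded_coord exp_bounded_const)
    have "(\<Sum>i\<in>UNIV. z $ i * (z $ i * 1)) = (norm z)\<^sup>2" for z :: "real ^ 'm"
      by (simp add: power2_norm_eq_inner inner_vec_def)
    then have sq: "(norm (w y))\<^sup>2 * dunkl_series (w y) x = (\<Sum>i\<in>UNIV. w y $ i * (w y $ i * 1) * dunkl_series (w y) x)" for w y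
      by (simp only: sum_distrib_right[symmetric])
    show "(\<integral>y. (\<Sum>i\<in>UNIV. gauss y *
        (chamber_weight y * (\<Sum>w\<in>W. w y $ i * (w y $ i * 1) * dunkl_series (w y) x))) \<partial>lborel)
      = (\<integral>y. gauss y * (chamber_weight y * (\<Sum>w\<in>W. (norm (w y))\<^sup>2 * dunkl_series (w y) x)) \<partial>lborel)"
      unfolding sum_distrib_left[symmetric] sq by (subst sum.swap) (rule refl)
  qed
  finally show ?thesis .
qed

text \<open>At the origin every kernel equals 1, so the integrand is strictly positive on the
  chamber, an open nonempty set and thus not negligible. This provides the nonvanishing required of
  an eigenfunction.\<close>

lemma gauss_transform_zero_pos: "0 < gauss_transform (\<lambda>z. 1) 0"
proof -
  let ?f = "\<lambda>y. gauss y * (chamber_weight y * (\<Sum>w\<in>W. 1 * dunkl_series (w y) 0))"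
  have f: "?f y = gauss y * (chamber_weight y * card W)" for y
    by (simp add: dunkl_series_zero)
  have card: "0 < card W" using finite_W W_nonempty by (simp add: card_gt_0_iff)
  have int: "integrable lborel ?f"
    by (rule C1_family.integrable[OF C1_family_series[OF exp_bounded_const]])
  have nonneg: "0 \<le> ?f y" for y unfolding f by (simp add: chamber_weight_nonneg)
  have "gauss_transform (\<lambda>z. 1) 0 \<noteq> 0"
  proof
    assume "gauss_transform (\<lambda>z. 1) 0 = 0"
    then have "AE y in lborel. ?f y = 0"
      unfolding gauss_transform_def using integral_nonneg_eq_0_iff_AE[OF int] nonneg by simp
    then have "AE y in lborel. y \<notin> weyl_chamber P"
    proof eventually_elim
      case (elim y)
      then show ?case using chamber_weight_pos[of y] card unfolding f by auto
    qed
    then have "weyl_chamber P \<in> null_sets lborel"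
      using open_weyl_chamber by (subst AE_iff_null_sets) auto
    then have "negligible (weyl_chamber P)"
      by (simp add: negligible_iff_null_sets null_sets_completionI)
    moreover have "weyl_chamber P \<noteq> {}"
      using exists_positive_on_P by (auto simp: weyl_chamber_def)
    ultimately show False using open_not_negligible[OF open_weyl_chamber] by blast
  qed
  moreover have "0 \<le> gauss_transform (\<lambda>z. 1) 0"
    unfolding gauss_transform_def using nonneg by (intro Bochner_Integration.integral_nonneg)
  ultimately show ?thesis by simp
qed

lemma exp_bounded_sum_series:
  "exp_bounded (\<lambda>y. chamber_weight y * (\<Sum>w\<in>W. dunkl_series (w y) x))"
proof -
  have "exp_bounded (\<lambda>y. dunkl_series y x)"
    using dunkl_series_bound[of _ x] by (intro exp_boundedI[where c = 1 and d = "norm x + 1"]) auto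
  from exp_bounded_mult[OF exp_bounded_chamber_weight exp_bounded_sum[OF finite_W exp_bounded_comp_W[OF this]]]
  show ?thesis .
qed

section \<open>The dilation identity and the Euler field\<close>

lemma gauss_transform_scale:
  assumes t: "t > 0"
  shows "t ^ (card P + CARD('m)) * gauss_transform (\<lambda>z. 1) (t *\<^sub>R x) =
    (\<integral>y. exp (- (1 / (2 * t\<^sup>2)) * (norm y)\<^sup>2) * (chamber_weight y * (\<Sum>w\<in>W. dunkl_series (w y) x)) \<partial>lborel)"
proof -
  let ?F = "\<lambda>y. exp (- (1 / (2 * t\<^sup>2)) * (norm y)\<^sup>2) * (chamber_weight y * (\<Sum>w\<in>W. dunkl_series (w y) x))"
  have "?F \<in> borel_measurable borel"
    by (rule borel_measurable_times[OF _ exp_bounded_measurable[OF exp_bounded_sum_series]]) simp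
  then have "(\<integral>y. ?F y \<partial>lborel) = t ^ CARD('m) * (\<integral>y. ?F (t *\<^sub>R y) \<partial>lborel)"
    using integral_lborel_scale[OF t, of ?F] by simp
  also have "(\<integral>y. ?F (t *\<^sub>R y) \<partial>lborel) = (\<integral>y. t ^ card P * (gauss y *
      (chamber_weight y * (\<Sum>w\<in>W. 1 * dunkl_series (w y) (t *\<^sub>R x)))) \<partial>lborel)"
  proof (intro Bochner_Integration.integral_cong refl)
    fix y :: "real ^ 'm"
    have "- (1 / (2 * t\<^sup>2)) * (norm (t *\<^sub>R y))\<^sup>2 = - (1/2) * (norm y)\<^sup>2"
      using t by (simp add: power_mult_distrib)
    moreover have "(\<Sum>w\<in>W. dunkl_series (w (t *\<^sub>R y)) x) = (\<Sum>w\<in>W. 1 * dunkl_series (w y) (t *\<^sub>R x))"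
      by (intro sum.cong refl) (simp add: dunkl_series_scale linear_W linear_scale)
    ultimately show "?F (t *\<^sub>R y) = t ^ card P * (gauss y *
      (chamber_weight y * (\<Sum>w\<in>W. 1 * dunkl_series (w y) (t *\<^sub>R x))))"
      by (simp only: chamber_weight_scale[OF t] mult_ac)
  qed
  also have "\<dots> = t ^ card P * gauss_transform (\<lambda>z. 1) (t *\<^sub>R x)"
    unfolding gauss_transform_def by (rule Bochner_Integration.integral_mult_right_zero)
  finally show ?thesis by (simp add: power_add mult_ac)
qed

lemma has_derivative_gauss_width:
  assumes F: "exp_bounded (F :: real ^ 'm \<Rightarrow> real)"
  shows "((\<lambda>t. \<integral>y. exp (- (1 / (2 * t\<^sup>2)) * (norm y)\<^sup>2) * F y \<partial>lborel) has_real_derivative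
    (\<integral>y. gauss y * ((norm y)\<^sup>2 * F y) \<partial>lborel)) (at 1)"
proof -
  let ?f = "\<lambda>t y. exp (- (1 / (2 * t\<^sup>2)) * (norm y)\<^sup>2) * F y"
  let ?f' = "\<lambda>t y s. (exp (- (1 / (2 * t\<^sup>2)) * (norm y)\<^sup>2) * ((norm y)\<^sup>2 / t ^ 3) * F y) * s"
  have [measurable]: "F \<in> borel_measurable borel" by (rule exp_bounded_measurable[OF F])
  have "((\<lambda>t. \<integral>y. ?f t y \<partial>lborel) has_derivative (\<lambda>s. \<integral>y. ?f' 1 y s \<partial>lborel)) (at 1)"
  \<comment> \<open>For \<open>t\<close> between 1/2 and 3/2 one has
    \<open>1 / (2 * t\<^sup>2) \<ge> 2/9\<close> and \<open>1 / t ^ 3 \<le> 8\<close>, the two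
    constants of the majorant.\<close>
  proof (rule has_derivative_integral[where e = "1/2" and f' = ?f' and h = "\<lambda>y. exp (- (2/9) * (norm y)\<^sup>2) * (8 * (norm y * norm y) * \<bar>F y\<bar>)"])
    have t: "1/2 < t" "t < 3/2" if "t \<in> ball (1::real) (1/2)" for t
      using that by (auto simp: dist_real_def abs_if split: if_splits)
    fix t :: real assume "t \<in> ball 1 (1/2)"
    note t = t[OF this]
    show "integrable lborel (?f t)"
      using t by (intro integrable_gauss_exp_bounded F) auto
    fix y :: "real ^ 'm"
    have "((\<lambda>t. exp (- (1 / (2 * t\<^sup>2)) * (norm y)\<^sup>2) * F y) has_real_derivative
        exp (- (1 / (2 * t\<^sup>2)) * (norm y)\<^sup>2) * ((norm y)\<^sup>2 / t ^ 3) * F y) (at t)"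
      using t by (auto intro!: derivative_eq_intros simp: power2_eq_square power3_eq_cube field_simps)
    then show "((\<lambda>t. ?f t y) has_derivative ?f' t y) (at t)"
      by (rule has_field_derivative_imp_has_derivative)
    have "t\<^sup>2 \<le> (3/2)\<^sup>2" using t by (intro power_mono) auto
    then have "2/9 \<le> 1 / (2 * t\<^sup>2)" using t by (simp add: field_simps power2_eq_square)
    then have "2/9 * (norm y)\<^sup>2 \<le> 1 / (2 * t\<^sup>2) * (norm y)\<^sup>2"
      by (rule mult_right_mono) simp
    then have e: "exp (- (1 / (2 * t\<^sup>2)) * (norm y)\<^sup>2) \<le> exp (- (2/9) * (norm y)\<^sup>2)"
      by (simp only: exp_le_cancel_iff mult_minus_left neg_le_iff_le)
    have "(1/2) ^ 3 \<le> t ^ 3" using t by (intro power_mono) auto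
    then have "1 \<le> 8 * t ^ 3" by (simp add: power3_eq_cube)
    then have "(norm y)\<^sup>2 * 1 \<le> (norm y)\<^sup>2 * (8 * t ^ 3)" by (rule mult_left_mono) simp
    then have "(norm y)\<^sup>2 / t ^ 3 \<le> 8 * (norm y * norm y)"
      using t by (simp add: divide_le_eq power2_eq_square mult_ac)
    with e have le: "exp (- (1 / (2 * t\<^sup>2)) * (norm y)\<^sup>2) * ((norm y)\<^sup>2 / t ^ 3) * \<bar>F y\<bar>
        \<le> exp (- (2/9) * (norm y)\<^sup>2) * (8 * (norm y * norm y)) * \<bar>F y\<bar>"
      using t by (intro mult_right_mono mult_mono) auto
    show "\<bar>?f' t y s\<bar> \<le> exp (- (2/9) * (norm y)\<^sup>2) * (8 * (norm y * norm y) * \<bar>F y\<bar>) * norm s" for s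
    proof -
      have "\<bar>?f' t y s\<bar> = exp (- (1 / (2 * t\<^sup>2)) * (norm y)\<^sup>2) * ((norm y)\<^sup>2 / t ^ 3) * \<bar>F y\<bar> * norm s"
        using t by (simp add: abs_mult)
      also have "\<dots> \<le> exp (- (2/9) * (norm y)\<^sup>2) * (8 * (norm y * norm y)) * \<bar>F y\<bar> * norm s"
        using le by (rule mult_right_mono) simp
      finally show ?thesis by (simp only: mult.assoc)
    qed
  next
    show "integrable lborel (\<lambda>y. exp (- (2/9) * (norm y)\<^sup>2) * (8 * (norm y * norm y) * \<bar>F y\<bar>))"
      by (intro integrable_gauss_exp_bounded exp_bounded_mult exp_bounded_const exp_bounded_norm exp_bounded_abs F) simp
  qed auto
  also have "(\<lambda>s. \<integral>y. ?f' 1 y s \<partial>lborel) = (*) (\<integral>y. gauss y * ((norm y)\<^sup>2 * F y) \<partial>lborel)"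
  proof
    fix s
    have "(\<integral>y. ?f' 1 y s \<partial>lborel) = (\<integral>y. (gauss y * ((norm y)\<^sup>2 * F y)) * s \<partial>lborel)"
      by (intro Bochner_Integration.integral_cong refl) (simp add: mult.assoc)
    also have "\<dots> = (\<integral>y. gauss y * ((norm y)\<^sup>2 * F y) \<partial>lborel) * s"
      by (rule Bochner_Integration.integral_mult_left_zero)
    finally show "(\<integral>y. ?f' 1 y s \<partial>lborel) = (\<integral>y. gauss y * ((norm y)\<^sup>2 * F y) \<partial>lborel) * s" .
  qed
  finally show ?thesis by (simp only: has_field_derivative_def)
qed

lemma euler_gauss_transform:
  "(\<Sum>i\<in>UNIV. x $ i * partial i (gauss_transform (\<lambda>z. 1)) x)
    = gauss_transform (\<lambda>z. (norm z)\<^sup>2) x - (real (card P) + real CARD('m)) * gauss_transform (\<lambda>z. 1) x"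
proof -
  let ?g = "gauss_transform (\<lambda>z. 1)" and ?N = "card P + CARD('m)"
  let ?F = "\<lambda>y. chamber_weight y * (\<Sum>w\<in>W. dunkl_series (w y) x)"
  let ?E = "\<Sum>i\<in>UNIV. x $ i * partial i ?g x"
  obtain g' where g': "(?g has_derivative g') (at x)"
    using C2_fun_gauss_transform[OF exp_bounded_const[of 1]]
    unfolding C2_fun_def C1_fun_def differentiable_def by blast
  have "((\<lambda>t. ?g (t *\<^sub>R x)) has_derivative (\<lambda>s. g' (s *\<^sub>R x))) (at 1)"
    by (rule has_derivative_compose[where f = "\<lambda>t. t *\<^sub>R x" and g = ?g])
      (auto intro!: derivative_eq_intros g')
  moreover have "(\<lambda>s. g' (s *\<^sub>R x)) = (*) ?E"
  proof
    have "g' x = ?E" by (rule directional_eq_sum_partial[OF g'])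
    then show "g' (s *\<^sub>R x) = ?E * s" for s
      by (simp only: linear_scale[OF has_derivative_linear[OF g']] real_scaleR_def mult.commute)
  qed
  ultimately have "((\<lambda>t. ?g (t *\<^sub>R x)) has_real_derivative ?E) (at 1)"
    by (simp only: has_field_derivative_def)
  then have "((\<lambda>t. t ^ ?N * ?g (t *\<^sub>R x)) has_real_derivative real ?N * ?g x + ?E) (at 1)"
    by (auto intro!: derivative_eq_intros)
  \<comment> \<open>The dilation identity is available for positive \<open>t\<close> only, which
    suffices near 1.\<close>
  then have 1: "((\<lambda>t. \<integral>y. exp (- (1 / (2 * t\<^sup>2)) * (norm y)\<^sup>2) * ?F y \<partial>lborel) has_real_derivative real ?N * ?g x + ?E) (at 1)"
    by (rule has_field_derivative_transform_within_open[where S = "{0<..}"]) (auto simp: gauss_transform_scale)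
  from DERIV_unique[OF 1 has_derivative_gauss_width[OF exp_bounded_sum_series]]
  have "real ?N * ?g x + ?E = (\<integral>y. gauss y * ((norm y)\<^sup>2 * ?F y) \<partial>lborel)" .
  \<comment> \<open>Since the group preserves norms, \<open>(norm y)\<^sup>2\<close> may be moved
    into the sum over \<open>W\<close> as \<open>(norm (w y))\<^sup>2\<close>.\<close>
  also have "\<dots> = gauss_transform (\<lambda>z. (norm z)\<^sup>2) x"
    unfolding gauss_transform_def
    by (intro Bochner_Integration.integral_cong refl) (simp add: norm_W sum_distrib_left mult_ac)
  finally show ?thesis by (simp add: algebra_simps)
qed

lemma g_integrand_eq:
  "indicator (weyl_chamber P) y *\<^sub>R g_integrand R P k x y = gauss y *
    (chamber_weight y * (\<Sum>w\<in>W. 1 * dunkl_series (w y) x))"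
  by (simp add: g_integrand_def dunkl_kernel_sym_def dunkl_kernel_eq_series chamber_weight_def)

lemma g_fun_eq: "g_fun R P k = gauss_transform (\<lambda>z. 1)"
  by (simp only: fun_eq_iff g_fun_def set_lebesgue_integral_def g_integrand_eq gauss_transform_def) simp

lemma set_integrable_g_integrand: "set_integrable lborel (weyl_chamber P) (g_integrand R P k x)"
  unfolding set_integrable_def g_integrand_eq
  by (rule C1_family.integrable[OF C1_family_series[OF exp_bounded_const]])

lemma eigenfunction_g_fun:
  "eigenfunction (\<lambda>f x. - dunkl_J P k f x) (real CARD('m) + real (card P)) (g_fun R P k)"
  unfolding eigenfunction_def g_fun_eq
proof (intro conjI allI)
  show "C2_fun (gauss_transform (\<lambda>z. 1))"
    by (rule C2_fun_gauss_transform[OF exp_bounded_const])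
  show "gauss_transform (\<lambda>z. 1) \<noteq> (\<lambda>_. 0)"
    using gauss_transform_zero_pos by (metis less_irrefl)
  show "- dunkl_J P k (gauss_transform (\<lambda>z. 1)) x = (real CARD('m) + real (card P)) * gauss_transform (\<lambda>z. 1) x" for x
    unfolding dunkl_J_def dunkl_laplacian_gauss_transform euler_gauss_transform by (simp add: algebra_simps)
qed

end

theorem corollary1:
  fixes R P :: "(real ^ 'm) set" and k :: "real ^ 'm \<Rightarrow> real"
  assumes "reduced_root_system R"
    and "positive_subsystem R P"
    and "\<forall>w\<in>refl_group R. \<forall>\<alpha>\<in>R. k (w \<alpha>) = k \<alpha>"
    and "\<forall>\<alpha>\<in>R. k \<alpha> \<ge> 1 / 2"
  shows "(\<forall>x. set_integrable lborel (weyl_chamber P) (g_integrand R P k x)) \<and>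
         eigenfunction (\<lambda>f x. - dunkl_J P k f x) (real CARD('m) + real (card P)) (g_fun R P k)"
proof -
  interpret dunkl_setup R P k
    using assms by unfold_locales (auto intro: order_trans[of 0 "1/2"])
  show ?thesis
    using set_integrable_g_integrand eigenfunction_g_fun by blast
qed

end
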